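(* Let $c\in\mathbb{R}$ and let $\{u(t,x);\ (t,x)\in\mathbb{R}_+\times\mathbb{R}^d\}$ be the random-field solution to the stochastic wave equation $\partial_t^2u=\mathcal{L}u+c+\dot F$ on $(0,\infty)\times\mathbb{R}^d$ with vanishing initial data $u(0)=0$ and $\partial_tu(0+,\cdot)=0$, where $\mathcal{L}$ is the generator of a symmetric, genuinely $d$-dimensional Lévy process with characteristic exponent $\psi$ satisfying $\lim_{\|\xi\|\to\infty}\psi(\xi)=\infty$, $\dot F$ is the centered Gaussian noise, white in time, with spatial covariance measure $\Gamma$ and spectral measure $\mu=\hat\Gamma$, and $\int_{\mathbb{R}^d}\frac{\mu(d\xi)}{1+\mathrm{Re}\,\psi(\xi)}<\infty$. Consider the conditions $$\int_{\mathbb{R}^d}\frac{|\psi(\xi)|^a\,\mu(d\xi)}{1+\mathrm{Re}\,\psi(\xi)}<\infty\quad\text{for some }a\in(0,1),\qquad( * )$$ $$\int_{\mathbb{R}^d}\frac{\|\xi\|^{2b}\,\mu(d\xi)}{1+\mathrm{Re}\,\psi(\xi)}<\infty\quad\text{for some }b\in(0,1).\qquad( ** )$$ Then: (i) If $( * )$ holds then, for every $x\in\mathbb{R}^d$, the random function $t\mapsto u(t,x)$ is a.s. locally Hölder continuous. (ii) If $( * )$ fails then, for every $x\in\mathbb{R}^d$, $t\mapsto u(t,x)$ is a.s. not locally Hölder continuous. (iii) The function $(t,x)\mapsto u(t,x)$ is a.s. locally Hölder continuous provided that $( ** )$ holds. (iv) If $( ** )$ fails then, for every $t>0$, $x\mapsto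 u(t,x)$ is a.s. not locally Hölder continuous.
   Context: Fourier transform: $\hat f(\xi)=\int_{\mathbb{R}^d}e^{ix\cdot\xi}f(x)\,dx$. $\|\cdot\|$ is the Euclidean norm and $\mathbb{R}_+=[0,\infty)$. Lévy process: $X=\{X(t)\}_{t\ge0}$ is a Lévy process on $\mathbb{R}^d$ with $X(0)=0$; its characteristic exponent $\psi$ is defined by $\mathrm{E}\,e^{i\xi\cdot X(t)}=e^{-t\psi(\xi)}$; $\mathcal{L}$ is its generator. "Genuinely $d$-dimensional" means $\psi(\xi)=0$ only for $\xi=0$. "Symmetric" means $X$ and $-X$ have the same law, equivalently $\psi(\xi)=\psi(-\xi)=\mathrm{Re}\,\psi(\xi)\ge0$ for all $\xi$. Noise: $\Gamma$ is a tempered, nonnegative-definite Borel measure on $\mathbb{R}^d$, and $\mu=\hat\Gamma$ is its spectral measure (a tempered nonnegative Borel measure). $\dot F$ is a centered generalized Gaussian field on $\mathbb{R}_+\times\mathbb{R}^d$ with (formally) $\mathrm{Cov}[\dot F(t_1,x),\dot F(t_2,y)]=\delta_0(t_1-t_2)\Gamma(x-y)$. Solution: let $\hat\varphi(t,\xi)=t\,\mathrm{sinc}(t\sqrt{\psi(\xi)})$ with $\mathrm{sinc}(a)=\sin(a)/a$ for $a\ne0$ and $\mathrm{sinc}(0)=1$; this is the spatial Fourier transform of the fundamental solution $\varphi$ of $\partial_t^2-\mathcal{L}$. The stochastic convolution $W=\varphi*F$ is the centered Gaussian random field on $\mathbb{R}_+\times\mathbb{R}^d$ with $$\mathrm{Cov}[W(t_1,x_1),W(t_2,x_2)]=(2\pi)^{-d}\int_0^{t_1\wedge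 t_2}ds\int_{\mathbb{R}^d}\mu(d\xi)\,\hat\varphi(t_1-s,\xi)\,\overline{\hat\varphi(t_2-s,\xi)}\,e^{i(x_1-x_2)\cdot\xi},$$ well defined because $\int\mu(d\xi)/(1+\psi(\xi))<\infty$. The random-field solution with null initial data and constant drift $c$ is $u(t,x)=c\int_0^t\hat\varphi(s,0)\,ds+W(t,x)=\tfrac{c}{2}t^2+W(t,x)$. Hölder continuity: a function is locally Hölder continuous if there is an exponent $\gamma>0$ such that it is Hölder continuous with exponent $\gamma$ on every compact subset of its domain. Saying that a random field a.s. is (resp. a.s. is not) locally Hölder continuous means that it a.s. has (resp. a.s. does not have) a modification that is locally Hölder continuous. *)

theory Defs
  imports "HOL-Probability.Probability"
begin

text \<open>
  The space \<open>\<real>\<^sup>d\<close> is a type \<open>'a\<close> of class \<^class>\<open>euclidean_space\<close>, with \<open>d = DIM('a)\<close>.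
\<close>

section \<open>Test functions, the Fourier transform, and spectral measures\<close>

fun iterated_partial ::
  "'b list \<Rightarrow> ('b::euclidean_space \<Rightarrow> 'c::real_normed_vector) \<Rightarrow> 'b \<Rightarrow> 'c" where
  "iterated_partial [] f = f"
| "iterated_partial (v # vs) f =
     (\<lambda>x. frechet_derivative (iterated_partial vs f) (at x) v)"

definition schwartz :: "('b::euclidean_space \<Rightarrow> 'c::real_normed_vector) \<Rightarrow> bool" where
  "schwartz f \<longleftrightarrow>
     (\<forall>vs. set vs \<subseteq> Basis \<longrightarrow>
        (\<forall>x. iterated_partial vs f differentiable (at x)) \<and>
        (\<forall>k::nat. \<exists>C. \<forall>x. (1 + norm x) ^ k * norm (iterated_partial vs f x) \<le> C))"

definition fourier :: "('a::euclidean_space \<Rightarrow> complex) \<Rightarrow> 'a \<Rightarrow> complex" where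
  "fourier f \<xi> = (LINT x|lborel. exp (\<i> * complex_of_real (x \<bullet> \<xi>)) * f x)"

definition tempered_measure :: "'a::euclidean_space measure \<Rightarrow> bool" where
  "tempered_measure \<nu> \<longleftrightarrow>
     sets \<nu> = sets borel \<and>
     (\<exists>k::nat. (\<integral>\<^sup>+x. ennreal (1 / (1 + norm x) ^ k) \<partial>\<nu>) < \<infinity>)"

definition nonneg_definite_measure :: "'a::euclidean_space measure \<Rightarrow> bool" where
  "nonneg_definite_measure \<Gamma> \<longleftrightarrow>
     (\<forall>h :: 'a \<Rightarrow> complex. schwartz h \<longrightarrow>
        (LINT z|\<Gamma>. LINT y|lborel. h y * cnj (h (y - z))) \<in> \<real>\<^sub>\<ge>\<^sub>0)"

text \<open>\<open>\<mu>\<close> is the Fourier transform of \<open>\<Gamma>\<close> in the sense of tempered distributions.\<close>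

definition spectral_measure ::
  "'a::euclidean_space measure \<Rightarrow> 'a measure \<Rightarrow> bool" where
  "spectral_measure \<Gamma> \<mu> \<longleftrightarrow>
     tempered_measure \<mu> \<and>
     (\<forall>h :: 'a \<Rightarrow> complex. schwartz h \<longrightarrow>
        (LINT x|\<Gamma>. fourier h x) = (LINT \<xi>|\<mu>. h \<xi>))"

section \<open>Levy processes\<close>

definition levy_process ::
  "'v measure \<Rightarrow> (real \<Rightarrow> 'v \<Rightarrow> 'a::euclidean_space) \<Rightarrow> bool" where
  "levy_process N X \<longleftrightarrow>
     prob_space N \<and>
     (\<forall>t\<ge>0. X t \<in> borel_measurable N) \<and>
     (AE \<omega> in N. X 0 \<omega> = 0) \<and>
     (\<forall>(n::nat) (t :: nat \<Rightarrow> real). 0 \<le> t 0 \<and> (\<forall>i<n. t i < t (Suc i)) \<longrightarrow>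
        prob_space.indep_vars N (\<lambda>_. borel)
          (\<lambda>i \<omega>. X (t (Suc i)) \<omega> - X (t i) \<omega>) {..<n}) \<and>
     (\<forall>s\<ge>0. \<forall>t\<ge>0.
        distr N borel (\<lambda>\<omega>. X (s + t) \<omega> - X s \<omega>) = distr N borel (X t)) \<and>
     (\<forall>t\<ge>0. \<forall>\<epsilon>>0.
        ((\<lambda>s. measure N {\<omega> \<in> space N. norm (X s \<omega> - X t \<omega>) > \<epsilon>}) \<longlongrightarrow> 0)
          (at t within {0..})) \<and>
     (AE \<omega> in N. \<forall>t\<ge>0.
        ((\<lambda>s. X s \<omega>) \<longlongrightarrow> X t \<omega>) (at_right t) \<and>
        (t > 0 \<longrightarrow> (\<exists>l. ((\<lambda>s. X s \<omega>) \<longlongrightarrow> l) (at_left t))))"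

definition process_law ::
  "'v measure \<Rightarrow> (real \<Rightarrow> 'v \<Rightarrow> 'a::euclidean_space) \<Rightarrow> (real \<Rightarrow> 'a) measure" where
  "process_law N X =
     distr N (PiM {0..} (\<lambda>_. borel)) (\<lambda>\<omega>. \<lambda>t\<in>{0..}. X t \<omega>)"

definition symmetric_process ::
  "'v measure \<Rightarrow> (real \<Rightarrow> 'v \<Rightarrow> 'a::euclidean_space) \<Rightarrow> bool" where
  "symmetric_process N X \<longleftrightarrow> process_law N X = process_law N (\<lambda>t \<omega>. - X t \<omega>)"

definition characteristic_exponent ::
  "'v measure \<Rightarrow> (real \<Rightarrow> 'v \<Rightarrow> 'a::euclidean_space) \<Rightarrow> ('a \<Rightarrow> complex) \<Rightarrow> bool" where
  "characteristic_exponent N X \<psi> \<longleftrightarrow>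
     (\<forall>t\<ge>0. \<forall>\<xi>.
        (LINT \<omega>|N. exp (\<i> * complex_of_real (\<xi> \<bullet> X t \<omega>))) = exp (- complex_of_real t * \<psi> \<xi>))"

definition genuinely_full_dimensional :: "('a::euclidean_space \<Rightarrow> complex) \<Rightarrow> bool" where
  "genuinely_full_dimensional \<psi> \<longleftrightarrow> (\<forall>\<xi>. \<psi> \<xi> = 0 \<longrightarrow> \<xi> = 0)"

section \<open>Gaussian fields, the noise, and the random-field solution\<close>

text \<open>Degenerate (zero-variance) Gaussian variables are included.\<close>

definition centered_gaussian :: "'w measure \<Rightarrow> ('w \<Rightarrow> real) \<Rightarrow> bool" where
  "centered_gaussian M Z \<longleftrightarrow>
     Z \<in> borel_measurable M \<and>
     ((AE \<omega> in M. Z \<omega> = 0) \<or>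
      (\<exists>\<sigma>>0. distributed M lborel Z (normal_density 0 \<sigma>)))"

definition centered_gaussian_field ::
  "'w measure \<Rightarrow> 'i set \<Rightarrow> ('i \<Rightarrow> 'w \<Rightarrow> real) \<Rightarrow> bool" where
  "centered_gaussian_field M I Z \<longleftrightarrow>
     (\<forall>J (a :: 'i \<Rightarrow> real). finite J \<and> J \<subseteq> I \<longrightarrow>
        centered_gaussian M (\<lambda>\<omega>. \<Sum>i\<in>J. a i * Z i \<omega>))"

definition cov :: "'w measure \<Rightarrow> ('w \<Rightarrow> real) \<Rightarrow> ('w \<Rightarrow> real) \<Rightarrow> real" where
  "cov M Y Z =
     (LINT \<omega>|M. (Y \<omega> - (LINT \<omega>'|M. Y \<omega>')) * (Z \<omega> - (LINT \<omega>'|M. Z \<omega>')))"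

text \<open>
  The generalized field is indexed by real Schwartz functions on \<open>\<real> \<times> \<real>\<^sup>d\<close>; only their values at
  nonnegative times matter, since the covariance form integrates over \<open>t \<ge> 0\<close>.  That form is
  \<open>\<integral>\<integral>\<integral> h (t, x) g (t, y) \<Gamma>(x - y) dx dy dt\<close> after the substitution \<open>z = x - y\<close>.
\<close>

definition white_in_time_noise ::
  "'w measure \<Rightarrow> 'a::euclidean_space measure \<Rightarrow> ((real \<times> 'a \<Rightarrow> real) \<Rightarrow> 'w \<Rightarrow> real) \<Rightarrow> bool"
  where
  "white_in_time_noise M \<Gamma> F \<longleftrightarrow>
     prob_space M \<and>
     centered_gaussian_field M {h. schwartz h} F \<and>
     (\<forall>h g. schwartz h \<and> schwartz g \<longrightarrow>
        cov M (F h) (F g) =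
          (LINT t:{0..}|lborel. LINT z|\<Gamma>. LINT x|lborel. h (t, x) * g (t, x - z)))"

text \<open>The exponent is complex-valued; as \<open>csinc\<close> is even, the branch of the root is immaterial.\<close>

definition csinc :: "complex \<Rightarrow> complex" where
  "csinc z = (if z = 0 then 1 else sin z / z)"

definition phi_hat :: "('a \<Rightarrow> complex) \<Rightarrow> real \<Rightarrow> 'a::euclidean_space \<Rightarrow> complex" where
  "phi_hat \<psi> t \<xi> = complex_of_real t * csinc (complex_of_real t * csqrt (\<psi> \<xi>))"

text \<open>
  \<open>W = \<phi> * F\<close>: the centered Gaussian field with the covariance of the stochastic convolution.
  The joint covariance with \<open>F\<close> singles out, among all fields with that covariance,
  the Wiener integral \<open>W t x = \<integral>\<integral> \<phi>(t - s, x - y) F(ds dy)\<close> on the given probability space: the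
  spatial Fourier transform of its integrand is \<open>\<xi> \<mapsto> phi_hat \<psi> (t - s) \<xi> * exp (\<i> x \<bullet> \<xi>)\<close>.
\<close>

definition stochastic_convolution ::
  "'w measure \<Rightarrow> ('a::euclidean_space \<Rightarrow> complex) \<Rightarrow> 'a measure \<Rightarrow>
   ((real \<times> 'a \<Rightarrow> real) \<Rightarrow> 'w \<Rightarrow> real) \<Rightarrow> (real \<Rightarrow> 'a \<Rightarrow> 'w \<Rightarrow> real) \<Rightarrow> bool" where
  "stochastic_convolution M \<psi> \<mu> F W \<longleftrightarrow>
     centered_gaussian_field M (({0..} \<times> UNIV) <+> {h. schwartz h})
       (case_sum (\<lambda>(t, x). W t x) F) \<and>
     (\<forall>t\<^sub>1\<ge>0. \<forall>t\<^sub>2\<ge>0. \<forall>x\<^sub>1 x\<^sub>2.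
        complex_of_real (cov M (W t\<^sub>1 x\<^sub>1) (W t\<^sub>2 x\<^sub>2)) =
          complex_of_real (1 / (2 * pi) ^ DIM('a)) *
          (LINT s:{0..min t\<^sub>1 t\<^sub>2}|lborel. LINT \<xi>|\<mu>.
             phi_hat \<psi> (t\<^sub>1 - s) \<xi> * cnj (phi_hat \<psi> (t\<^sub>2 - s) \<xi>) *
             exp (\<i> * complex_of_real ((x\<^sub>1 - x\<^sub>2) \<bullet> \<xi>)))) \<and>
     (\<forall>t\<ge>0. \<forall>x h. schwartz h \<longrightarrow>
        complex_of_real (cov M (W t x) (F h)) =
          complex_of_real (1 / (2 * pi) ^ DIM('a)) *
          (LINT s:{0..t}|lborel. LINT \<xi>|\<mu>.
             phi_hat \<psi> (t - s) \<xi> * exp (\<i> * complex_of_real (x \<bullet> \<xi>)) *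
             cnj (fourier (\<lambda>y. complex_of_real (h (s, y))) \<xi>)))"

definition random_field_solution ::
  "'w measure \<Rightarrow> ('a::euclidean_space \<Rightarrow> complex) \<Rightarrow> 'a measure \<Rightarrow>
   ((real \<times> 'a \<Rightarrow> real) \<Rightarrow> 'w \<Rightarrow> real) \<Rightarrow> real \<Rightarrow> (real \<Rightarrow> 'a \<Rightarrow> 'w \<Rightarrow> real) \<Rightarrow> bool" where
  "random_field_solution M \<psi> \<mu> F c u \<longleftrightarrow>
     (\<exists>W. stochastic_convolution M \<psi> \<mu> F W \<and>
        (\<forall>t\<ge>0. \<forall>x. \<forall>\<omega>\<in>space M.
           complex_of_real (u t x \<omega>) =
             complex_of_real c * (LINT s:{0..t}|lborel. phi_hat \<psi> s 0) +
             complex_of_real (W t x \<omega>)))"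

section \<open>Hoelder continuity\<close>

definition hoelder_on ::
  "real \<Rightarrow> 'p::metric_space set \<Rightarrow> ('p \<Rightarrow> 'q::metric_space) \<Rightarrow> bool" where
  "hoelder_on \<gamma> K f \<longleftrightarrow> (\<exists>C. \<forall>x\<in>K. \<forall>y\<in>K. dist (f x) (f y) \<le> C * dist x y powr \<gamma>)"

definition locally_hoelder_on ::
  "'p::metric_space set \<Rightarrow> ('p \<Rightarrow> 'q::metric_space) \<Rightarrow> bool" where
  "locally_hoelder_on D f \<longleftrightarrow>
     (\<exists>\<gamma>>0. \<forall>K. compact K \<and> K \<subseteq> D \<longrightarrow> hoelder_on \<gamma> K f)"

definition modification ::
  "'w measure \<Rightarrow> 'p set \<Rightarrow> ('p \<Rightarrow> 'w \<Rightarrow> real) \<Rightarrow> ('p \<Rightarrow> 'w \<Rightarrow> real) \<Rightarrow> bool" where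
  "modification M D Z Y \<longleftrightarrow>
     (\<forall>p\<in>D. Y p \<in> borel_measurable M \<and> (AE \<omega> in M. Y p \<omega> = Z p \<omega>))"

definition as_locally_hoelder ::
  "'w measure \<Rightarrow> 'p::metric_space set \<Rightarrow> ('p \<Rightarrow> 'w \<Rightarrow> real) \<Rightarrow> bool" where
  "as_locally_hoelder M D Z \<longleftrightarrow>
     (\<exists>Y. modification M D Z Y \<and> (AE \<omega> in M. locally_hoelder_on D (\<lambda>p. Y p \<omega>)))"

text \<open>
  Almost surely not locally Hoelder: no modification has locally Hoelder sample functions, outside
  a null set.  This is stronger than the negation of \<open>as_locally_hoelder\<close>.
\<close>

definition as_not_locally_hoelder ::
  "'w measure \<Rightarrow> 'p::metric_space set \<Rightarrow> ('p \<Rightarrow> 'w \<Rightarrow> real) \<Rightarrow> bool" where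
  "as_not_locally_hoelder M D Z \<longleftrightarrow>
     (\<forall>Y. modification M D Z Y \<longrightarrow> (AE \<omega> in M. \<not> locally_hoelder_on D (\<lambda>p. Y p \<omega>)))"

section \<open>The integrability conditions\<close>

definition dalang_condition ::
  "('a::euclidean_space \<Rightarrow> complex) \<Rightarrow> 'a measure \<Rightarrow> bool" where
  "dalang_condition \<psi> \<mu> \<longleftrightarrow> (\<integral>\<^sup>+\<xi>. ennreal (1 / (1 + Re (\<psi> \<xi>))) \<partial>\<mu>) < \<infinity>"

definition temporal_condition ::
  "('a::euclidean_space \<Rightarrow> complex) \<Rightarrow> 'a measure \<Rightarrow> bool" where
  "temporal_condition \<psi> \<mu> \<longleftrightarrow>
     (\<exists>a::real. 0 < a \<and> a < 1 \<and>
        (\<integral>\<^sup>+\<xi>. ennreal (cmod (\<psi> \<xi>) powr a / (1 + Re (\<psi> \<xi>))) \<partial>\<mu>) < \<infinity>)"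

definition spatial_condition ::
  "('a::euclidean_space \<Rightarrow> complex) \<Rightarrow> 'a measure \<Rightarrow> bool" where
  "spatial_condition \<psi> \<mu> \<longleftrightarrow>
     (\<exists>b::real. 0 < b \<and> b < 1 \<and>
        (\<integral>\<^sup>+\<xi>. ennreal (norm \<xi> powr (2 * b) / (1 + Re (\<psi> \<xi>))) \<partial>\<mu>) < \<infinity>)"

end

theory Submission
  imports Defs
begin

text \<open>
  For a symmetric process the exponent \<open>\<psi>\<close> is real, nonnegative and continuous, so
  \<open>phi_hat \<psi> t \<xi> = sin (t \<rho>) / \<rho>\<close> with \<open>\<rho> = sqrt (\<psi> \<xi>)\<close>. The solution is the smooth drift
  \<open>c t\<^sup>2 / 2\<close> plus the Gaussian field \<open>W\<close>, and both directions of the theorem come down to the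
  variances of the increments of \<open>W\<close>. These are double integrals over
  time and frequency (\<open>convolution_increment_spectral\<close>).

  \<^emph>\<open>Sufficiency.\<close> The time increment of \<open>sin (t \<rho>) / \<rho>\<close> is bounded both by \<open>|h|\<close> and by a multiple of
  \<open>1 / \<rho>\<close>. Interpolating the two gives \<open>E (W (t + h, x) - W (t, x))\<^sup>2 = O(|h| powr (2 a))\<close> whenever
  \<open>\<integral> \<psi>\<^sup>a / (1 + \<psi>) d\<mu>\<close> is finite; in space \<open>1 - cos \<theta> \<le> 2 |\<theta>| powr (2 b)\<close> plays this role. As
  \<open>\<psi> \<xi> = O(1 + \<parallel>\<xi>\<parallel>\<^sup>2)\<close>, the spatial condition implies the temporal one, so that it
  controls joint increments. A power bound on the variance of a Gaussian increment is a
  power bound on all its moments, and a chaining argument in the spirit of Kolmogorov and Chentsov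
  (\<open>hoelder_modification_of_moment_bound\<close>) produces the Hoelder modification.

  \<^emph>\<open>Necessity.\<close> If a modification is locally Hoelder with positive probability, then the
  normalised increments \<open>|W p - W p0| / dist p p0 powr \<gamma>\<close> over a countable set of points \<open>p\<close> near \<open>p0\<close> are
  bounded by a constant with positive probability. A Gaussian variable with large variance
  is unlikely to lie in a fixed interval, so the variances of these increments are
  bounded as well (\<open>as_not_locally_hoelder_gaussian\<close>). It remains to recover the integrability
  condition from \<open>E (W p - W p0)\<^sup>2 = O(dist p p0 powr (2 \<gamma>))\<close> along the points at dyadic distances. The variance
  dominates \<open>\<integral> (1 - cos (f / 2 ^ n)) / (1 + \<psi>) d\<mu>\<close> over large \<open>\<rho>\<close>, where \<open>f = \<rho>\<close> in time and
  \<open>f \<xi> = \<xi> \<bullet> i\<close> in space, and summing over \<open>n\<close> with weights \<open>4 powr (b n)\<close>, \<open>b < \<gamma>\<close>, controls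
  \<open>\<integral> |f| powr (2 b) / (1 + \<psi>) d\<mu>\<close> (\<open>nn_integral_powr_of_dyadic_cos\<close>).
\<close>

section \<open>Moments, small balls and increments of centered Gaussian variables\<close>

lemma centered_gaussian_even_moment:
  assumes "prob_space M" and Z: "centered_gaussian M Z"
  shows "integrable M (\<lambda>\<omega>. Z \<omega> ^ (2 * k))"
    and "(LINT \<omega>|M. Z \<omega> ^ (2 * k)) = fact (2 * k) / (2 ^ k * fact k) * (LINT \<omega>|M. (Z \<omega>)\<^sup>2) ^ k"
proof -
  interpret prob_space M by fact
  have [measurable]: "Z \<in> borel_measurable M" using Z by (simp add: centered_gaussian_def)
  have "integrable M (\<lambda>\<omega>. Z \<omega> ^ (2 * k)) \<and>
     (LINT \<omega>|M. Z \<omega> ^ (2 * k)) = fact (2 * k) / (2 ^ k * fact k) * (LINT \<omega>|M. (Z \<omega>)\<^sup>2) ^ k"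
  proof (cases "AE \<omega> in M. Z \<omega> = 0")
    case True
    have eq: "(LINT \<omega>|M. Z \<omega> ^ j) = (LINT \<omega>|M. 0 ^ j)" for j
      using True by (intro integral_cong_AE) auto
    have "integrable M (\<lambda>\<omega>. Z \<omega> ^ (2 * k)) \<longleftrightarrow> integrable M (\<lambda>\<omega>. (0::real) ^ (2 * k))"
      using True by (intro integrable_cong_AE) auto
    then show ?thesis by (cases "k = 0") (simp_all add: eq prob_space power_0_left)
  next
    case False
    then obtain \<sigma> where \<sigma>: "\<sigma> > 0" and D: "distributed M lborel Z (normal_density 0 \<sigma>)"
      using Z by (auto simp: centered_gaussian_def)
    have I: "integrable M (\<lambda>\<omega>. Z \<omega> ^ j)" for j
      using distributed_integrable[OF D, of "\<lambda>x. x ^ j"] integrable_normal_moment[OF \<sigma>, of 0 j] by simp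
    have E: "(LINT \<omega>|M. Z \<omega> ^ (2 * j)) = fact (2 * j) / ((2 / \<sigma>\<^sup>2) ^ j * fact j)" for j
      using distributed_integral[OF D, of "\<lambda>x. x ^ (2 * j)"] integral_normal_moment_even[OF \<sigma>, of 0 j]
      by simp
    have "(LINT \<omega>|M. (Z \<omega>)\<^sup>2) = \<sigma>\<^sup>2"
      using E[of 1] by (simp add: fact_numeral)
    then show ?thesis using I E[of k] by (simp add: power_divide)
  qed
  then show "integrable M (\<lambda>\<omega>. Z \<omega> ^ (2 * k))"
    and "(LINT \<omega>|M. Z \<omega> ^ (2 * k)) = fact (2 * k) / (2 ^ k * fact k) * (LINT \<omega>|M. (Z \<omega>)\<^sup>2) ^ k" by auto
qed

lemma centered_gaussian_square_integrable:
  assumes "prob_space M" and "centered_gaussian M Z"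
  shows "integrable M (\<lambda>\<omega>. (Z \<omega>)\<^sup>2)"
  using centered_gaussian_even_moment(1)[OF assms, of 1] by simp

lemma centered_gaussian_mean:
  assumes "prob_space M" and Z: "centered_gaussian M Z"
  shows "(LINT \<omega>|M. Z \<omega>) = 0"
proof -
  interpret prob_space M by fact
  have [measurable]: "Z \<in> borel_measurable M" using Z by (simp add: centered_gaussian_def)
  show ?thesis
  proof (cases "AE \<omega> in M. Z \<omega> = 0")
    case True
    then have "(LINT \<omega>|M. Z \<omega>) = (LINT \<omega>|M. 0)" by (intro integral_cong_AE) auto
    then show ?thesis by simp
  next
    case False
    then obtain \<sigma> where \<sigma>: "\<sigma> > 0" and D: "distributed M lborel Z (normal_density 0 \<sigma>)"
      using Z by (auto simp: centered_gaussian_def)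
    show ?thesis
      using distributed_integral[OF D, of "\<lambda>x. x"] integral_normal_moment_nz_1[OF \<sigma>, of 0] by simp
  qed
qed

text \<open>
  The density of a centered normal variable is at most \<open>1 / (2 \<sigma>)\<close>, so it charges \<open>[-r, r]\<close> with
  mass at most \<open>r / \<sigma>\<close>. Conversely, a lower bound on that mass bounds the variance. Stated with
  squares, the estimate also covers the degenerate case.
\<close>

lemma centered_gaussian_small_ball:
  assumes "prob_space M" and Z: "centered_gaussian M Z" and r: "0 \<le> r"
  shows "(measure M {\<omega> \<in> space M. \<bar>Z \<omega>\<bar> \<le> r})\<^sup>2 * (LINT \<omega>|M. (Z \<omega>)\<^sup>2) \<le> r\<^sup>2"
proof -
  interpret prob_space M by fact
  have [measurable]: "Z \<in> borel_measurable M" using Z by (simp add: centered_gaussian_def)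
  show ?thesis
  proof (cases "AE \<omega> in M. Z \<omega> = 0")
    case True
    then have "(LINT \<omega>|M. (Z \<omega>)\<^sup>2) = (LINT \<omega>|M. 0)" by (intro integral_cong_AE) auto
    then show ?thesis by simp
  next
    case False
    then obtain \<sigma> where \<sigma>: "\<sigma> > 0" and D: "distributed M lborel Z (normal_density 0 \<sigma>)"
      using Z by (auto simp: centered_gaussian_def)
    have var: "(LINT \<omega>|M. (Z \<omega>)\<^sup>2) = \<sigma>\<^sup>2"
      using distributed_integral[OF D, of "\<lambda>x. x\<^sup>2"] integral_normal_moment_even[OF \<sigma>, of 0 1]
      by (simp add: fact_numeral)
    have dens: "normal_density 0 \<sigma> x \<le> 1 / (2 * \<sigma>)" for x
    proof -
      have "2 \<le> sqrt (2 * pi)" using pi_ge_two by (intro real_le_rsqrt) auto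
      then have "2 * \<sigma> \<le> sqrt (2 * pi * \<sigma>\<^sup>2)" using \<sigma> by (simp add: real_sqrt_mult)
      then have "1 / sqrt (2 * pi * \<sigma>\<^sup>2) * exp (-(x - 0)\<^sup>2 / (2 * \<sigma>\<^sup>2)) \<le> 1 / (2 * \<sigma>) * 1"
        using \<sigma> by (intro mult_mono divide_left_mono) auto
      then show ?thesis by (simp add: normal_density_def)
    qed
    have set_eq: "{\<omega> \<in> space M. \<bar>Z \<omega>\<bar> \<le> r} = Z -` {-r..r} \<inter> space M" by auto
    have "emeasure M {\<omega> \<in> space M. \<bar>Z \<omega>\<bar> \<le> r}
        = (\<integral>\<^sup>+x. ennreal (normal_density 0 \<sigma> x) * indicator {-r..r} x \<partial>lborel)"
      unfolding set_eq by (rule distributed_emeasure[OF D]) simp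
    also have "\<dots> \<le> (\<integral>\<^sup>+x. ennreal (1 / (2 * \<sigma>)) * indicator {-r..r} x \<partial>lborel)"
      by (intro nn_integral_mono mult_right_mono ennreal_leI dens) auto
    also have "\<dots> = ennreal (r / \<sigma>)"
      using \<sigma> r by (simp add: nn_integral_cmult_indicator ennreal_mult[symmetric])
    finally have "measure M {\<omega> \<in> space M. \<bar>Z \<omega>\<bar> \<le> r} \<le> r / \<sigma>"
      using \<sigma> r by (simp add: emeasure_eq_measure)
    then have "measure M {\<omega> \<in> space M. \<bar>Z \<omega>\<bar> \<le> r} * \<sigma> \<le> r" using \<sigma> by (simp add: field_simps)
    then have "(measure M {\<omega> \<in> space M. \<bar>Z \<omega>\<bar> \<le> r} * \<sigma>)\<^sup>2 \<le> r\<^sup>2"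
      using \<sigma> by (intro power_mono) auto
    then show ?thesis by (simp add: var power_mult_distrib)
  qed
qed

lemma centered_gaussian_field_single:
  assumes "centered_gaussian_field M I Z" and "i \<in> I"
  shows "centered_gaussian M (Z i)"
  using assms(1)[unfolded centered_gaussian_field_def, rule_format, of "{i}" "\<lambda>_. 1"] assms(2) by simp

lemma centered_gaussian_field_diff:
  assumes "prob_space M" and Z: "centered_gaussian_field M I Z" and "i \<in> I" and "j \<in> I"
  shows "centered_gaussian M (\<lambda>\<omega>. Z i \<omega> - Z j \<omega>)"
proof (cases "i = j")
  case True
  then show ?thesis by (simp add: centered_gaussian_def)
next
  case False
  then show ?thesis
    using Z[unfolded centered_gaussian_field_def, rule_format, of "{i, j}" "\<lambda>k. if k = i then 1 else -1"]
      assms(3,4) by simp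
qed

lemma centered_gaussian_cov:
  assumes "prob_space M" and "centered_gaussian M Y" and "centered_gaussian M Z"
  shows "cov M Y Z = (LINT \<omega>|M. Y \<omega> * Z \<omega>)"
  using assms by (simp add: cov_def centered_gaussian_mean)

lemma abs_mult_le_sum_squares:
  fixes a b :: real
  shows "\<bar>a * b\<bar> \<le> a\<^sup>2 + b\<^sup>2"
proof -
  have "0 \<le> \<bar>a\<bar> * \<bar>b\<bar>" by simp
  moreover have "2 * (\<bar>a\<bar> * \<bar>b\<bar>) \<le> a\<^sup>2 + b\<^sup>2"
    using sum_squares_bound[of "\<bar>a\<bar>" "\<bar>b\<bar>"] by simp
  ultimately show ?thesis unfolding abs_mult by linarith
qed

lemma centered_gaussian_diff_second_moment:
  assumes "prob_space M" and Y: "centered_gaussian M Y" and Z: "centered_gaussian M Z"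
  shows "(LINT \<omega>|M. (Y \<omega> - Z \<omega>)\<^sup>2) = cov M Y Y + cov M Z Z - 2 * cov M Y Z"
proof -
  interpret prob_space M by fact
  have [measurable]: "Y \<in> borel_measurable M" "Z \<in> borel_measurable M"
    using Y Z by (simp_all add: centered_gaussian_def)
  note sq = centered_gaussian_square_integrable[OF assms(1) Y] centered_gaussian_square_integrable[OF assms(1) Z]
  have YZ: "integrable M (\<lambda>\<omega>. Y \<omega> * Z \<omega>)"
  proof (rule Bochner_Integration.integrable_bound)
    show "integrable M (\<lambda>\<omega>. (Y \<omega>)\<^sup>2 + (Z \<omega>)\<^sup>2)" using sq by simp
    show "AE \<omega> in M. norm (Y \<omega> * Z \<omega>) \<le> norm ((Y \<omega>)\<^sup>2 + (Z \<omega>)\<^sup>2)"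
      using abs_mult_le_sum_squares by simp
  qed simp
  have "(LINT \<omega>|M. (Y \<omega> - Z \<omega>)\<^sup>2) = (LINT \<omega>|M. ((Y \<omega>)\<^sup>2 + (Z \<omega>)\<^sup>2) - 2 * (Y \<omega> * Z \<omega>))"
    by (intro Bochner_Integration.integral_cong) (auto simp: power2_diff)
  also have "\<dots> = (LINT \<omega>|M. (Y \<omega>)\<^sup>2) + (LINT \<omega>|M. (Z \<omega>)\<^sup>2) - 2 * (LINT \<omega>|M. Y \<omega> * Z \<omega>)"
    using sq YZ by simp
  finally show ?thesis
    using assms by (simp add: centered_gaussian_cov power2_eq_square)
qed

section \<open>Hoelder modifications by chaining along dyadic grids\<close>

definition dyadic_round :: "nat \<Rightarrow> 'b::euclidean_space \<Rightarrow> 'b" where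
  "dyadic_round n p = (\<Sum>i\<in>Basis. (of_int \<lfloor>2 ^ n * (p \<bullet> i)\<rfloor> / 2 ^ n) *\<^sub>R i)"

lemma dist_dyadic_round:
  fixes p :: "'b::euclidean_space"
  shows "dist (dyadic_round n p) p \<le> DIM('b) / 2 ^ n"
proof -
  have "\<bar>(dyadic_round n p - p) \<bullet> i\<bar> \<le> 1 / 2 ^ n" if "i \<in> Basis" for i
  proof -
    have "(dyadic_round n p - p) \<bullet> i = (of_int \<lfloor>2 ^ n * (p \<bullet> i)\<rfloor> - 2 ^ n * (p \<bullet> i)) / 2 ^ n"
      using that by (simp add: dyadic_round_def inner_diff_left field_simps)
    moreover have "\<bar>of_int \<lfloor>2 ^ n * (p \<bullet> i)\<rfloor> - 2 ^ n * (p \<bullet> i)\<bar> \<le> 1" by linarith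
    ultimately show ?thesis by (simp add: divide_right_mono)
  qed
  then have "norm (dyadic_round n p - p) \<le> (\<Sum>i\<in>(Basis::'b set). 1 / 2 ^ n)"
    by (intro order_trans[OF norm_le_l1] sum_mono) auto
  then show ?thesis by (simp add: dist_norm)
qed

text \<open>
  Grid points are determined by \<open>d\<close> integers of size at most \<open>2 ^ n R + 1\<close>.
\<close>

lemma card_dyadic_round_cball:
  fixes R n :: nat
  defines "G \<equiv> dyadic_round n ` cball (0 :: 'b::euclidean_space) (real R)"
  shows "finite G" and "card G \<le> ((2 * R + 3) * 2 ^ n) ^ DIM('b)"
proof -
  define L :: int where "L = 2 ^ n * int R + 1"
  define F where "F = (\<lambda>k::'b \<Rightarrow> int. \<Sum>i\<in>Basis. (of_int (k i) / 2 ^ n) *\<^sub>R i)"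
  define E where "E = PiE (Basis::'b set) (\<lambda>_. {-L..L})"
  have fin: "finite E" unfolding E_def by (intro finite_PiE) auto
  have sub: "G \<subseteq> F ` E"
  proof
    fix g assume "g \<in> G"
    then obtain p where p: "norm p \<le> real R" and g: "g = dyadic_round n p"
      by (auto simp: G_def)
    define k where "k = (\<lambda>i\<in>(Basis::'b set). \<lfloor>2 ^ n * (p \<bullet> i)\<rfloor>)"
    have "\<lfloor>2 ^ n * (p \<bullet> i)\<rfloor> \<in> {-L..L}" if "i \<in> Basis" for i
    proof -
      have "\<bar>p \<bullet> i\<bar> \<le> real R" using Basis_le_norm[OF that, of p] p by linarith
      then have "\<bar>2 ^ n * (p \<bullet> i)\<bar> \<le> 2 ^ n * real R" by (simp add: abs_mult)
      then have "- (2 ^ n * real R) \<le> 2 ^ n * (p \<bullet> i)" "2 ^ n * (p \<bullet> i) \<le> 2 ^ n * real R"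
        by linarith+
      moreover have "of_int (2 ^ n * int R) = (2 ^ n * real R :: real)" by simp
      ultimately show ?thesis unfolding L_def
        by (auto simp only: atLeastAtMost_iff le_floor_iff floor_le_iff)
    qed
    then have "k \<in> E" by (simp add: k_def E_def)
    moreover have "F k = g" by (simp add: F_def k_def g dyadic_round_def cong: sum.cong)
    ultimately show "g \<in> F ` E" by blast
  qed
  then show "finite G" using fin finite_subset by blast
  have "card G \<le> card (F ` E)" using sub fin by (intro card_mono) auto
  also have "\<dots> \<le> card E" by (rule card_image_le[OF fin])
  also have "\<dots> = nat (2 * L + 1) ^ DIM('b)" by (simp add: E_def card_PiE)
  also have "nat (2 * L + 1) = 2 * (2 ^ n * R) + 3"
    by (simp add: L_def nat_add_distrib nat_mult_distrib nat_power_eq)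
  also have "(2 * (2 ^ n * R) + 3) ^ DIM('b) \<le> ((2 * R + 3) * 2 ^ n) ^ DIM('b)"
    by (intro power_mono) (auto simp: algebra_simps)
  finally show "card G \<le> ((2 * R + 3) * 2 ^ n) ^ DIM('b)" .
qed

lemma geometric_increments_limit:
  fixes x :: "nat \<Rightarrow> real"
  assumes a: "0 \<le> a" "a < 1" and inc: "\<And>n. n \<ge> m \<Longrightarrow> \<bar>x (Suc n) - x n\<bar> \<le> a ^ n" and "n \<ge> m"
  shows "\<bar>lim x - x n\<bar> \<le> a ^ n / (1 - a)"
proof -
  define y where "y = (\<lambda>k. x (k + n))"
  have le: "norm (y (Suc k) - y k) \<le> a ^ n * a ^ k" for k
    using inc[of "k + n"] \<open>n \<ge> m\<close> by (simp add: y_def power_add mult.commute)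
  have S: "summable (\<lambda>k. a ^ n * a ^ k)" using a by (intro summable_mult summable_geometric) simp
  have sm: "summable (\<lambda>k. y (Suc k) - y k)"
    by (rule summable_comparison_test[OF _ S]) (use le in auto)
  then obtain l where "(\<lambda>k. y (Suc k) - y k) sums l" by (auto simp: summable_def)
  then have "(\<lambda>N. \<Sum>k<N. y (Suc k) - y k) \<longlonglongrightarrow> l" by (simp add: sums_def)
  then have "(\<lambda>N. y N - y 0) \<longlonglongrightarrow> l" by (simp add: sum_lessThan_telescope)
  then have "(\<lambda>N. (y N - y 0) + y 0) \<longlonglongrightarrow> l + y 0" by (intro tendsto_intros)
  then have "y \<longlonglongrightarrow> l + y 0" by simp
  then have "x \<longlonglongrightarrow> l + y 0" unfolding y_def by (rule LIMSEQ_offset)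
  then have "lim x = l + x n" by (simp add: limI y_def)
  moreover have "\<bar>l\<bar> \<le> a ^ n / (1 - a)"
  proof -
    have "l = (\<Sum>k. y (Suc k) - y k)" using \<open>(\<lambda>k. y (Suc k) - y k) sums l\<close> by (simp add: sums_iff)
    also have "norm \<dots> \<le> (\<Sum>k. a ^ n * a ^ k)" by (rule norm_suminf_le[OF le S])
    also have "\<dots> = a ^ n / (1 - a)" using a by (simp add: suminf_mult suminf_geometric)
    finally show ?thesis by simp
  qed
  ultimately show ?thesis by simp
qed

text \<open>
  The deterministic half of chaining: if a function oscillates by at most \<open>2 powr (- \<gamma> n)\<close> between
  neighbouring grid points of all fine levels \<open>n\<close>, its extension by limits along the grid is Hoelder. Two
  points at distance about \<open>2 ^ - n\<close> are compared through their level-\<open>n\<close> roundings. The factor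
  \<open>2 d + 1\<close> makes both the roundings of such a pair and the successive roundings of
  one point count as neighbours.
\<close>

lemma hoelder_on_dyadic_limit:
  fixes z :: "'b::euclidean_space \<Rightarrow> real" and R n0 :: nat
  defines "H n \<equiv> dyadic_round n ` cball 0 (real R) \<union> dyadic_round (Suc n) ` cball 0 (real R)"
  assumes \<gamma>: "\<gamma> > 0"
    and osc: "\<And>n g h. n \<ge> n0 \<Longrightarrow> g \<in> H n \<Longrightarrow> h \<in> H n \<Longrightarrow>
      dist g h \<le> (2 * real DIM('b) + 1) / 2 ^ n \<Longrightarrow> \<bar>z g - z h\<bar> \<le> (2 powr - \<gamma>) ^ n"
  shows "hoelder_on \<gamma> (cball 0 (real R)) (\<lambda>p. lim (\<lambda>n. z (dyadic_round n p)))"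
proof -
  define a where "a = 2 powr - \<gamma>"
  define y where "y p = lim (\<lambda>n. z (dyadic_round n p))" for p :: 'b
  have a: "0 < a" "a < 1" using \<gamma> by (auto simp: a_def powr_less_one)
  have an: "a ^ n = (1 / 2 ^ n) powr \<gamma>" for n
  proof -
    have "a ^ n = a powr real n" using a by (simp add: powr_realpow)
    moreover have "(1::real) / 2 ^ n = 2 powr - real n"
      by (simp add: powr_minus powr_realpow divide_inverse)
    ultimately show ?thesis by (simp add: a_def powr_powr mult.commute)
  qed
  have approx: "\<bar>y p - z (dyadic_round n p)\<bar> \<le> a ^ n / (1 - a)"
    if p: "p \<in> cball 0 (real R)" and n: "n \<ge> n0" for p n
    unfolding y_def
  proof (rule geometric_increments_limit[where m = n0])
    fix k assume "k \<ge> n0"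
    have "dist (dyadic_round (Suc k) p) (dyadic_round k p)
        \<le> DIM('b) / 2 ^ Suc k + DIM('b) / 2 ^ k"
      using dist_dyadic_round[of "Suc k" p] dist_dyadic_round[of k p]
        dist_triangle3[of "dyadic_round (Suc k) p" "dyadic_round k p" p]
      by (simp add: dist_commute)
    also have "\<dots> \<le> DIM('b) / 2 ^ k + DIM('b) / 2 ^ k"
      by (intro add_mono divide_left_mono) auto
    also have "\<dots> \<le> (2 * real DIM('b) + 1) / 2 ^ k" by (simp add: add_divide_distrib)
    finally show "\<bar>z (dyadic_round (Suc k) p) - z (dyadic_round k p)\<bar> \<le> a ^ k"
      unfolding a_def using p by (intro osc[OF \<open>k \<ge> n0\<close>]) (auto simp: H_def)
  qed (use a n in auto)
  define B where "B = 2 / (1 - a) + 1"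
  have B: "B > 0" using a by (simp add: B_def add_pos_pos)
  have near: "\<bar>y p - y q\<bar> \<le> B * a ^ n"
    if p: "p \<in> cball 0 (real R)" and q: "q \<in> cball 0 (real R)" and n: "n \<ge> n0"
      and d: "dist p q \<le> 1 / 2 ^ n" for p q n
  proof -
    have "dist (dyadic_round n p) (dyadic_round n q)
        \<le> DIM('b) / 2 ^ n + 1 / 2 ^ n + DIM('b) / 2 ^ n"
      using dist_dyadic_round[of n p] dist_dyadic_round[of n q] d
        dist_triangle[of "dyadic_round n p" "dyadic_round n q" p]
        dist_triangle[of p "dyadic_round n q" q]
      by (simp add: dist_commute)
    also have "\<dots> = (2 * real DIM('b) + 1) / 2 ^ n" by (simp add: add_divide_distrib)
    finally have "\<bar>z (dyadic_round n p) - z (dyadic_round n q)\<bar> \<le> a ^ n"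
      unfolding a_def using p q by (intro osc[OF n]) (auto simp: H_def)
    then have "\<bar>y p - y q\<bar> \<le> a ^ n / (1 - a) + a ^ n + a ^ n / (1 - a)"
      using approx[OF p n] approx[OF q n] by linarith
    also have "\<dots> = B * a ^ n" by (simp add: B_def algebra_simps)
    finally show ?thesis .
  qed
  define S where "S = (\<Sum>g\<in>dyadic_round n0 ` cball 0 (real R). \<bar>z g\<bar>)"
  have S0: "S \<ge> 0" unfolding S_def by (intro sum_nonneg) auto
  have S: "\<bar>z (dyadic_round n0 p)\<bar> \<le> S" if "p \<in> cball 0 (real R)" for p
    unfolding S_def using that card_dyadic_round_cball(1)[of n0 R]
    by (intro member_le_sum) auto
  define K where "K = B * 2 powr \<gamma> + (2 * S + 2 / (1 - a)) * (2 ^ n0) powr \<gamma>"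
  have "\<bar>y p - y q\<bar> \<le> K * dist p q powr \<gamma>"
    if p: "p \<in> cball 0 (real R)" and q: "q \<in> cball 0 (real R)" for p q
  proof (cases "p = q")
    case False
    then have pos: "dist p q > 0" by simp
    show ?thesis
    proof (cases "dist p q < 1 / 2 ^ n0")
      case True
      \<comment> \<open>the dyadic scale of the distance: \<open>2 ^ - (n + 1) < dist p q \<le> 2 ^ - n\<close>\<close>
      define n where "n = (LEAST n. 1 / 2 ^ Suc n < dist p q)"
      have ex: "\<exists>n. 1 / 2 ^ Suc n < dist p q"
      proof -
        obtain n where "(1/2::real) ^ n < dist p q" using real_arch_pow_inv[OF pos, of "1/2"] by auto
        moreover have "(1/2::real) ^ Suc n \<le> (1/2) ^ n" by simp
        ultimately show ?thesis by (auto simp: power_divide intro!: exI[of _ n])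
      qed
      have n1: "1 / 2 ^ Suc n < dist p q" unfolding n_def by (rule LeastI_ex[OF ex])
      have "n \<ge> n0"
      proof (rule ccontr)
        assume "\<not> n \<ge> n0"
        then have "(2::real) ^ Suc n \<le> 2 ^ n0" by (intro power_increasing) auto
        then have "1 / 2 ^ n0 \<le> (1::real) / 2 ^ Suc n" by (intro divide_left_mono) auto
        then show False using n1 True by linarith
      qed
      have n2: "dist p q \<le> 1 / 2 ^ n"
      proof (cases n)
        case 0
        have "(1::real) / 2 ^ n0 \<le> 1" by simp
        then have "dist p q \<le> 1" using True by linarith
        then show ?thesis using 0 by simp
      next
        case (Suc k)
        then have "\<not> 1 / 2 ^ Suc k < dist p q" unfolding n_def using not_less_Least[of k "\<lambda>n. 1 / 2 ^ Suc n < dist p q"] by auto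
        then show ?thesis using Suc by simp
      qed
      have "a ^ n = (2 * (1 / 2 ^ Suc n)) powr \<gamma>" by (simp add: an)
      also have "\<dots> = 2 powr \<gamma> * (1 / 2 ^ Suc n) powr \<gamma>" by (rule powr_mult)
      also have "\<dots> \<le> 2 powr \<gamma> * dist p q powr \<gamma>"
        using n1 \<gamma> by (intro mult_left_mono powr_mono2) auto
      finally have "\<bar>y p - y q\<bar> \<le> B * (2 powr \<gamma> * dist p q powr \<gamma>)"
        using near[OF p q \<open>n \<ge> n0\<close> n2] B by (smt (verit) mult_left_mono)
      moreover have "0 \<le> (2 * S + 2 / (1 - a)) * (2 ^ n0) powr \<gamma> * dist p q powr \<gamma>"
        using S0 a by (intro mult_nonneg_nonneg add_nonneg_nonneg) auto
      ultimately show ?thesis by (simp add: K_def algebra_simps)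
    next
      case False
      then have "1 \<le> 2 ^ n0 * dist p q" by (simp add: field_simps)
      then have one: "1 \<le> (2 ^ n0) powr \<gamma> * dist p q powr \<gamma>"
        using \<gamma> ge_one_powr_ge_zero[of "2 ^ n0 * dist p q" \<gamma>] by (simp add: powr_mult)
      have "a ^ n0 / (1 - a) \<le> 1 / (1 - a)" using a by (intro divide_right_mono power_le_one) auto
      then have "\<bar>y p - y q\<bar> \<le> 2 * S + 2 * (1 / (1 - a))"
        using approx[OF p order_refl] approx[OF q order_refl] S[OF p] S[OF q] by linarith
      then have "\<bar>y p - y q\<bar> \<le> (2 * S + 2 / (1 - a)) * 1" by simp
      also have "\<dots> \<le> (2 * S + 2 / (1 - a)) * ((2 ^ n0) powr \<gamma> * dist p q powr \<gamma>)"
        using S0 a one by (intro mult_left_mono add_nonneg_nonneg) auto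
      finally have "\<bar>y p - y q\<bar> \<le> (2 * S + 2 / (1 - a)) * ((2 ^ n0) powr \<gamma> * dist p q powr \<gamma>)" .
      moreover have "0 \<le> B * 2 powr \<gamma> * dist p q powr \<gamma>" using B by simp
      ultimately show ?thesis by (simp add: K_def algebra_simps)
    qed
  qed simp
  then show ?thesis unfolding hoelder_on_def y_def dist_real_def by blast
qed


lemma markov_moment:
  assumes "prob_space M" and [measurable]: "X \<in> borel_measurable M"
    and "integrable M (\<lambda>\<omega>. \<bar>X \<omega>\<bar> ^ m)" and "(LINT \<omega>|M. \<bar>X \<omega>\<bar> ^ m) \<le> V" and "\<epsilon> > 0"
  shows "measure M {\<omega> \<in> space M. \<bar>X \<omega>\<bar> > \<epsilon>} \<le> V / \<epsilon> ^ m"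
proof -
  interpret prob_space M by fact
  have "measure M {\<omega> \<in> space M. \<bar>X \<omega>\<bar> > \<epsilon>} \<le> measure M {\<omega> \<in> space M. \<epsilon> ^ m \<le> \<bar>X \<omega>\<bar> ^ m}"
    using \<open>\<epsilon> > 0\<close> by (intro finite_measure_mono) (auto intro!: power_mono)
  also have "\<dots> \<le> (LINT \<omega>|M. \<bar>X \<omega>\<bar> ^ m) / \<epsilon> ^ m"
    using assms(3) \<open>\<epsilon> > 0\<close> by (intro integral_Markov_inequality_measure[where A = "{}"]) auto
  also have "\<dots> \<le> V / \<epsilon> ^ m" using assms(4,5) by (intro divide_right_mono) auto
  finally show ?thesis .
qed

lemma eventually_avoid_summable:
  assumes "prob_space M" and [measurable]: "\<And>n. A n \<in> sets M"
    and le: "\<And>n. measure M (A n) \<le> K * q ^ n" and q: "0 \<le> q" "q < 1"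
  shows "AE \<omega> in M. \<exists>n0. \<forall>n\<ge>n0. \<omega> \<notin> A n"
proof -
  interpret prob_space M by fact
  have "summable (\<lambda>n. measure M (A n))"
    by (rule summable_comparison_test[of _ "\<lambda>n. K * q ^ n"])
      (use le q in \<open>auto intro!: summable_mult summable_geometric\<close>)
  then have "AE \<omega> in M. eventually (\<lambda>n. \<omega> \<in> space M - A n) sequentially"
    by (intro borel_cantelli_AE1) (auto simp: emeasure_eq_measure)
  then show ?thesis by eventually_elim (auto simp: eventually_sequentially)
qed

text \<open>
  The probabilistic half of chaining. The union bound runs over all pairs of neighbouring grid points of
  a ball, crudely counted as at most the square of the number of grid points; this costs \<open>2 d\<close> instead of the \<open>d\<close> in the
  theorem of Kolmogorov and Chentsov and spares counting neighbours. The loss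
  is harmless for Gaussian fields, where moments of every order are available.
\<close>

lemma hoelder_modification_of_moment_bound:
  fixes Z :: "'b::euclidean_space \<Rightarrow> 'w \<Rightarrow> real" and m :: nat and \<beta> \<gamma> :: real
  assumes M: "prob_space M" and meas [measurable]: "\<And>p. Z p \<in> borel_measurable M"
    and int: "\<And>p q. integrable M (\<lambda>\<omega>. \<bar>Z p \<omega> - Z q \<omega>\<bar> ^ m)"
    and mom: "\<And>R::nat. \<exists>C. \<forall>p\<in>cball 0 (real R). \<forall>q\<in>cball 0 (real R).
        (LINT \<omega>|M. \<bar>Z p \<omega> - Z q \<omega>\<bar> ^ m) \<le> C * dist p q powr \<beta>"
    and \<gamma>: "\<gamma> > 0" and \<beta>: "2 * real DIM('b) + \<gamma> * real m < \<beta>"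
  shows "\<exists>Y. (\<forall>p. Y p \<in> borel_measurable M \<and> (AE \<omega> in M. Y p \<omega> = Z p \<omega>)) \<and>
    (AE \<omega> in M. \<forall>R::nat. hoelder_on \<gamma> (cball 0 (real R)) (\<lambda>p. Y p \<omega>))"
proof -
  interpret prob_space M by fact
  define d where "d = DIM('b)"
  define a where "a = 2 powr - \<gamma>"
  define Y where "Y p \<omega> = lim (\<lambda>n. Z (dyadic_round n p) \<omega>)" for p \<omega>
  have a: "0 < a" "a < 1" using \<gamma> by (auto simp: a_def powr_less_one)
  have \<beta>0: "\<beta> > 0"
  proof -
    have "0 \<le> 2 * real DIM('b) + \<gamma> * m" using \<gamma> by simp
    then show ?thesis using \<beta> by linarith
  qed
  have dist_powr: "(x / 2 ^ n) powr \<beta> = x powr \<beta> * (2 powr - \<beta>) ^ n" if "x \<ge> 0" for x :: real and n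
  proof -
    have "(2::real) ^ n = 2 powr real n" by (simp add: powr_realpow)
    then have "(x / 2 ^ n) powr \<beta> = x powr \<beta> / 2 powr (real n * \<beta>)"
      using that by (simp add: powr_divide powr_powr)
    also have "\<dots> = x powr \<beta> * 2 powr (- \<beta> * real n)" by (simp add: powr_minus_divide mult.commute)
    also have "2 powr (- \<beta> * real n) = (2 powr - \<beta>) powr real n" by (simp add: powr_powr)
    also have "\<dots> = (2 powr - \<beta>) ^ n" by (simp add: powr_realpow)
    finally show ?thesis .
  qed
  have am: "a ^ m = 2 powr - (\<gamma> * m)" by (simp add: a_def powr_realpow[symmetric] powr_powr)
  \<comment> \<open>the ratio of the geometric series bounding the failure probability of one pair at level \<open>n\<close>\<close>
  define q where "q = 2 powr - \<beta> / a ^ m"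
  have q_eq: "q = 2 powr (\<gamma> * m - \<beta>)" by (simp add: q_def am powr_minus_divide powr_diff)
  have q0: "q > 0" unfolding q_eq by simp
  have q4: "q * 4 ^ d < 1"
  proof -
    have "(4::real) ^ d = 2 powr (2 * d)" by (simp add: powr_powr[symmetric] powr_realpow)
    then have "q * 4 ^ d = 2 powr (\<gamma> * m - \<beta> + 2 * d)" by (simp add: q_eq powr_add)
    also have "\<dots> < 2 powr 0" using \<beta> by (intro powr_less_mono) (auto simp: d_def)
    finally show ?thesis by simp
  qed
  have q1: "q < 1"
  proof -
    have "q * 1 \<le> q * 4 ^ d" using q0 by (intro mult_left_mono) auto
    then show ?thesis using q4 by linarith
  qed
  have modif: "AE \<omega> in M. Y p \<omega> = Z p \<omega>" for p
  proof -
    obtain R :: nat where R: "norm p + d \<le> real R" using real_arch_simple by blast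
    have pR: "p \<in> cball 0 (real R)" using R by simp
    have DR: "dyadic_round n p \<in> cball 0 (real R)" for n
    proof -
      have "norm (dyadic_round n p) \<le> norm p + dist (dyadic_round n p) p"
        unfolding dist_norm by (metis add.commute diff_add_cancel norm_triangle_ineq)
      also have "dist (dyadic_round n p) p \<le> d / 1"
        unfolding d_def by (rule order_trans[OF dist_dyadic_round]) (intro divide_left_mono; simp)
      finally show ?thesis using R by simp
    qed
    obtain C0 where C0: "\<forall>p\<in>cball 0 (real R). \<forall>q\<in>cball 0 (real R).
        (LINT \<omega>|M. \<bar>Z p \<omega> - Z q \<omega>\<bar> ^ m) \<le> C0 * dist p q powr \<beta>" using mom by blast
    define C where "C = max C0 0"
    have C: "C \<ge> 0" by (simp add: C_def)
    have "AE \<omega> in M. \<exists>n0. \<forall>n\<ge>n0. \<omega> \<notin> {\<omega>\<in>space M. \<bar>Z (dyadic_round n p) \<omega> - Z p \<omega>\<bar> > a ^ n}"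
    proof (rule eventually_avoid_summable[OF M])
      fix n
      have "(LINT \<omega>|M. \<bar>Z (dyadic_round n p) \<omega> - Z p \<omega>\<bar> ^ m) \<le> C0 * dist (dyadic_round n p) p powr \<beta>"
        using C0 DR pR by blast
      also have "\<dots> \<le> C * (d / 2 ^ n) powr \<beta>" unfolding d_def
        using \<beta>0 C by (intro mult_mono powr_mono2 dist_dyadic_round) (auto simp: C_def)
      also have "\<dots> = C * (d powr \<beta> * (2 powr - \<beta>) ^ n)" by (subst dist_powr) auto
      finally have "measure M {\<omega>\<in>space M. \<bar>Z (dyadic_round n p) \<omega> - Z p \<omega>\<bar> > a ^ n}
          \<le> C * (d powr \<beta> * (2 powr - \<beta>) ^ n) / (a ^ n) ^ m"
        using a by (intro markov_moment M int) auto
      also have "\<dots> = C * d powr \<beta> * q ^ n"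
        by (simp add: q_def power_divide power_mult[symmetric] mult.commute)
      finally show "measure M {\<omega>\<in>space M. \<bar>Z (dyadic_round n p) \<omega> - Z p \<omega>\<bar> > a ^ n} \<le> C * d powr \<beta> * q ^ n" .
    qed (use q0 q1 in auto)
    with AE_space show ?thesis
    proof eventually_elim
      case (elim \<omega>)
      then obtain n0 where n0: "\<And>n. n \<ge> n0 \<Longrightarrow> \<bar>Z (dyadic_round n p) \<omega> - Z p \<omega>\<bar> \<le> a ^ n" by force
      have "(\<lambda>n. Z (dyadic_round n p) \<omega> - Z p \<omega>) \<longlonglongrightarrow> 0"
      proof (rule tendsto_rabs_zero_cancel, rule tendsto_sandwich[of "\<lambda>_. 0" _ _ "\<lambda>n. a ^ n"])
        show "eventually (\<lambda>n. \<bar>Z (dyadic_round n p) \<omega> - Z p \<omega>\<bar> \<le> a ^ n) sequentially"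
          using n0 by (auto simp: eventually_sequentially)
        show "(\<lambda>n. a ^ n) \<longlonglongrightarrow> 0" using a by (intro LIMSEQ_power_zero) auto
      qed auto
      then show ?case unfolding Y_def by (intro limI) (simp add: LIM_zero_iff)
    qed
  qed
  have hoelder: "AE \<omega> in M. hoelder_on \<gamma> (cball 0 (real R)) (\<lambda>p. Y p \<omega>)" for R
  proof -
    define H where "H n = dyadic_round n ` cball (0::'b) (real R) \<union> dyadic_round (Suc n) ` cball 0 (real R)" for n
    \<comment> \<open>neighbouring pairs at level \<open>n\<close>; there are at most \<open>K\<^sup>2 * (4 ^ d) ^ n\<close> of them\<close>
    define E where "E n = {(g, h) \<in> H n \<times> H n. dist g h \<le> (2 * real d + 1) / 2 ^ n}" for n
    define K :: real where "K = 2 * ((2 * real R + 3) * 2) ^ d"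
    have finH: "finite (H n)" for n by (simp add: H_def card_dyadic_round_cball(1))
    have finE: "finite (E n)" for n
      by (rule finite_subset[of _ "H n \<times> H n"]) (auto simp: E_def finH)
    have cardH: "real (card (H n)) \<le> K * (2 ^ d) ^ n" for n
    proof -
      have "card (H n) \<le> card (dyadic_round n ` cball (0::'b) (real R)) + card (dyadic_round (Suc n) ` cball (0::'b) (real R))"
        unfolding H_def by (rule card_Un_le)
      also have "\<dots> \<le> ((2 * R + 3) * 2 ^ n) ^ d + ((2 * R + 3) * 2 ^ Suc n) ^ d"
        unfolding d_def by (intro add_mono card_dyadic_round_cball(2))
      also have "\<dots> \<le> ((2 * R + 3) * 2 ^ Suc n) ^ d + ((2 * R + 3) * 2 ^ Suc n) ^ d"
        by (intro add_mono power_mono mult_left_mono) auto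
      finally have "real (card (H n)) \<le> real (((2 * R + 3) * 2 ^ Suc n) ^ d + ((2 * R + 3) * 2 ^ Suc n) ^ d)"
        by (rule of_nat_mono)
      also have "\<dots> = 2 * ((2 * real R + 3) * 2 * 2 ^ n) ^ d" by (simp add: algebra_simps)
      also have "\<dots> = K * (2 ^ n) ^ d" unfolding K_def by (simp only: power_mult_distrib mult.assoc)
      also have "((2::real) ^ n) ^ d = (2 ^ d) ^ n" by (simp add: power_mult[symmetric] mult.commute)
      finally show ?thesis .
    qed
    have cardE: "real (card (E n)) \<le> K\<^sup>2 * (4 ^ d) ^ n" for n
    proof -
      have "card (E n) \<le> card (H n \<times> H n)"
        by (rule card_mono) (auto simp: E_def finH)
      then have "real (card (E n)) \<le> (real (card (H n)))\<^sup>2"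
        by (simp add: power2_eq_square card_cartesian_product flip: of_nat_mult)
      also have "\<dots> \<le> (K * (2 ^ d) ^ n)\<^sup>2" using cardH by (intro power_mono) auto
      also have "\<dots> = K\<^sup>2 * (4 ^ d) ^ n"
      proof -
        have "(4::real) = 2\<^sup>2" by simp
        then show ?thesis by (simp only: power_mult_distrib power_mult[symmetric]) (simp add: ac_simps)
      qed
      finally show ?thesis .
    qed
    obtain R' :: nat where R': "real R + d \<le> real R'" using real_arch_simple by blast
    have HR: "g \<in> cball 0 (real R')" if g: "g \<in> H n" for g n
    proof -
      obtain k p where p: "norm p \<le> real R" and g: "g = dyadic_round k p"
        using g by (auto simp: H_def)
      have "norm (dyadic_round k p) \<le> norm p + dist (dyadic_round k p) p"
        unfolding dist_norm by (metis add.commute diff_add_cancel norm_triangle_ineq)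
      also have "dist (dyadic_round k p) p \<le> d / 1"
        unfolding d_def by (rule order_trans[OF dist_dyadic_round]) (intro divide_left_mono; simp)
      finally show ?thesis using R' p g by simp
    qed
    obtain C0 where C0: "\<forall>p\<in>cball 0 (real R'). \<forall>q\<in>cball 0 (real R').
        (LINT \<omega>|M. \<bar>Z p \<omega> - Z q \<omega>\<bar> ^ m) \<le> C0 * dist p q powr \<beta>" using mom by blast
    define C where "C = max C0 0"
    have C: "C \<ge> 0" by (simp add: C_def)
    define L where "L = C * (2 * real d + 1) powr \<beta>"
    define A where "A n = (\<Union>(g, h)\<in>E n. {\<omega>\<in>space M. \<bar>Z g \<omega> - Z h \<omega>\<bar> > a ^ n})" for n
    have "AE \<omega> in M. \<exists>n0. \<forall>n\<ge>n0. \<omega> \<notin> A n"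
    proof (rule eventually_avoid_summable[OF M])
      fix n
      show "A n \<in> sets M" unfolding A_def by (intro sets.finite_UN finE) auto
      have pair: "measure M {\<omega>\<in>space M. \<bar>Z g \<omega> - Z h \<omega>\<bar> > a ^ n} \<le> L * q ^ n" if gh: "(g, h) \<in> E n" for g h
      proof -
        have "(LINT \<omega>|M. \<bar>Z g \<omega> - Z h \<omega>\<bar> ^ m) \<le> C0 * dist g h powr \<beta>"
          using C0 HR gh by (auto simp: E_def)
        also have "\<dots> \<le> C * ((2 * real d + 1) / 2 ^ n) powr \<beta>"
          using \<beta>0 C gh by (intro mult_mono powr_mono2) (auto simp: C_def E_def)
        also have "\<dots> = L * (2 powr - \<beta>) ^ n" by (subst dist_powr) (auto simp: L_def)
        finally have "measure M {\<omega>\<in>space M. \<bar>Z g \<omega> - Z h \<omega>\<bar> > a ^ n} \<le> L * (2 powr - \<beta>) ^ n / (a ^ n) ^ m"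
          using a by (intro markov_moment M int) auto
        also have "\<dots> = L * q ^ n"
          by (simp add: q_def power_divide power_mult[symmetric] mult.commute)
        finally show ?thesis .
      qed
      have "measure M (A n) \<le> (\<Sum>(g, h)\<in>E n. measure M {\<omega>\<in>space M. \<bar>Z g \<omega> - Z h \<omega>\<bar> > a ^ n})"
        unfolding A_def case_prod_unfold by (intro finite_measure_subadditive_finite finE) auto
      also have "\<dots> \<le> (\<Sum>(g, h)\<in>E n. L * q ^ n)"
        using pair by (intro sum_mono) auto
      also have "\<dots> = real (card (E n)) * (L * q ^ n)" by simp
      also have "\<dots> \<le> K\<^sup>2 * (4 ^ d) ^ n * (L * q ^ n)"
        using C q0 by (intro mult_right_mono cardE mult_nonneg_nonneg) (auto simp: L_def)
      also have "\<dots> = K\<^sup>2 * L * (q * 4 ^ d) ^ n" by (simp add: power_mult_distrib)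
      finally show "measure M (A n) \<le> K\<^sup>2 * L * (q * 4 ^ d) ^ n" .
    qed (use q0 q4 in auto)
    with AE_space show ?thesis
    proof eventually_elim
      case (elim \<omega>)
      then obtain n0 where n0: "\<And>n. n \<ge> n0 \<Longrightarrow> \<omega> \<notin> A n" by blast
      show ?case unfolding Y_def
      proof (rule hoelder_on_dyadic_limit[OF \<gamma>, where ?n0.0 = n0 and z = "\<lambda>p. Z p \<omega>"])
        fix n and g h :: 'b assume *: "n \<ge> n0"
          "g \<in> dyadic_round n ` cball 0 (real R) \<union> dyadic_round (Suc n) ` cball 0 (real R)"
          "h \<in> dyadic_round n ` cball 0 (real R) \<union> dyadic_round (Suc n) ` cball 0 (real R)"
          "dist g h \<le> (2 * real DIM('b) + 1) / 2 ^ n"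
        then have "(g, h) \<in> E n" by (simp add: E_def H_def d_def add.commute)
        then show "\<bar>Z g \<omega> - Z h \<omega>\<bar> \<le> (2 powr - \<gamma>) ^ n"
          using n0[OF *(1)] elim(1) by (force simp: A_def a_def)
      qed
    qed
  qed
  have "Y p \<in> borel_measurable M" for p unfolding Y_def by measurable
  then show ?thesis using modif hoelder by (intro exI[of _ Y]) (auto simp: AE_all_countable)
qed

section \<open>Hoelder modifications and their absence for Gaussian fields\<close>

text \<open>
  The \<open>2 k\<close>-th moment of a Gaussian increment is a constant times the \<open>k\<close>-th power of its variance, hence
  of order \<open>dist p q powr (2 \<kappa> k)\<close>. Any Hoelder exponent below \<open>\<kappa>\<close> is reached by taking \<open>k\<close> large;
  \<open>\<kappa> / 2\<close> suffices for local Hoelder continuity.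
\<close>

lemma gaussian_hoelder_modification:
  fixes Z :: "'b::euclidean_space \<Rightarrow> 'w \<Rightarrow> real" and \<kappa> :: real
  assumes M: "prob_space M" and meas: "\<And>p. Z p \<in> borel_measurable M"
    and gauss: "\<And>p q. centered_gaussian M (\<lambda>\<omega>. Z p \<omega> - Z q \<omega>)"
    and \<kappa>: "\<kappa> > 0"
    and var: "\<And>R::nat. \<exists>C. \<forall>p\<in>cball 0 (real R). \<forall>q\<in>cball 0 (real R).
        (LINT \<omega>|M. (Z p \<omega> - Z q \<omega>)\<^sup>2) \<le> C * dist p q powr (2 * \<kappa>)"
  shows "\<exists>Y. (\<forall>p. Y p \<in> borel_measurable M \<and> (AE \<omega> in M. Y p \<omega> = Z p \<omega>)) \<and>
    (AE \<omega> in M. \<forall>R::nat. hoelder_on (\<kappa> / 2) (cball 0 (real R)) (\<lambda>p. Y p \<omega>))"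
proof -
  obtain k :: nat where k: "2 * real DIM('b) / \<kappa> < real k" using reals_Archimedean2 by blast
  have abs_eq: "\<bar>Z p \<omega> - Z q \<omega>\<bar> ^ (2 * k) = (Z p \<omega> - Z q \<omega>) ^ (2 * k)" for p q \<omega>
    by (simp add: power_even_abs)
  define D :: real where "D = fact (2 * k) / (2 ^ k * fact k)"
  have D: "D \<ge> 0" by (simp add: D_def)
  show ?thesis
  proof (rule hoelder_modification_of_moment_bound[where m = "2 * k" and \<beta> = "2 * \<kappa> * k"])
    show "integrable M (\<lambda>\<omega>. \<bar>Z p \<omega> - Z q \<omega>\<bar> ^ (2 * k))" for p q
      unfolding abs_eq by (rule centered_gaussian_even_moment(1)[OF M gauss])
    fix R :: nat
    obtain C0 where C0: "\<And>p q. p \<in> cball 0 (real R) \<Longrightarrow> q \<in> cball 0 (real R) \<Longrightarrow>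
        (LINT \<omega>|M. (Z p \<omega> - Z q \<omega>)\<^sup>2) \<le> C0 * dist p q powr (2 * \<kappa>)" using var[of R] by blast
    have "(LINT \<omega>|M. \<bar>Z p \<omega> - Z q \<omega>\<bar> ^ (2 * k)) \<le> (D * C0 ^ k) * dist p q powr (2 * \<kappa> * k)"
      if "p \<in> cball 0 (real R)" "q \<in> cball 0 (real R)" for p q
    proof -
      have "(LINT \<omega>|M. \<bar>Z p \<omega> - Z q \<omega>\<bar> ^ (2 * k)) = D * (LINT \<omega>|M. (Z p \<omega> - Z q \<omega>)\<^sup>2) ^ k"
        unfolding abs_eq D_def by (rule centered_gaussian_even_moment(2)[OF M gauss])
      also have "\<dots> \<le> D * (C0 * dist p q powr (2 * \<kappa>)) ^ k"
        using D C0[OF that] by (intro mult_left_mono power_mono) auto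
      also have "\<dots> = (D * C0 ^ k) * (dist p q powr (2 * \<kappa>)) ^ k" by (simp add: power_mult_distrib)
      also have "(dist p q powr (2 * \<kappa>)) ^ k = dist p q powr (2 * \<kappa> * k)"
      proof (cases "p = q")
        case True
        have "k \<noteq> 0" 
        proof
          assume "k = 0"
          moreover have "0 \<le> 2 * real DIM('b) / \<kappa>" using \<kappa> by simp
          ultimately show False using k by simp
        qed
        then show ?thesis using True by simp
      next
        case False
        then show ?thesis by (simp add: powr_powr[symmetric] powr_realpow)
      qed
      finally show ?thesis .
    qed
    then show "\<exists>C. \<forall>p\<in>cball 0 (real R). \<forall>q\<in>cball 0 (real R).
        (LINT \<omega>|M. \<bar>Z p \<omega> - Z q \<omega>\<bar> ^ (2 * k)) \<le> C * dist p q powr (2 * \<kappa> * k)" by blast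
  next
    show "2 * real DIM('b) + \<kappa> / 2 * real (2 * k) < 2 * \<kappa> * real k" using k \<kappa> by (simp add: field_simps)
  qed (use M meas \<kappa> in auto)
qed

lemma hoelder_on_subset: "hoelder_on \<gamma> K f \<Longrightarrow> L \<subseteq> K \<Longrightarrow> hoelder_on \<gamma> L f"
  unfolding hoelder_on_def by blast

lemma hoelder_on_add_lipschitz:
  fixes f :: "'p::metric_space \<Rightarrow> real" and g :: "'p \<Rightarrow> real"
  assumes f: "hoelder_on \<gamma> K f" and \<gamma>: "0 < \<gamma>" "\<gamma> \<le> 1" and K: "bounded K"
    and g: "\<And>x y. x \<in> K \<Longrightarrow> y \<in> K \<Longrightarrow> \<bar>g x - g y\<bar> \<le> L * dist x y"
  shows "hoelder_on \<gamma> K (\<lambda>x. g x + f x)"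
proof -
  obtain C where C: "\<And>x y. x \<in> K \<Longrightarrow> y \<in> K \<Longrightarrow> \<bar>f x - f y\<bar> \<le> C * dist x y powr \<gamma>"
    using f unfolding hoelder_on_def dist_real_def by blast
  obtain D where D: "\<And>x y. x \<in> K \<Longrightarrow> y \<in> K \<Longrightarrow> dist x y \<le> D"
    using K unfolding bounded_two_points by auto
  have "\<bar>(g x + f x) - (g y + f y)\<bar> \<le> (\<bar>L\<bar> * D powr (1 - \<gamma>) + C) * dist x y powr \<gamma>"
    if xy: "x \<in> K" "y \<in> K" for x y
  proof -
    have "dist x y = dist x y powr (1 - \<gamma>) * dist x y powr \<gamma>"
      using powr_add[of "dist x y" "1 - \<gamma>" \<gamma>] by simp
    moreover have "dist x y powr (1 - \<gamma>) * dist x y powr \<gamma> \<le> D powr (1 - \<gamma>) * dist x y powr \<gamma>"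
      using D[OF xy] \<gamma> by (intro mult_right_mono powr_mono2) auto
    ultimately have "dist x y \<le> D powr (1 - \<gamma>) * dist x y powr \<gamma>" by linarith
    then have "L * dist x y \<le> \<bar>L\<bar> * (D powr (1 - \<gamma>) * dist x y powr \<gamma>)"
      by (intro mult_mono) auto
    then show ?thesis using g[OF xy] C[OF xy] by (simp add: algebra_simps)
  qed
  then show ?thesis unfolding hoelder_on_def dist_real_def by blast
qed

text \<open>
  If the increments of \<open>Z\<close> from \<open>p0\<close> obey a Hoelder bound with a fixed constant on an event of probability
  \<open>\<delta> > 0\<close>, then each single increment does so with probability at least \<open>\<delta>\<close>, and the small ball
  estimate bounds its variance. So when the variances satisfy no power bound, every such event is null.
  Exponents \<open>1 / m\<close> and integer constants suffice, because the points lie within distance 1 of \<open>p0\<close>; this leaves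
  countably many events. Using only the countable set \<open>P\<close> makes the events measurable and
  lets the modification be replaced by \<open>u\<close> almost surely.
\<close>

lemma as_not_locally_hoelder_gaussian:
  fixes Z :: "'p::metric_space \<Rightarrow> 'w \<Rightarrow> real"
  assumes M: "prob_space M" and K: "compact K" "K \<subseteq> D" and P: "countable P" "P \<subseteq> K" and p0: "p0 \<in> K"
    and near: "\<And>p. p \<in> P \<Longrightarrow> dist p p0 \<le> 1"
    and gauss: "\<And>p. p \<in> P \<Longrightarrow> centered_gaussian M (\<lambda>\<omega>. Z p \<omega> - Z p0 \<omega>)"
    and drift: "\<And>p \<omega>. p \<in> K \<Longrightarrow> \<omega> \<in> space M \<Longrightarrow> u p \<omega> = g p + Z p \<omega>"
    and lip: "\<And>p. p \<in> P \<Longrightarrow> \<bar>g p - g p0\<bar> \<le> L * dist p p0"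
    and var: "\<And>m B. 0 < m \<Longrightarrow> \<exists>p\<in>P. dist p p0 > 0 \<and>
        (LINT \<omega>|M. (Z p \<omega> - Z p0 \<omega>)\<^sup>2) > B * dist p p0 powr (2 / real m)"
  shows "as_not_locally_hoelder M D u"
  unfolding as_not_locally_hoelder_def
proof (intro allI impI)
  interpret prob_space M by fact
  fix Y assume Y: "modification M D u Y"
  \<comment> \<open>the events to be shown null: a Hoelder bound with exponent \<open>1 / m\<close> and constant \<open>B\<close>\<close>
  define A where "A m B = {\<omega>\<in>space M. \<forall>p\<in>P. \<bar>Z p \<omega> - Z p0 \<omega>\<bar> \<le> real B * dist p p0 powr (1 / real m)}" for m B :: nat
  have meas [measurable]: "(\<lambda>\<omega>. Z p \<omega> - Z p0 \<omega>) \<in> borel_measurable M" if "p \<in> P" for p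
    using gauss[OF that] by (simp add: centered_gaussian_def)
  have A_sets: "A m B \<in> sets M" for m B
  proof -
    have "{\<omega>\<in>space M. \<bar>Z p \<omega> - Z p0 \<omega>\<bar> \<le> r} \<in> sets M" if "p \<in> P" for p r
      using meas[OF that] by measurable
    then show ?thesis unfolding A_def by (intro sets.sets_Collect_countable_All' P) auto
  qed
  have null: "AE \<omega> in M. \<omega> \<notin> A m B" if m: "0 < m" for m B
  proof -
    have "measure M (A m B) = 0"
    proof (rule ccontr)
      assume "measure M (A m B) \<noteq> 0"
      then have pos: "measure M (A m B) > 0" using measure_nonneg[of M "A m B"] by linarith
      define \<delta> where "\<delta> = (measure M (A m B))\<^sup>2"
      have \<delta>: "\<delta> > 0" using pos by (simp add: \<delta>_def)
      obtain p where p: "p \<in> P" "dist p p0 > 0"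
        "(LINT \<omega>|M. (Z p \<omega> - Z p0 \<omega>)\<^sup>2) > (real B)\<^sup>2 / \<delta> * dist p p0 powr (2 / real m)" using var[OF m] by blast
      define r where "r = real B * dist p p0 powr (1 / real m)"
      have r: "r \<ge> 0" by (simp add: r_def)
      have r2: "r\<^sup>2 = (real B)\<^sup>2 * dist p p0 powr (2 / real m)"
        using p(2) by (simp add: r_def power_mult_distrib powr_power)
      have "measure M (A m B) \<le> measure M {\<omega>\<in>space M. \<bar>Z p \<omega> - Z p0 \<omega>\<bar> \<le> r}"
        using p(1) by (intro finite_measure_mono) (auto simp: A_def r_def)
      then have "\<delta> \<le> (measure M {\<omega>\<in>space M. \<bar>Z p \<omega> - Z p0 \<omega>\<bar> \<le> r})\<^sup>2"
        unfolding \<delta>_def by (intro power_mono) auto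
      then have "\<delta> * (LINT \<omega>|M. (Z p \<omega> - Z p0 \<omega>)\<^sup>2)
          \<le> (measure M {\<omega>\<in>space M. \<bar>Z p \<omega> - Z p0 \<omega>\<bar> \<le> r})\<^sup>2 * (LINT \<omega>|M. (Z p \<omega> - Z p0 \<omega>)\<^sup>2)"
        by (intro mult_right_mono) auto
      also have "\<dots> \<le> r\<^sup>2" by (rule centered_gaussian_small_ball[OF M gauss[OF p(1)] r])
      finally have "\<delta> * (LINT \<omega>|M. (Z p \<omega> - Z p0 \<omega>)\<^sup>2) \<le> r\<^sup>2" .
      moreover have "r\<^sup>2 < \<delta> * (LINT \<omega>|M. (Z p \<omega> - Z p0 \<omega>)\<^sup>2)"
        using p(3) \<delta> unfolding r2 by (simp add: field_simps)
      ultimately show False by simp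
    qed
    then show ?thesis using A_sets[of m B] by (intro AE_not_in) (simp add: null_sets_def emeasure_eq_measure)
  qed
  have "AE \<omega> in M. \<forall>m B. 0 < m \<longrightarrow> \<omega> \<notin> A m B"
    unfolding AE_all_countable using null by auto
  moreover have "AE \<omega> in M. \<forall>p\<in>insert p0 P. Y p \<omega> = u p \<omega>"
  proof (subst AE_ball_countable)
    show "\<forall>p\<in>insert p0 P. AE \<omega> in M. Y p \<omega> = u p \<omega>"
      using Y K P p0 unfolding modification_def by blast
  qed (use P in auto)
  ultimately show "AE \<omega> in M. \<not> locally_hoelder_on D (\<lambda>p. Y p \<omega>)"
    using AE_space
  proof eventually_elim
    case (elim \<omega>)
    show ?case
    proof
      assume "locally_hoelder_on D (\<lambda>p. Y p \<omega>)"
      then obtain \<gamma> where \<gamma>: "\<gamma> > 0" and "hoelder_on \<gamma> K (\<lambda>p. Y p \<omega>)"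
        using K unfolding locally_hoelder_on_def by blast
      then obtain C where C: "\<And>p. p \<in> P \<Longrightarrow> \<bar>Y p \<omega> - Y p0 \<omega>\<bar> \<le> C * dist p p0 powr \<gamma>"
        using P p0 unfolding hoelder_on_def dist_real_def by blast
      define m where "m = nat \<lceil>1 / \<gamma>\<rceil> + 1"
      have m: "m > 0" "1 / real m \<le> \<gamma>" "1 / real m \<le> 1"
      proof -
        have "1 / \<gamma> \<le> real m" unfolding m_def by linarith
        then have "1 \<le> \<gamma> * real m" using \<gamma> by (simp add: pos_divide_le_eq mult.commute)
        moreover have "real m > 0" by (simp add: m_def)
        ultimately show "1 / real m \<le> \<gamma>" by (simp add: pos_divide_le_eq)
      qed (auto simp: m_def)
      obtain B :: nat where B: "\<bar>C\<bar> + \<bar>L\<bar> \<le> real B" using real_arch_simple by blast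
      have "\<bar>Z p \<omega> - Z p0 \<omega>\<bar> \<le> real B * dist p p0 powr (1 / real m)" if p: "p \<in> P" for p
      proof -
        have u: "u p \<omega> = g p + Z p \<omega>" "u p0 \<omega> = g p0 + Z p0 \<omega>"
          using drift elim(3) p P p0 by auto
        have small: "dist p p0 powr s \<le> dist p p0 powr (1 / real m)" if "1 / real m \<le> s" for s
          using near[OF p] that by (cases "p = p0") (auto intro!: powr_mono')
        have "C * dist p p0 powr \<gamma> \<le> \<bar>C\<bar> * dist p p0 powr (1 / real m)"
          using small[OF m(2)] by (intro mult_mono) auto
        moreover have "L * dist p p0 \<le> \<bar>L\<bar> * dist p p0 powr (1 / real m)"
          using small[OF m(3)] by (intro mult_mono) auto
        ultimately have "\<bar>Z p \<omega> - Z p0 \<omega>\<bar> \<le> (\<bar>C\<bar> + \<bar>L\<bar>) * dist p p0 powr (1 / real m)"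
          using C[OF p] lip[OF p] elim(2) p u by (simp add: algebra_simps) 
        also have "\<dots> \<le> real B * dist p p0 powr (1 / real m)" using B by (intro mult_right_mono) auto
        finally show ?thesis .
      qed
      then have "\<omega> \<in> A m B" using elim(3) by (simp add: A_def)
      then show False using elim(1) m by blast
    qed
  qed
qed

text \<open>
  The index set \<open>D\<close> will be a half-line or a half-space. Composing with a 1-Lipschitz retraction \<open>r\<close> onto \<open>D\<close>
  extends the field to the whole space, where the chaining takes place.
\<close>

lemma as_locally_hoelder_gaussian:
  fixes Z :: "'b::euclidean_space \<Rightarrow> 'w \<Rightarrow> real" and \<kappa> :: real
  assumes M: "prob_space M" and meas: "\<And>p. p \<in> D \<Longrightarrow> Z p \<in> borel_measurable M"
    and gauss: "\<And>p q. p \<in> D \<Longrightarrow> q \<in> D \<Longrightarrow> centered_gaussian M (\<lambda>\<omega>. Z p \<omega> - Z q \<omega>)"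
    and \<kappa>: "0 < \<kappa>" "\<kappa> \<le> 1"
    and r: "\<And>p. r p \<in> D" "\<And>p. p \<in> D \<Longrightarrow> r p = p" "\<And>p q. dist (r p) (r q) \<le> dist p q"
    and D0: "0 \<in> D"
    and var: "\<And>R::nat. \<exists>C\<ge>0. \<forall>p\<in>D \<inter> cball 0 (real R). \<forall>q\<in>D \<inter> cball 0 (real R).
        (LINT \<omega>|M. (Z p \<omega> - Z q \<omega>)\<^sup>2) \<le> C * dist p q powr (2 * \<kappa>)"
    and drift: "\<And>p \<omega>. p \<in> D \<Longrightarrow> \<omega> \<in> space M \<Longrightarrow> u p \<omega> = g p + Z p \<omega>"
    and lip: "\<And>R::nat. \<exists>L. \<forall>p\<in>D \<inter> cball 0 (real R). \<forall>q\<in>D \<inter> cball 0 (real R). \<bar>g p - g q\<bar> \<le> L * dist p q"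
  shows "as_locally_hoelder M D u"
proof -
  have norm_r: "norm (r p) \<le> norm p" for p
    using r(3)[of p 0] r(2)[OF D0] by simp
  have "\<exists>Y. (\<forall>p. Y p \<in> borel_measurable M \<and> (AE \<omega> in M. Y p \<omega> = Z (r p) \<omega>)) \<and>
    (AE \<omega> in M. \<forall>R::nat. hoelder_on (\<kappa> / 2) (cball 0 (real R)) (\<lambda>p. Y p \<omega>))"
  proof (rule gaussian_hoelder_modification[OF M _ _ \<kappa>(1)])
    fix R :: nat
    obtain C where C: "C \<ge> 0" "\<And>p q. p \<in> D \<inter> cball 0 (real R) \<Longrightarrow> q \<in> D \<inter> cball 0 (real R) \<Longrightarrow>
        (LINT \<omega>|M. (Z p \<omega> - Z q \<omega>)\<^sup>2) \<le> C * dist p q powr (2 * \<kappa>)" using var[of R] by blast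
    have "(LINT \<omega>|M. (Z (r p) \<omega> - Z (r q) \<omega>)\<^sup>2) \<le> C * dist p q powr (2 * \<kappa>)"
      if pq: "p \<in> cball 0 (real R)" "q \<in> cball 0 (real R)" for p q
    proof -
      have "r p \<in> D \<inter> cball 0 (real R)" "r q \<in> D \<inter> cball 0 (real R)"
        using pq r(1) order_trans[OF norm_r] by auto
      then have "(LINT \<omega>|M. (Z (r p) \<omega> - Z (r q) \<omega>)\<^sup>2) \<le> C * dist (r p) (r q) powr (2 * \<kappa>)"
        by (rule C(2))
      also have "\<dots> \<le> C * dist p q powr (2 * \<kappa>)"
        using C(1) r(3) \<kappa> by (intro mult_left_mono powr_mono2) auto
      finally show ?thesis .
    qed
    then show "\<exists>C. \<forall>p\<in>cball 0 (real R). \<forall>q\<in>cball 0 (real R).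
        (LINT \<omega>|M. (Z (r p) \<omega> - Z (r q) \<omega>)\<^sup>2) \<le> C * dist p q powr (2 * \<kappa>)" by blast
  qed (use meas gauss r(1) in auto)
  then obtain Y where Y_meas: "\<And>p. Y p \<in> borel_measurable M"
    and Y_eq: "\<And>p. AE \<omega> in M. Y p \<omega> = Z (r p) \<omega>"
    and Y_hoelder: "AE \<omega> in M. \<forall>R::nat. hoelder_on (\<kappa> / 2) (cball 0 (real R)) (\<lambda>p. Y p \<omega>)"
    by blast
  have "modification M D u (\<lambda>p \<omega>. g p + Y p \<omega>)"
    unfolding modification_def
  proof (intro ballI conjI)
    fix p assume p: "p \<in> D"
    show "(\<lambda>\<omega>. g p + Y p \<omega>) \<in> borel_measurable M" using Y_meas[of p] by simp
    show "AE \<omega> in M. g p + Y p \<omega> = u p \<omega>"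
      using Y_eq[of p] AE_space by eventually_elim (simp add: drift[OF p] r(2)[OF p])
  qed
  moreover have "AE \<omega> in M. locally_hoelder_on D (\<lambda>p. g p + Y p \<omega>)"
    using Y_hoelder
  proof eventually_elim
    case (elim \<omega>)
    show ?case unfolding locally_hoelder_on_def
    proof (intro exI[of _ "\<kappa> / 2"] conjI allI impI)
      fix K assume K: "compact K \<and> K \<subseteq> D"
      then have bK: "bounded K" using compact_imp_bounded by blast
      then obtain B where "\<forall>x\<in>K. norm x \<le> B" using bounded_iff by blast
      moreover obtain R :: nat where "B \<le> real R" using real_arch_simple by blast
      ultimately have KR: "K \<subseteq> cball 0 (real R)" by fastforce
      obtain L where L: "\<And>p q. p \<in> D \<inter> cball 0 (real R) \<Longrightarrow> q \<in> D \<inter> cball 0 (real R) \<Longrightarrow> \<bar>g p - g q\<bar> \<le> L * dist p q"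
        using lip[of R] by blast
      show "hoelder_on (\<kappa> / 2) K (\<lambda>p. g p + Y p \<omega>)"
      proof (rule hoelder_on_add_lipschitz)
        show "hoelder_on (\<kappa> / 2) K (\<lambda>p. Y p \<omega>)"
          using elim KR hoelder_on_subset by blast
        show "\<bar>g x - g y\<bar> \<le> L * dist x y" if "x \<in> K" "y \<in> K" for x y
          using that K KR by (intro L) auto
      qed (use \<kappa> bK in auto)
    qed (use \<kappa> in auto)
  qed
  ultimately show ?thesis unfolding as_locally_hoelder_def by blast
qed

section \<open>The exponent of a symmetric Levy process\<close>

lemma symmetric_process_marginal:
  fixes N :: "'v measure" and X :: "real \<Rightarrow> 'v \<Rightarrow> 'a::euclidean_space"
  assumes X: "levy_process N X" and sym: "symmetric_process N X" and t: "t \<ge> 0"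
  shows "distr N borel (X t) = distr N borel (\<lambda>\<omega>. - X t \<omega>)"
proof -
  have meas: "X s \<in> borel_measurable N" if "s \<ge> 0" for s using X that by (simp add: levy_process_def)
  have marg: "distr (process_law N Y) borel (\<lambda>f. f t) = distr N borel (Y t)"
    if Y: "\<And>s. s \<ge> 0 \<Longrightarrow> Y s \<in> borel_measurable N" for Y :: "real \<Rightarrow> 'v \<Rightarrow> 'a"
  proof -
    have "(\<lambda>\<omega>. \<lambda>t\<in>{0..}. Y t \<omega>) \<in> measurable N (PiM {0..} (\<lambda>_. borel))"
      using Y by (intro measurable_restrict) auto
    moreover have "(\<lambda>f. f t) \<in> measurable (PiM {0..} (\<lambda>_. borel :: 'a measure)) borel"
      using t by (intro measurable_component_singleton) auto
    ultimately show ?thesis using t by (simp add: process_law_def distr_distr comp_def)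
  qed
  have "distr N borel (X t) = distr (process_law N X) borel (\<lambda>f. f t)" using marg[OF meas] by simp
  also have "\<dots> = distr (process_law N (\<lambda>t \<omega>. - X t \<omega>)) borel (\<lambda>f. f t)"
    using sym by (simp add: symmetric_process_def)
  also have "\<dots> = distr N borel (\<lambda>\<omega>. - X t \<omega>)" using meas by (intro marg) auto
  finally show ?thesis .
qed

text \<open>
  Symmetry makes the sine part of the characteristic function vanish, so \<open>sin (t Im (\<psi> \<xi>)) = 0\<close> for all
  \<open>t \<ge> 0\<close>, which is only possible when \<open>Im (\<psi> \<xi>) = 0\<close>.
\<close>

lemma symmetric_exponent:
  assumes X: "levy_process N X" and sym: "symmetric_process N X" and ch: "characteristic_exponent N X \<psi>"
  shows symmetric_exponent_Im: "Im (\<psi> \<xi>) = 0"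
    and symmetric_exponent_cos: "t \<ge> 0 \<Longrightarrow> (LINT \<omega>|N. cos (\<xi> \<bullet> X t \<omega>)) = exp (- t * Re (\<psi> \<xi>))"
proof -
  interpret prob_space N using X by (simp add: levy_process_def)
  have meas: "X t \<in> borel_measurable N" if "t \<ge> 0" for t using X that by (simp add: levy_process_def)
  have parts: "(LINT \<omega>|N. cos (\<xi> \<bullet> X t \<omega>)) = Re (exp (- complex_of_real t * \<psi> \<xi>))"
    "(LINT \<omega>|N. sin (\<xi> \<bullet> X t \<omega>)) = Im (exp (- complex_of_real t * \<psi> \<xi>))" if t: "t \<ge> 0" for t
  proof -
    note [measurable] = meas[OF t]
    have int: "integrable N (\<lambda>\<omega>. exp (\<i> * complex_of_real (\<xi> \<bullet> X t \<omega>)))"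
      by (rule integrable_const_bound[where B = 1]) auto
    have eq: "(LINT \<omega>|N. exp (\<i> * complex_of_real (\<xi> \<bullet> X t \<omega>))) = exp (- complex_of_real t * \<psi> \<xi>)"
      using ch t by (simp add: characteristic_exponent_def)
    show "(LINT \<omega>|N. cos (\<xi> \<bullet> X t \<omega>)) = Re (exp (- complex_of_real t * \<psi> \<xi>))"
      using integral_Re[OF int] unfolding eq by (simp add: Re_exp)
    show "(LINT \<omega>|N. sin (\<xi> \<bullet> X t \<omega>)) = Im (exp (- complex_of_real t * \<psi> \<xi>))"
      using integral_Im[OF int] unfolding eq by (simp add: Im_exp)
  qed
  have sin0: "sin (t * Im (\<psi> \<xi>)) = 0" if t: "t \<ge> 0" for t
  proof -
    note [measurable] = meas[OF t]
    have "(LINT \<omega>|N. sin (\<xi> \<bullet> X t \<omega>)) = (LINT x|distr N borel (X t). sin (\<xi> \<bullet> x))"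
      by (simp add: integral_distr)
    also have "\<dots> = (LINT \<omega>|N. sin (\<xi> \<bullet> - X t \<omega>))"
      unfolding symmetric_process_marginal[OF X sym t] by (subst integral_distr) auto
    also have "\<dots> = - (LINT \<omega>|N. sin (\<xi> \<bullet> X t \<omega>))" by simp
    finally have "(LINT \<omega>|N. sin (\<xi> \<bullet> X t \<omega>)) = 0" by simp
    then show ?thesis using parts(2)[OF t] by (simp add: Im_exp)
  qed
  show Im: "Im (\<psi> \<xi>) = 0"
  proof (rule ccontr)
    assume *: "Im (\<psi> \<xi>) \<noteq> 0"
    \<comment> \<open>at this time the sine would be \<open>1\<close> or \<open>-1\<close>\<close>
    have "sin (pi / (2 * \<bar>Im (\<psi> \<xi>)\<bar>) * Im (\<psi> \<xi>)) = 0" by (rule sin0) simp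
    moreover have "pi / (2 * \<bar>Im (\<psi> \<xi>)\<bar>) * Im (\<psi> \<xi>) = sgn (Im (\<psi> \<xi>)) * (pi / 2)"
      using * by (auto simp: sgn_if abs_if)
    ultimately show False using * by (auto simp: sgn_if split: if_splits)
  qed
  show "(LINT \<omega>|N. cos (\<xi> \<bullet> X t \<omega>)) = exp (- t * Re (\<psi> \<xi>))" if "t \<ge> 0"
    using parts(1)[OF that] Im by (simp add: Re_exp)
qed

lemma symmetric_exponent_nonneg:
  assumes X: "levy_process N X" and sym: "symmetric_process N X" and ch: "characteristic_exponent N X \<psi>"
  shows "Re (\<psi> \<xi>) \<ge> 0"
proof -
  interpret prob_space N using X by (simp add: levy_process_def)
  have [measurable]: "X 1 \<in> borel_measurable N" using X by (simp add: levy_process_def)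
  have "(LINT \<omega>|N. cos (\<xi> \<bullet> X 1 \<omega>)) \<le> (LINT \<omega>|N. 1)"
    by (intro integral_mono integrable_const_bound[where B = 1]) auto
  then show ?thesis using symmetric_exponent_cos[OF assms, of 1 \<xi>] by (simp add: prob_space)
qed

text \<open>
  The characteristic function at time 1 is \<open>exp (- Re (\<psi> \<xi>))\<close>, continuous and positive; take logarithms.
\<close>

lemma symmetric_exponent_continuous:
  fixes X :: "real \<Rightarrow> 'v \<Rightarrow> 'a::euclidean_space"
  assumes X: "levy_process N X" and sym: "symmetric_process N X" and ch: "characteristic_exponent N X \<psi>"
  shows "continuous_on UNIV (\<lambda>\<xi>. Re (\<psi> \<xi>))"
proof -
  interpret prob_space N using X by (simp add: levy_process_def)
  have [measurable]: "X 1 \<in> borel_measurable N" using X by (simp add: levy_process_def)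
  have "continuous_on UNIV (\<lambda>\<xi>. LINT \<omega>|N. cos (\<xi> \<bullet> X 1 \<omega>))"
  proof (rule continuous_on_sequentiallyI)
    fix u :: "nat \<Rightarrow> 'a" and a assume u: "u \<longlonglongrightarrow> a"
    show "(\<lambda>n. LINT \<omega>|N. cos (u n \<bullet> X 1 \<omega>)) \<longlonglongrightarrow> (LINT \<omega>|N. cos (a \<bullet> X 1 \<omega>))"
      by (rule integral_dominated_convergence[where w = "\<lambda>_. 1"])
        (auto intro!: tendsto_intros u)
  qed
  then have "continuous_on UNIV (\<lambda>\<xi>. - ln (LINT \<omega>|N. cos (\<xi> \<bullet> X 1 \<omega>)))"
    by (intro continuous_intros) (auto simp: symmetric_exponent_cos[OF assms])
  then show ?thesis by (simp add: symmetric_exponent_cos[OF assms])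
qed

text \<open>
  Take expectations in \<open>1 - cos (2 x) \<le> 4 (1 - cos x)\<close> at \<open>x = \<xi> \<bullet> X t\<close>, divide by \<open>t\<close>, and let \<open>t\<close>
  decrease to 0.
\<close>

lemma symmetric_exponent_double:
  assumes X: "levy_process N X" and sym: "symmetric_process N X" and ch: "characteristic_exponent N X \<psi>"
  shows "Re (\<psi> (2 *\<^sub>R \<xi>)) \<le> 4 * Re (\<psi> \<xi>)"
proof -
  interpret prob_space N using X by (simp add: levy_process_def)
  define A where "A = Re (\<psi> (2 *\<^sub>R \<xi>))"
  define B where "B = Re (\<psi> \<xi>)"
  have le: "(1 - exp (- t * A)) / t \<le> 4 * B" if t: "t > 0" for t
  proof -
    have [measurable]: "X t \<in> borel_measurable N" using X t by (simp add: levy_process_def)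
    have int: "integrable N (\<lambda>\<omega>. cos (\<zeta> \<bullet> X t \<omega>))" for \<zeta>
      by (rule integrable_const_bound[where B = 1]) auto
    have cos2: "1 - cos (2 * x) \<le> 4 * (1 - cos x)" for x :: real
    proof -
      have "4 * (1 - cos x) - (1 - cos (2 * x)) = 2 * (1 - cos x)\<^sup>2"
        using cos_double_cos[of x] by (simp add: power2_eq_square algebra_simps)
      then show ?thesis by (smt (verit) zero_le_power2)
    qed
    have "1 - exp (- t * A) = (LINT \<omega>|N. 1 - cos (2 * (\<xi> \<bullet> X t \<omega>)))"
      using symmetric_exponent_cos[OF assms, of t "2 *\<^sub>R \<xi>"] t int[of "2 *\<^sub>R \<xi>"]
      by (simp add: A_def prob_space)
    also have "\<dots> \<le> (LINT \<omega>|N. 4 * (1 - cos (\<xi> \<bullet> X t \<omega>)))"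
      using int[of "2 *\<^sub>R \<xi>"] int[of \<xi>] by (intro integral_mono cos2) auto
    also have "\<dots> = 4 * (1 - exp (- t * B))"
      using symmetric_exponent_cos[OF assms, of t \<xi>] t int[of \<xi>] by (simp add: B_def prob_space)
    also have "\<dots> \<le> 4 * (t * B)" using exp_ge_add_one_self[of "- t * B"] by simp
    finally show ?thesis using t by (simp add: field_simps)
  qed
  have "((\<lambda>t. 1 - exp (- t * A)) has_real_derivative A) (at 0)"
    by (auto intro!: derivative_eq_intros)
  then have "((\<lambda>t. (1 - exp (- t * A)) / t) \<longlongrightarrow> A) (at 0)"
    by (simp add: has_field_derivative_iff)
  then have "((\<lambda>t. (1 - exp (- t * A)) / t) \<longlongrightarrow> A) (at_right 0)"
    by (rule filterlim_mono) (auto simp: at_le)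
  then have "A \<le> 4 * B"
    by (rule tendsto_upperbound) (use le in \<open>auto simp: eventually_at_filter\<close>)
  then show ?thesis by (simp add: A_def B_def)
qed

text \<open>
  The exponent is bounded on the unit ball by continuity and grows at most by the factor 4 each time
  the frequency doubles.
\<close>

lemma symmetric_exponent_quadratic_growth:
  assumes X: "levy_process N X" and sym: "symmetric_process N X" and ch: "characteristic_exponent N X \<psi>"
  shows "\<exists>C\<ge>0. \<forall>\<xi>. Re (\<psi> \<xi>) \<le> C * (1 + (norm \<xi>)\<^sup>2)"
proof -
  have "compact ((\<lambda>\<xi>. Re (\<psi> \<xi>)) ` cball 0 1)"
    by (intro compact_continuous_image continuous_on_subset[OF symmetric_exponent_continuous[OF assms]]) auto
  then obtain S0 where S0: "\<And>\<xi>. \<xi> \<in> cball 0 1 \<Longrightarrow> \<bar>Re (\<psi> \<xi>)\<bar> \<le> S0"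
    using compact_imp_bounded bounded_iff by (metis (no_types, lifting) imageI real_norm_def)
  define S where "S = max S0 0"
  have S: "S \<ge> 0" "\<And>\<xi>. norm \<xi> \<le> 1 \<Longrightarrow> Re (\<psi> \<xi>) \<le> S"
    using S0 by (fastforce simp: S_def)+
  have dyadic: "norm \<xi> \<le> 2 ^ n \<Longrightarrow> Re (\<psi> \<xi>) \<le> S * 4 ^ n" for n \<xi>
  proof (induction n arbitrary: \<xi>)
    case 0
    then show ?case using S by simp
  next
    case (Suc n)
    have "Re (\<psi> \<xi>) \<le> 4 * Re (\<psi> ((1/2) *\<^sub>R \<xi>))"
      using symmetric_exponent_double[OF assms, of "(1/2) *\<^sub>R \<xi>"] by simp
    also have "\<dots> \<le> 4 * (S * 4 ^ n)" using Suc by simp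
    finally show ?case by simp
  qed
  have "Re (\<psi> \<xi>) \<le> 4 * S * (1 + (norm \<xi>)\<^sup>2)" for \<xi>
  proof (cases "norm \<xi> \<le> 1")
    case True
    have "S * 1 \<le> S * (4 * (1 + (norm \<xi>)\<^sup>2))" using S(1) by (intro mult_left_mono) auto
    then show ?thesis using S(2)[OF True] by (simp add: mult_ac)
  next
    case False
    define n where "n = nat \<lceil>log 2 (norm \<xi>)\<rceil>"
    have n1: "norm \<xi> > 1" using False by simp
    then have "0 < norm \<xi>" by linarith
    then have "log 2 (norm \<xi>) \<ge> 0" using n1 zero_le_log_cancel_iff[of 2 "norm \<xi>"] by linarith
    then have n: "log 2 (norm \<xi>) \<le> real n" "real n \<le> log 2 (norm \<xi>) + 1" unfolding n_def by linarith+
    have "norm \<xi> \<le> 2 powr real n" using n(1) False by (subst (asm) log_le_iff) auto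
    then have lo: "norm \<xi> \<le> 2 ^ n" by (simp add: powr_realpow)
    have "2 powr real n \<le> 2 powr (log 2 (norm \<xi>) + 1)" using n(2) by (intro powr_mono) auto
    also have "\<dots> = 2 * norm \<xi>" using \<open>0 < norm \<xi>\<close> by (simp add: powr_add)
    finally have hi: "2 ^ n \<le> 2 * norm \<xi>" by (simp add: powr_realpow)
    have "Re (\<psi> \<xi>) \<le> S * 4 ^ n" by (rule dyadic[OF lo])
    also have "(4::real) ^ n = (2 ^ n)\<^sup>2" by (simp add: power2_eq_square power_mult_distrib[symmetric])
    also have "S * (2 ^ n)\<^sup>2 \<le> S * (2 * norm \<xi>)\<^sup>2" using hi S by (intro mult_left_mono power_mono) auto
    also have "\<dots> \<le> 4 * S * (1 + (norm \<xi>)\<^sup>2)" using S by (simp add: power_mult_distrib algebra_simps)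
    finally show ?thesis .
  qed
  then show ?thesis using S by (intro exI[of _ "4 * S"]) auto
qed

section \<open>Spectral representation of the increments\<close>

definition wave :: "real \<Rightarrow> real \<Rightarrow> real" where
  "wave t \<rho> = (if \<rho> = 0 then t else sin (t * \<rho>) / \<rho>)"

text \<open>
  Restricting to \<open>0 \<le> s \<le> t\<close> lets kernels of different times be integrated over the same domain.
\<close>

definition retarded_wave :: "real \<Rightarrow> real \<Rightarrow> real \<Rightarrow> real" where
  "retarded_wave t \<rho> s = indicator {0..t} s * wave (t - s) \<rho>"

lemma phi_hat_eq_wave:
  assumes "Im (\<psi> \<xi>) = 0" and "Re (\<psi> \<xi>) \<ge> 0"
  shows "phi_hat \<psi> t \<xi> = complex_of_real (wave t (sqrt (Re (\<psi> \<xi>))))"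
proof -
  have "\<psi> \<xi> = complex_of_real (Re (\<psi> \<xi>))" using assms by (simp add: complex_eq_iff)
  then have "csqrt (\<psi> \<xi>) = complex_of_real (sqrt (Re (\<psi> \<xi>)))"
    using assms(2) by (metis of_real_sqrt)
  then show ?thesis
    by (simp add: phi_hat_def csinc_def wave_def sin_of_real
        del: of_real_mult of_real_divide add: of_real_mult[symmetric] of_real_divide[symmetric])
qed

text \<open>
  The two competing bounds behind every upper estimate: wave profiles are 1-Lipschitz in time
  uniformly in the frequency, and they decay like the inverse frequency.
\<close>

lemma wave_diff_bounds:
  shows "\<bar>wave t \<rho> - wave s \<rho>\<bar> \<le> \<bar>t - s\<bar>" and "\<bar>\<rho> * wave t \<rho>\<bar> \<le> 1"
proof -
  show "\<bar>wave t \<rho> - wave s \<rho>\<bar> \<le> \<bar>t - s\<bar>"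
  proof (cases "\<rho> = 0")
    case False
    have "\<bar>sin (t * \<rho>) - sin (s * \<rho>)\<bar> = 2 * \<bar>sin ((t * \<rho> - s * \<rho>) / 2)\<bar> * \<bar>cos ((t * \<rho> + s * \<rho>) / 2)\<bar>"
      by (simp add: sin_diff_sin abs_mult)
    also have "\<dots> \<le> 2 * \<bar>(t * \<rho> - s * \<rho>) / 2\<bar> * 1"
      by (intro mult_mono abs_sin_x_le_abs_x abs_cos_le_one) auto
    also have "\<dots> = \<bar>t - s\<bar> * \<bar>\<rho>\<bar>" by (simp add: abs_mult[symmetric] left_diff_distrib)
    finally show ?thesis using False
      by (simp add: wave_def diff_divide_distrib[symmetric] divide_le_eq)
  qed (simp add: wave_def)
  show "\<bar>\<rho> * wave t \<rho>\<bar> \<le> 1" by (simp add: wave_def)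
qed

lemma wave_abs_le: "\<bar>wave t \<rho>\<bar> \<le> \<bar>t\<bar>"
  using wave_diff_bounds(1)[of t \<rho> 0] by (simp add: wave_def split: if_splits)

lemma square_le_quotient:
  fixes y \<rho> K :: real
  assumes "y\<^sup>2 \<le> A" and "(\<rho> * y)\<^sup>2 \<le> B"
  shows "y\<^sup>2 \<le> (A + B) / (1 + \<rho>\<^sup>2)"
proof -
  have "1 + \<rho>\<^sup>2 > 0" by (smt (verit) zero_le_power2)
  moreover have "y\<^sup>2 * (1 + \<rho>\<^sup>2) \<le> A + B"
    using assms by (simp add: power_mult_distrib algebra_simps)
  ultimately show ?thesis by (simp add: pos_le_divide_eq)
qed

lemma retarded_wave_sq_le:
  "(retarded_wave t \<rho> s)\<^sup>2 \<le> indicator {0..t} s * ((t\<^sup>2 + 1) / (1 + \<rho>\<^sup>2))"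
proof (cases "s \<in> {0..t}")
  case True
  have "(wave (t - s) \<rho>)\<^sup>2 \<le> t\<^sup>2"
    using wave_abs_le[of "t - s" \<rho>] True by (intro power2_le_iff_abs_le[THEN iffD2]) auto
  moreover have "(\<rho> * wave (t - s) \<rho>)\<^sup>2 \<le> 1"
    using wave_diff_bounds(2)[of \<rho> "t - s"] by (simp add: abs_square_le_1)
  ultimately show ?thesis using True square_le_quotient by (simp add: retarded_wave_def)
qed (simp add: retarded_wave_def)

lemma retarded_wave_measurable [measurable]:
  assumes [measurable]: "r \<in> borel_measurable N" "f \<in> borel_measurable N"
  shows "(\<lambda>x. retarded_wave t (r x) (f x)) \<in> borel_measurable N"
  unfolding retarded_wave_def wave_def by measurable

lemma tempered_measure_sigma_finite:
  fixes \<mu> :: "'a::euclidean_space measure"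
  assumes "tempered_measure \<mu>"
  shows "sigma_finite_measure \<mu>"
proof -
  have sets [measurable_cong]: "sets \<mu> = sets borel" using assms by (simp add: tempered_measure_def)
  have sp: "space \<mu> = UNIV" using sets_eq_imp_space_eq[OF sets] by simp
  obtain k :: nat where k: "(\<integral>\<^sup>+x. ennreal (1 / (1 + norm x) ^ k) \<partial>\<mu>) < \<infinity>"
    using assms by (auto simp: tempered_measure_def)
  have fin: "emeasure \<mu> (cball 0 (real n)) \<noteq> \<infinity>" for n
  proof -
    have "emeasure \<mu> (cball 0 (real n)) = (\<integral>\<^sup>+x. indicator (cball 0 (real n)) x \<partial>\<mu>)"
      by simp
    also have "\<dots> \<le> (\<integral>\<^sup>+x. ennreal ((1 + real n) ^ k) * ennreal (1 / (1 + norm x) ^ k) \<partial>\<mu>)"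
    proof (intro nn_integral_mono)
      fix x :: 'a
      show "indicator (cball 0 (real n)) x \<le> ennreal ((1 + real n) ^ k) * ennreal (1 / (1 + norm x) ^ k)"
      proof (cases "norm x \<le> real n")
        case True
        have "(1 + norm x) ^ k \<le> (1 + real n) ^ k" using True by (intro power_mono) auto
        moreover have "(1 + norm x) ^ k > 0" by (intro zero_less_power) (simp add: add_pos_nonneg)
        ultimately have "1 \<le> (1 + real n) ^ k * (1 / (1 + norm x) ^ k)" by simp
        then have "1 \<le> ennreal ((1 + real n) ^ k * (1 / (1 + norm x) ^ k))" by simp
        also have "\<dots> = ennreal ((1 + real n) ^ k) * ennreal (1 / (1 + norm x) ^ k)"
          by (intro ennreal_mult) auto
        finally show ?thesis using True by simp
      qed simp
    qed
    also have "\<dots> = ennreal ((1 + real n) ^ k) * (\<integral>\<^sup>+x. ennreal (1 / (1 + norm x) ^ k) \<partial>\<mu>)"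
      by (intro nn_integral_cmult) measurable
    also have "\<dots> < \<infinity>" using k by (simp add: ennreal_mult_less_top)
    finally show ?thesis by simp
  qed
  show ?thesis
  proof
    show "\<exists>A. countable A \<and> A \<subseteq> sets \<mu> \<and> \<Union> A = space \<mu> \<and> (\<forall>a\<in>A. emeasure \<mu> a \<noteq> \<infinity>)"
    proof (intro exI[of _ "range (\<lambda>n::nat. cball (0::'a) (real n))"] conjI)
      show "\<Union> (range (\<lambda>n. cball (0::'a) (real n))) = space \<mu>"
        using real_arch_simple by (auto simp: sp)
    qed (use fin in \<open>auto simp: sets\<close>)
  qed
qed

lemma centered_gaussian_field_convolution:
  assumes "stochastic_convolution M \<psi> \<mu> F W" and "t \<ge> 0"
  shows "centered_gaussian M (W t x)"
proof -
  have "centered_gaussian M (case_sum (\<lambda>(t, x). W t x) F (Inl (t, x)))"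
    using assms unfolding stochastic_convolution_def
    by (intro centered_gaussian_field_single[where I = "({0..} \<times> UNIV) <+> {h. schwartz h}"]) auto
  then show ?thesis by simp
qed

lemma centered_gaussian_convolution_diff:
  assumes "prob_space M" and "stochastic_convolution M \<psi> \<mu> F W" and "t \<ge> 0" and "s \<ge> 0"
  shows "centered_gaussian M (\<lambda>\<omega>. W t x \<omega> - W s y \<omega>)"
proof -
  have "centered_gaussian M (\<lambda>\<omega>. case_sum (\<lambda>(t, x). W t x) F (Inl (t, x)) \<omega>
      - case_sum (\<lambda>(t, x). W t x) F (Inl (s, y)) \<omega>)"
    using assms unfolding stochastic_convolution_def
    by (intro centered_gaussian_field_diff[where I = "({0..} \<times> UNIV) <+> {h. schwartz h}"]) auto
  then show ?thesis by simp
qed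

text \<open>
  The covariance formula is bilinear in the kernels \<open>k t\<^sub>i s \<xi> * exp (\<i> x\<^sub>i \<bullet> \<xi>)\<close>, so the variance of an
  increment is the squared norm of the difference of two kernels; the integrand is
  that squared modulus written out. Condition \<open>dalang_condition\<close> makes the kernels
  square integrable, which justifies Fubini.
\<close>

lemma convolution_increment_spectral:
  fixes \<mu> :: "'a::euclidean_space measure"
  defines "c \<equiv> 1 / (2 * pi) ^ DIM('a)"
  assumes M: "prob_space M" and conv: "stochastic_convolution M \<psi> \<mu> F W"
    and \<psi>: "\<And>\<xi>. Im (\<psi> \<xi>) = 0" "\<And>\<xi>. Re (\<psi> \<xi>) \<ge> 0"
    and \<psi>_meas [measurable]: "(\<lambda>\<xi>. Re (\<psi> \<xi>)) \<in> borel_measurable borel"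
    and \<mu>: "tempered_measure \<mu>" and dalang: "dalang_condition \<psi> \<mu>"
    and t: "t\<^sub>1 \<ge> 0" "t\<^sub>2 \<ge> 0"
  defines "k t s \<xi> \<equiv> retarded_wave t (sqrt (Re (\<psi> \<xi>))) s"
  shows "ennreal (LINT \<omega>|M. (W t\<^sub>1 x\<^sub>1 \<omega> - W t\<^sub>2 x\<^sub>2 \<omega>)\<^sup>2) = ennreal c * (\<integral>\<^sup>+\<xi>. \<integral>\<^sup>+s.
      ennreal ((k t\<^sub>1 s \<xi>)\<^sup>2 + (k t\<^sub>2 s \<xi>)\<^sup>2 - 2 * (k t\<^sub>1 s \<xi> * k t\<^sub>2 s \<xi> * cos ((x\<^sub>1 - x\<^sub>2) \<bullet> \<xi>))) \<partial>lborel \<partial>\<mu>)"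
proof -
  have sets [measurable_cong]: "sets \<mu> = sets borel" using \<mu> by (simp add: tempered_measure_def)
  interpret \<mu>: sigma_finite_measure \<mu> by (rule tempered_measure_sigma_finite[OF \<mu>])
  interpret P: pair_sigma_finite "lborel :: real measure" \<mu> ..
  define P where "P = (lborel :: real measure) \<Otimes>\<^sub>M \<mu>"
  have c: "c \<ge> 0" by (simp add: c_def)
  have k_meas [measurable]: "(\<lambda>x. k t (fst x) (snd x)) \<in> borel_measurable P" for t
    unfolding k_def P_def by measurable
  have k_meas' [measurable]: "(\<lambda>s. k t s \<xi>) \<in> borel_measurable lborel" for t \<xi>
    unfolding k_def by measurable
  have cos_meas [measurable]: "(\<lambda>x. exp (\<i> * complex_of_real (z \<bullet> snd x))) \<in> borel_measurable P" for z :: 'a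
    unfolding P_def by measurable
  have k_bound: "(k t s \<xi>)\<^sup>2 \<le> indicator {0..t} s * ((t\<^sup>2 + 1) / (1 + Re (\<psi> \<xi>)))" for t s \<xi>
    using retarded_wave_sq_le[of t "sqrt (Re (\<psi> \<xi>))" s] \<psi>(2)[of \<xi>] by (simp add: k_def)
  have k_sq: "integrable P (\<lambda>x. (k t (fst x) (snd x))\<^sup>2)" for t
  proof (rule integrableI_nonneg)
    have "(\<integral>\<^sup>+x. ennreal ((k t (fst x) (snd x))\<^sup>2) \<partial>P)
        \<le> (\<integral>\<^sup>+x. ennreal (indicator {0..t} (fst x) * ((t\<^sup>2 + 1) / (1 + Re (\<psi> (snd x))))) \<partial>P)"
      by (intro nn_integral_mono ennreal_leI k_bound)
    also have "\<dots> = (\<integral>\<^sup>+s. \<integral>\<^sup>+\<xi>. ennreal (indicator {0..t} s * ((t\<^sup>2 + 1) / (1 + Re (\<psi> \<xi>)))) \<partial>\<mu> \<partial>lborel)"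
      unfolding P_def by (subst \<mu>.nn_integral_fst[symmetric]) auto
    also have "\<dots> = (\<integral>\<^sup>+s. indicator {0..t} s * (ennreal (t\<^sup>2 + 1) * (\<integral>\<^sup>+\<xi>. ennreal (1 / (1 + Re (\<psi> \<xi>))) \<partial>\<mu>)) \<partial>lborel)"
    proof (intro nn_integral_cong)
      fix s :: real
      have "(\<integral>\<^sup>+\<xi>. ennreal (indicator {0..t} s * ((t\<^sup>2 + 1) / (1 + Re (\<psi> \<xi>)))) \<partial>\<mu>)
          = (\<integral>\<^sup>+\<xi>. (indicator {0..t} s * ennreal (t\<^sup>2 + 1)) * ennreal (1 / (1 + Re (\<psi> \<xi>))) \<partial>\<mu>)"
      proof (intro nn_integral_cong)
        fix \<xi>
        have "ennreal ((t\<^sup>2 + 1) / (1 + Re (\<psi> \<xi>))) = ennreal (t\<^sup>2 + 1) * ennreal (1 / (1 + Re (\<psi> \<xi>)))"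
          using \<psi>(2)[of \<xi>] by (subst ennreal_mult[symmetric]) auto
        then show "ennreal (indicator {0..t} s * ((t\<^sup>2 + 1) / (1 + Re (\<psi> \<xi>))))
            = indicator {0..t} s * ennreal (t\<^sup>2 + 1) * ennreal (1 / (1 + Re (\<psi> \<xi>)))"
          by (cases "s \<in> {0..t}") (simp_all del: ennreal_plus)
      qed
      also have "\<dots> = (indicator {0..t} s * ennreal (t\<^sup>2 + 1)) * (\<integral>\<^sup>+\<xi>. ennreal (1 / (1 + Re (\<psi> \<xi>))) \<partial>\<mu>)"
        by (intro nn_integral_cmult) measurable
      finally show "(\<integral>\<^sup>+\<xi>. ennreal (indicator {0..t} s * ((t\<^sup>2 + 1) / (1 + Re (\<psi> \<xi>)))) \<partial>\<mu>)
          = indicator {0..t} s * (ennreal (t\<^sup>2 + 1) * (\<integral>\<^sup>+\<xi>. ennreal (1 / (1 + Re (\<psi> \<xi>))) \<partial>\<mu>))"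
        by (simp add: mult.assoc)
    qed
    also have "\<dots> = emeasure lborel {0..t} * (ennreal (t\<^sup>2 + 1) * (\<integral>\<^sup>+\<xi>. ennreal (1 / (1 + Re (\<psi> \<xi>))) \<partial>\<mu>))"
      by (simp add: nn_integral_multc)
    also have "\<dots> < \<infinity>"
      using dalang by (simp add: dalang_condition_def ennreal_mult_less_top emeasure_lborel_Icc_eq)
    finally show "(\<integral>\<^sup>+x. ennreal ((k t (fst x) (snd x))\<^sup>2) \<partial>P) < \<infinity>" .
  qed auto
  have G_int: "integrable P (\<lambda>x. complex_of_real (k t (fst x) (snd x) * k t' (fst x) (snd x)) * exp (\<i> * complex_of_real (z \<bullet> snd x)))"
    for t t' and z :: 'a
  proof (rule Bochner_Integration.integrable_bound)
    show "integrable P (\<lambda>x. (k t (fst x) (snd x))\<^sup>2 + (k t' (fst x) (snd x))\<^sup>2)"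
      by (intro Bochner_Integration.integrable_add k_sq)
    show "AE x in P. norm (complex_of_real (k t (fst x) (snd x) * k t' (fst x) (snd x)) * exp (\<i> * complex_of_real (z \<bullet> snd x)))
        \<le> norm ((k t (fst x) (snd x))\<^sup>2 + (k t' (fst x) (snd x))\<^sup>2)"
      using abs_mult_le_sum_squares by (intro AE_I2) (simp add: norm_mult abs_mult[symmetric] del: of_real_mult)
  qed measurable
  have cov_eq: "cov M (W t x) (W t' x') = c * (LINT y|P. k t (fst y) (snd y) * k t' (fst y) (snd y) * cos ((x - x') \<bullet> snd y))"
    and cov_int: "integrable P (\<lambda>y. k t (fst y) (snd y) * k t' (fst y) (snd y) * cos ((x - x') \<bullet> snd y))"
    if tt: "t \<ge> 0" "t' \<ge> 0" for t t' and x x' :: 'a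
  proof -
    define G where "G y = complex_of_real (k t (fst y) (snd y) * k t' (fst y) (snd y)) * exp (\<i> * complex_of_real ((x - x') \<bullet> snd y))" for y
    have int: "integrable P G" unfolding G_def by (rule G_int)
    have "(LINT s:{0..min t t'}|lborel. LINT \<xi>|\<mu>.
             phi_hat \<psi> (t - s) \<xi> * cnj (phi_hat \<psi> (t' - s) \<xi>) * exp (\<i> * complex_of_real ((x - x') \<bullet> \<xi>)))
        = (LINT s|lborel. LINT \<xi>|\<mu>. G (s, \<xi>))"
      unfolding set_lebesgue_integral_def
    proof (intro Bochner_Integration.integral_cong refl)
      fix s :: real
      show "indicator {0..min t t'} s *\<^sub>R (LINT \<xi>|\<mu>.
             phi_hat \<psi> (t - s) \<xi> * cnj (phi_hat \<psi> (t' - s) \<xi>) * exp (\<i> * complex_of_real ((x - x') \<bullet> \<xi>)))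
          = (LINT \<xi>|\<mu>. G (s, \<xi>))"
        by (cases "s \<in> {0..min t t'}")
          (auto simp: G_def k_def retarded_wave_def phi_hat_eq_wave \<psi> indicator_def)
    qed
    also have "\<dots> = integral\<^sup>L P G" using int unfolding P_def by (rule P.integral_fst')
    finally have "complex_of_real (cov M (W t x) (W t' x')) = complex_of_real c * integral\<^sup>L P G"
      using conv tt unfolding stochastic_convolution_def c_def by simp
    from arg_cong[where f = Re, OF this] have "cov M (W t x) (W t' x') = c * Re (integral\<^sup>L P G)"
      by simp
    moreover have Re_G: "Re (G y) = k t (fst y) (snd y) * k t' (fst y) (snd y) * cos ((x - x') \<bullet> snd y)" for y
      by (simp add: G_def Re_exp)
    ultimately show "cov M (W t x) (W t' x') = c * (LINT y|P. k t (fst y) (snd y) * k t' (fst y) (snd y) * cos ((x - x') \<bullet> snd y))"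
      using integral_Re[OF int] by simp
    show "integrable P (\<lambda>y. k t (fst y) (snd y) * k t' (fst y) (snd y) * cos ((x - x') \<bullet> snd y))"
      using integrable_Re[OF int] by (simp add: Re_G)
  qed
  define D where "D y = (k t\<^sub>1 (fst y) (snd y))\<^sup>2 + (k t\<^sub>2 (fst y) (snd y))\<^sup>2
      - 2 * (k t\<^sub>1 (fst y) (snd y) * k t\<^sub>2 (fst y) (snd y) * cos ((x\<^sub>1 - x\<^sub>2) \<bullet> snd y))" for y
  have D_int: "integrable P D" unfolding D_def
    by (intro Bochner_Integration.integrable_add Bochner_Integration.integrable_diff k_sq
        integrable_mult_right cov_int t)
  have D_nonneg: "D y \<ge> 0" for y
  proof -
    have "0 \<le> a\<^sup>2 + b\<^sup>2 - 2 * (a * b * cos \<theta>)" for a b \<theta> :: real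
    proof -
      have "a\<^sup>2 + b\<^sup>2 - 2 * (a * b * cos \<theta>) = (a - b * cos \<theta>)\<^sup>2 + (b * sin \<theta>)\<^sup>2"
      proof -
        have "b\<^sup>2 = b\<^sup>2 * ((sin \<theta>)\<^sup>2 + (cos \<theta>)\<^sup>2)" by simp
        then show ?thesis by (simp only: power2_diff power_mult_distrib distrib_left)
      qed
      then show ?thesis by simp
    qed
    then show ?thesis unfolding D_def .
  qed
  have "(LINT \<omega>|M. (W t\<^sub>1 x\<^sub>1 \<omega> - W t\<^sub>2 x\<^sub>2 \<omega>)\<^sup>2) = c * integral\<^sup>L P D"
  proof -
    have "(LINT \<omega>|M. (W t\<^sub>1 x\<^sub>1 \<omega> - W t\<^sub>2 x\<^sub>2 \<omega>)\<^sup>2)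
        = cov M (W t\<^sub>1 x\<^sub>1) (W t\<^sub>1 x\<^sub>1) + cov M (W t\<^sub>2 x\<^sub>2) (W t\<^sub>2 x\<^sub>2) - 2 * cov M (W t\<^sub>1 x\<^sub>1) (W t\<^sub>2 x\<^sub>2)"
      using t conv by (intro centered_gaussian_diff_second_moment M centered_gaussian_field_convolution)
    also have "\<dots> = c * ((LINT y|P. (k t\<^sub>1 (fst y) (snd y))\<^sup>2) + (LINT y|P. (k t\<^sub>2 (fst y) (snd y))\<^sup>2)
        - 2 * (LINT y|P. k t\<^sub>1 (fst y) (snd y) * k t\<^sub>2 (fst y) (snd y) * cos ((x\<^sub>1 - x\<^sub>2) \<bullet> snd y)))"
      by (simp add: cov_eq t power2_eq_square algebra_simps)
    also have "\<dots> = c * integral\<^sup>L P D"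
      unfolding D_def using k_sq cov_int[OF t] by simp
    finally show ?thesis .
  qed
  then have "ennreal (LINT \<omega>|M. (W t\<^sub>1 x\<^sub>1 \<omega> - W t\<^sub>2 x\<^sub>2 \<omega>)\<^sup>2) = ennreal c * ennreal (integral\<^sup>L P D)"
    using c by (simp add: ennreal_mult D_nonneg)
  also have "ennreal (integral\<^sup>L P D) = (\<integral>\<^sup>+y. ennreal (D y) \<partial>P)"
    using D_int D_nonneg by (intro nn_integral_eq_integral[symmetric]) auto
  also have "\<dots> = (\<integral>\<^sup>+\<xi>. \<integral>\<^sup>+s. ennreal (D (s, \<xi>)) \<partial>lborel \<partial>\<mu>)"
    using D_int unfolding P_def by (intro P.nn_integral_snd[symmetric]) auto
  finally show ?thesis by (simp add: D_def)
qed

section \<open>Dyadic cosine increments and fractional moments\<close>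

text \<open>
  For \<open>|x| \<ge> 1\<close> one dyadic scale \<open>n\<close> puts \<open>|x| / 2 ^ n\<close> in \<open>[1, 2)\<close>, where \<open>1 - cos\<close> is bounded below.
  Hence \<open>|x| powr (2 b) \<le> 1 + D * (\<Sum>n. 4 powr (b n) * (1 - cos (x / 2 ^ n)))\<close>, and after integration
  the series is geometric with ratio \<open>4 powr (b - \<gamma>) < 1\<close>.
\<close>

lemma nn_integral_powr_of_dyadic_cos:
  fixes f :: "'a \<Rightarrow> real" and w :: "'a \<Rightarrow> ennreal"
  assumes [measurable]: "f \<in> borel_measurable \<mu>" "w \<in> borel_measurable \<mu>"
    and w: "(\<integral>\<^sup>+\<xi>. w \<xi> \<partial>\<mu>) < \<infinity>" and b: "0 < b" "b < \<gamma>"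
    and bound: "\<And>n::nat. (\<integral>\<^sup>+\<xi>. ennreal (1 - cos (f \<xi> / 2 ^ n)) * w \<xi> \<partial>\<mu>) \<le> ennreal (C * (2 powr (- 2 * \<gamma>)) ^ n)"
  shows "(\<integral>\<^sup>+\<xi>. ennreal (\<bar>f \<xi>\<bar> powr (2 * b)) * w \<xi> \<partial>\<mu>) < \<infinity>"
proof -
  define c where "c = 1 - cos (1::real)"
  have c: "c > 0" using cos_monotone_0_pi[of 0 1] pi_gt3 by (simp add: c_def)
  define D where "D = 2 powr (2 * b) / c"
  have D: "D \<ge> 0" using c by (simp add: D_def)
  define v where "v = (2::real) powr (2 * b)"
  have v: "v > 0" by (simp add: v_def)
  have pt: "ennreal (\<bar>x\<bar> powr (2 * b)) \<le> 1 + (\<Sum>n. ennreal (D * v ^ n * (1 - cos (x / 2 ^ n))))" for x :: real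
  proof (cases "\<bar>x\<bar> \<le> 1")
    case True
    have "\<bar>x\<bar> powr (2 * b) \<le> 1" using True b powr_le1[of "2 * b" "\<bar>x\<bar>"] by simp
    then have "ennreal (\<bar>x\<bar> powr (2 * b)) \<le> 1" by (simp add: ennreal_le_1)
    then show ?thesis by (rule order_trans) simp
  next
    case False
    define n where "n = nat \<lfloor>log 2 \<bar>x\<bar>\<rfloor>"
    have "log 2 \<bar>x\<bar> \<ge> 0" using False by simp
    then have n: "real n \<le> log 2 \<bar>x\<bar>" "log 2 \<bar>x\<bar> < real n + 1" unfolding n_def by linarith+
    have lo: "2 ^ n \<le> \<bar>x\<bar>" using n(1) False by (simp add: le_log_iff powr_realpow)
    have hi: "\<bar>x\<bar> \<le> 2 * 2 ^ n"
    proof -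
      have "\<bar>x\<bar> < 2 powr (real n + 1)" using n(2) False by (subst (asm) log_less_iff) auto
      then show ?thesis by (simp add: powr_add powr_realpow)
    qed
    have "1 \<le> \<bar>x\<bar> / 2 ^ n" using lo by (simp add: le_divide_eq)
    moreover have "\<bar>x\<bar> / 2 ^ n \<le> 2" using hi by (simp add: divide_le_eq)
    ultimately have "1 \<le> \<bar>x\<bar> / 2 ^ n" "\<bar>x\<bar> / 2 ^ n \<le> pi" using pi_gt3 by linarith+
    then have "cos (\<bar>x\<bar> / 2 ^ n) \<le> cos 1" by (intro cos_monotone_0_pi_le) auto
    moreover have "cos (\<bar>x\<bar> / 2 ^ n) = cos (x / 2 ^ n)" by (auto simp: abs_if)
    ultimately have cge: "c \<le> 1 - cos (x / 2 ^ n)" by (simp add: c_def)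
    have "\<bar>x\<bar> powr (2 * b) \<le> (2 * 2 ^ n) powr (2 * b)" using hi b by (intro powr_mono2) auto
    also have "\<dots> = 2 powr (2 * b) * (2 ^ n) powr (2 * b)" by (rule powr_mult)
    also have "((2::real) ^ n) powr (2 * b) = v ^ n"
      by (simp add: v_def powr_realpow[symmetric] powr_powr mult.commute)
    also have "2 powr (2 * b) * v ^ n = D * v ^ n * c" using c by (simp add: D_def)
    also have "\<dots> \<le> D * v ^ n * (1 - cos (x / 2 ^ n))" using cge D v by (intro mult_left_mono) auto
    finally have "ennreal (\<bar>x\<bar> powr (2 * b)) \<le> ennreal (D * v ^ n * (1 - cos (x / 2 ^ n)))"
      by (rule ennreal_leI)
    also have "\<dots> \<le> (\<Sum>n. ennreal (D * v ^ n * (1 - cos (x / 2 ^ n))))"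
      using sum_le_suminf[OF summableI, of "{n}" "\<lambda>n. ennreal (D * v ^ n * (1 - cos (x / 2 ^ n)))"] by simp
    finally show ?thesis by (rule order_trans) simp
  qed
  define q where "q = v * 2 powr (- 2 * \<gamma>)"
  have q: "0 \<le> q" "q < 1"
  proof -
    have "q = 2 powr (2 * b - 2 * \<gamma>)" by (simp add: q_def v_def powr_add[symmetric])
    also have "\<dots> < 2 powr 0" using b by (intro powr_less_mono) auto
    finally show "q < 1" by simp
  qed (simp add: q_def v_def)
  have "(\<integral>\<^sup>+\<xi>. ennreal (\<bar>f \<xi>\<bar> powr (2 * b)) * w \<xi> \<partial>\<mu>)
      \<le> (\<integral>\<^sup>+\<xi>. (1 + (\<Sum>n. ennreal (D * v ^ n * (1 - cos (f \<xi> / 2 ^ n))))) * w \<xi> \<partial>\<mu>)"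
    by (intro nn_integral_mono mult_right_mono pt) auto
  also have "\<dots> = (\<integral>\<^sup>+\<xi>. w \<xi> + (\<Sum>n. ennreal (D * v ^ n * (1 - cos (f \<xi> / 2 ^ n))) * w \<xi>) \<partial>\<mu>)"
    by (simp add: distrib_right)
  also have "\<dots> = (\<integral>\<^sup>+\<xi>. w \<xi> \<partial>\<mu>) + (\<Sum>n. \<integral>\<^sup>+\<xi>. ennreal (D * v ^ n * (1 - cos (f \<xi> / 2 ^ n))) * w \<xi> \<partial>\<mu>)"
    by (subst nn_integral_add) (auto simp del: ennreal_suminf_multc intro!: arg_cong2[where f = "(+)"] nn_integral_suminf)
  also have "(\<Sum>n. \<integral>\<^sup>+\<xi>. ennreal (D * v ^ n * (1 - cos (f \<xi> / 2 ^ n))) * w \<xi> \<partial>\<mu>)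
      \<le> (\<Sum>n. ennreal (D * \<bar>C\<bar> * q ^ n))"
  proof (intro suminf_le summableI)
    fix n
    have "(\<integral>\<^sup>+\<xi>. ennreal (D * v ^ n * (1 - cos (f \<xi> / 2 ^ n))) * w \<xi> \<partial>\<mu>)
        = ennreal (D * v ^ n) * (\<integral>\<^sup>+\<xi>. ennreal (1 - cos (f \<xi> / 2 ^ n)) * w \<xi> \<partial>\<mu>)"
      using D v by (simp add: ennreal_mult nn_integral_cmult mult.assoc)
    also have "\<dots> \<le> ennreal (D * v ^ n) * ennreal (\<bar>C\<bar> * (2 powr (- 2 * \<gamma>)) ^ n)"
      by (intro mult_left_mono order_trans[OF bound] ennreal_leI mult_right_mono) auto
    also have "\<dots> = ennreal (D * \<bar>C\<bar> * q ^ n)"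
      using D v by (simp add: q_def power_mult_distrib ennreal_mult[symmetric] mult_ac)
    finally show "(\<integral>\<^sup>+\<xi>. ennreal (D * v ^ n * (1 - cos (f \<xi> / 2 ^ n))) * w \<xi> \<partial>\<mu>) \<le> ennreal (D * \<bar>C\<bar> * q ^ n)" .
  qed
  also have "(\<Sum>n. ennreal (D * \<bar>C\<bar> * q ^ n)) < \<infinity>"
  proof -
    have "summable (\<lambda>n. D * \<bar>C\<bar> * q ^ n)" using q by (intro summable_mult summable_geometric) auto
    then have "(\<Sum>n. ennreal (D * \<bar>C\<bar> * q ^ n)) = ennreal (\<Sum>n. D * \<bar>C\<bar> * q ^ n)"
      using q D by (intro suminf_ennreal2) auto
    then show ?thesis by simp
  qed
  finally show ?thesis using w by (simp add: add_left_mono less_top[symmetric])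
qed

section \<open>Interpolation and trigonometric estimates\<close>

lemma one_plus_powr_le:
  fixes p a :: real
  assumes p: "p \<ge> 0" and a: "0 < a" "a \<le> 1"
  shows "(1 + p) powr a \<le> 2 * (1 + p powr a)"
proof -
  have "(1 + p) powr a \<le> (2 * max 1 p) powr a" using p a by (intro powr_mono2) auto
  also have "\<dots> = 2 powr a * (max 1 p) powr a" by (rule powr_mult)
  also have "\<dots> \<le> 2 * (1 + p powr a)"
  proof (intro mult_mono)
    show "(2::real) powr a \<le> 2" using a powr_mono[of a 1 "2::real"] by simp
    show "(max 1 p) powr a \<le> 1 + p powr a" by (cases "p \<le> 1") (auto simp: max_def)
  qed auto
  finally show ?thesis .
qed

text \<open>
  Write \<open>y\<^sup>2\<close> as the product of its powers with exponents \<open>1 - a\<close> and \<open>a\<close> and use one bound on each.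
\<close>

lemma square_interpolation:
  fixes y h K p a :: real
  assumes a: "0 < a" "a < 1" and p: "p \<ge> 0" and K: "K \<ge> 1"
    and y1: "y\<^sup>2 \<le> h\<^sup>2" and y2: "y\<^sup>2 \<le> K / (1 + p)"
  shows "y\<^sup>2 \<le> 2 * K * \<bar>h\<bar> powr (2 * a) * ((1 + p powr a) / (1 + p))"
proof -
  have "y\<^sup>2 = (y\<^sup>2) powr (1 - a) * (y\<^sup>2) powr a"
    using powr_add[of "y\<^sup>2" "1 - a" a] by simp
  also have "\<dots> \<le> (K / (1 + p)) powr (1 - a) * (h\<^sup>2) powr a"
    using y1 y2 a by (intro mult_mono powr_mono2) auto
  also have "(h\<^sup>2) powr a = \<bar>h\<bar> powr (2 * a)"
  proof -
    have "h\<^sup>2 = \<bar>h\<bar> powr 2" by (cases "h = 0") auto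
    then show ?thesis using powr_powr[of "\<bar>h\<bar>" 2 a] by metis
  qed
  also have "(K / (1 + p)) powr (1 - a) \<le> K * (2 * (1 + p powr a) / (1 + p))"
  proof -
    have "(K / (1 + p)) powr (1 - a) = K powr (1 - a) / (1 + p) powr (1 - a)"
      by (rule powr_divide)
    also have "\<dots> = K powr (1 - a) * ((1 + p) powr a / (1 + p))"
      using p by (simp add: powr_diff)
    also have "\<dots> \<le> K * ((2 * (1 + p powr a)) / (1 + p))"
    proof (intro mult_mono divide_right_mono)
      show "K powr (1 - a) \<le> K" using K a powr_mono[of "1 - a" 1 K] by simp
      show "(1 + p) powr a \<le> 2 * (1 + p powr a)" using p a by (intro one_plus_powr_le) auto
    qed (use p K in auto)
    finally show ?thesis by simp
  qed
  finally have "y\<^sup>2 \<le> K * (2 * (1 + p powr a) / (1 + p)) * \<bar>h\<bar> powr (2 * a)"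
    by (simp add: mult_right_mono)
  then show ?thesis by (simp add: algebra_simps)
qed

lemma one_minus_cos_le_powr:
  fixes \<theta> b :: real
  assumes b: "0 < b" "b < 1"
  shows "1 - cos \<theta> \<le> 2 * \<bar>\<theta>\<bar> powr (2 * b)"
proof (cases "\<bar>\<theta>\<bar> \<le> 1")
  case True
  have "1 - cos \<theta> = 2 * (sin (\<theta> / 2))\<^sup>2" using cos_double_sin[of "\<theta> / 2"] by simp
  also have "(sin (\<theta> / 2))\<^sup>2 \<le> (\<theta> / 2)\<^sup>2"
    by (rule iffD1[OF abs_le_square_iff abs_sin_x_le_abs_x])
  also have "2 * (\<theta> / 2)\<^sup>2 \<le> 2 * \<bar>\<theta>\<bar> powr 2"
    by (cases "\<theta> = 0") (auto simp: power_divide)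
  also have "\<bar>\<theta>\<bar> powr 2 \<le> \<bar>\<theta>\<bar> powr (2 * b)" using True b by (intro powr_mono') auto
  finally show ?thesis by simp
next
  case False
  then have "1 \<le> \<bar>\<theta>\<bar> powr (2 * b)" using b by (intro ge_one_powr_ge_zero) auto
  then show ?thesis using cos_ge_minus_one[of \<theta>] by linarith
qed

text \<open>
  Over \<open>[0, L]\<close> the mean of \<open>cos\<^sup>2\<close> is \<open>1 / 2\<close> up to an error \<open>1 / (2 \<rho> L)\<close>, which is at most \<open>1 / 4\<close>
  once the frequency exceeds \<open>2 / L\<close>. The phase \<open>\<alpha>\<close> is free, so that the same bound serves for
  sines and for shifted times.
\<close>

lemma nn_integral_cos_sq_ge:
  fixes \<rho> \<alpha> L :: real
  assumes L: "L > 0" and \<rho>: "\<rho> \<ge> 2 / L"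
  shows "ennreal (L / 4) \<le> (\<integral>\<^sup>+s. ennreal ((cos (\<rho> * (\<alpha> - s)))\<^sup>2) * indicator {0..L} s \<partial>lborel)"
proof -
  have \<rho>0: "\<rho> > 0" using \<rho> L by (smt (verit) divide_pos_pos)
  define \<Phi> where "\<Phi> s = s / 2 - sin (2 * (\<rho> * (\<alpha> - s))) / (4 * \<rho>)" for s
  have "(\<Phi> has_real_derivative (cos (\<rho> * (\<alpha> - s)))\<^sup>2) (at s)" for s
  proof -
    have "(\<Phi> has_real_derivative (1 + cos (2 * (\<rho> * (\<alpha> - s)))) / 2) (at s)"
      unfolding \<Phi>_def using \<rho>0 by (auto intro!: derivative_eq_intros simp: field_simps)
    moreover have "(1 + cos (2 * (\<rho> * (\<alpha> - s)))) / 2 = (cos (\<rho> * (\<alpha> - s)))\<^sup>2"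
      using cos_double_cos[of "\<rho> * (\<alpha> - s)"] by simp
    ultimately show ?thesis by simp
  qed
  then have "(\<integral>\<^sup>+s. ennreal ((cos (\<rho> * (\<alpha> - s)))\<^sup>2) * indicator {0..L} s \<partial>lborel) = \<Phi> L - \<Phi> 0"
    using L by (intro nn_integral_FTC_Icc) auto
  moreover have "L / 4 \<le> \<Phi> L - \<Phi> 0"
  proof -
    have "sin (2 * (\<rho> * (\<alpha> - L))) - sin (2 * (\<rho> * (\<alpha> - 0))) \<le> 2"
      using sin_le_one[of "2 * (\<rho> * (\<alpha> - L))"] sin_ge_minus_one[of "2 * (\<rho> * (\<alpha> - 0))"] by linarith
    then have "(sin (2 * (\<rho> * (\<alpha> - L))) - sin (2 * (\<rho> * (\<alpha> - 0)))) / (4 * \<rho>) \<le> 2 / (4 * \<rho>)"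
      using \<rho>0 by (intro divide_right_mono) auto
    also have "\<dots> \<le> L / 4" using \<rho> \<rho>0 L by (simp add: field_simps)
    finally show ?thesis by (simp add: \<Phi>_def diff_divide_distrib)
  qed
  ultimately show ?thesis by (simp add: ennreal_leI)
qed

lemma norm_powr_le_sum_Basis:
  fixes \<xi> :: "'a::euclidean_space"
  assumes r: "r > 0"
  shows "norm \<xi> powr r \<le> real DIM('a) powr r * (\<Sum>i\<in>Basis. \<bar>\<xi> \<bullet> i\<bar> powr r)"
proof -
  define m where "m = Max ((\<lambda>i. \<bar>\<xi> \<bullet> i\<bar>) ` Basis)"
  have "m \<in> (\<lambda>i. \<bar>\<xi> \<bullet> i\<bar>) ` Basis" unfolding m_def by (intro Max_in) auto
  then obtain j where j: "j \<in> Basis" "m = \<bar>\<xi> \<bullet> j\<bar>" by blast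
  have "norm \<xi> \<le> (\<Sum>i\<in>Basis. \<bar>\<xi> \<bullet> i\<bar>)" by (rule norm_le_l1)
  also have "\<dots> \<le> (\<Sum>i\<in>(Basis::'a set). m)" unfolding m_def by (intro sum_mono Max_ge) auto
  finally have "norm \<xi> powr r \<le> (real DIM('a) * m) powr r" using r by (intro powr_mono2) auto
  also have "\<dots> = real DIM('a) powr r * \<bar>\<xi> \<bullet> j\<bar> powr r" by (simp add: powr_mult j)
  also have "\<dots> \<le> real DIM('a) powr r * (\<Sum>i\<in>Basis. \<bar>\<xi> \<bullet> i\<bar> powr r)"
    using j by (intro mult_left_mono member_le_sum) auto
  finally show ?thesis .
qed

section \<open>Upper and lower bounds for the increments\<close>

lemma nn_integral_strip_le:
  fixes f :: "real \<Rightarrow> 'a \<Rightarrow> real" and g :: "'a \<Rightarrow> real"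
  assumes [measurable]: "g \<in> borel_measurable \<mu>" and nonneg: "0 \<le> T" "0 \<le> A" "\<And>\<xi>. 0 \<le> g \<xi>"
    and le: "\<And>s \<xi>. f s \<xi> \<le> indicator {0..T} s * (A * g \<xi>)"
  shows "(\<integral>\<^sup>+\<xi>. \<integral>\<^sup>+s. ennreal (f s \<xi>) \<partial>lborel \<partial>\<mu>) \<le> ennreal (T * A) * (\<integral>\<^sup>+\<xi>. ennreal (g \<xi>) \<partial>\<mu>)"
proof -
  have "(\<integral>\<^sup>+\<xi>. \<integral>\<^sup>+s. ennreal (f s \<xi>) \<partial>lborel \<partial>\<mu>) \<le> (\<integral>\<^sup>+\<xi>. ennreal (T * A) * ennreal (g \<xi>) \<partial>\<mu>)"
  proof (intro nn_integral_mono)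
    fix \<xi>
    have "(\<integral>\<^sup>+s. ennreal (f s \<xi>) \<partial>lborel) \<le> (\<integral>\<^sup>+s. ennreal (A * g \<xi>) * indicator {0..T} s \<partial>lborel)"
      by (intro nn_integral_mono order_trans[OF ennreal_leI[OF le]]) (auto simp: indicator_def)
    also have "\<dots> = ennreal (A * g \<xi>) * ennreal T" using nonneg by (simp add: nn_integral_cmult_indicator)
    also have "\<dots> = ennreal (T * A) * ennreal (g \<xi>)" using nonneg by (simp add: ennreal_mult[symmetric] mult_ac)
    finally show "(\<integral>\<^sup>+s. ennreal (f s \<xi>) \<partial>lborel) \<le> ennreal (T * A) * ennreal (g \<xi>)" .
  qed
  also have "\<dots> = ennreal (T * A) * (\<integral>\<^sup>+\<xi>. ennreal (g \<xi>) \<partial>\<mu>)" by (rule nn_integral_cmult) simp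
  finally show ?thesis .
qed

text \<open>
  When only one of the two times exceeds \<open>s\<close>, the other kernel vanishes and the Lipschitz bound is used
  between \<open>t\<^sub>i - s\<close> and 0, since then \<open>t\<^sub>i - s \<le> |t\<^sub>1 - t\<^sub>2|\<close>. Thus one bound covers both parts of the time integral.
\<close>

lemma retarded_wave_diff_sq_le:
  assumes t: "0 \<le> t\<^sub>1" "t\<^sub>1 \<le> T" "0 \<le> t\<^sub>2" "t\<^sub>2 \<le> T" and a: "0 < a" "a < 1"
  shows "(retarded_wave t\<^sub>1 \<rho> s - retarded_wave t\<^sub>2 \<rho> s)\<^sup>2
    \<le> indicator {0..T} s * (2 * (T\<^sup>2 + 4) * \<bar>t\<^sub>1 - t\<^sub>2\<bar> powr (2 * a) * ((1 + (\<rho>\<^sup>2) powr a) / (1 + \<rho>\<^sup>2)))"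
proof (cases "s \<in> {0..T}")
  case False
  then show ?thesis using t by (auto simp: retarded_wave_def indicator_def)
next
  case True
  define y where "y = retarded_wave t\<^sub>1 \<rho> s - retarded_wave t\<^sub>2 \<rho> s"
  have y1: "\<bar>y\<bar> \<le> \<bar>t\<^sub>1 - t\<^sub>2\<bar>"
    using wave_diff_bounds(1)[of "t\<^sub>1 - s" \<rho> "t\<^sub>2 - s"] wave_abs_le[of "t\<^sub>1 - s" \<rho>] wave_abs_le[of "t\<^sub>2 - s" \<rho>]
    by (auto simp: y_def retarded_wave_def indicator_def)
  have b: "\<bar>\<rho> * retarded_wave t \<rho> s\<bar> \<le> 1" for t
    using wave_diff_bounds(2)[of \<rho> "t - s"] by (simp add: retarded_wave_def indicator_def)
  have "\<bar>\<rho> * y\<bar> \<le> 2" using b[of t\<^sub>1] b[of t\<^sub>2] unfolding y_def right_diff_distrib by linarith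
  then have y2: "(\<rho> * y)\<^sup>2 \<le> 4" using abs_le_square_iff[of "\<rho> * y" 2] by simp
  have y3: "y\<^sup>2 \<le> (t\<^sub>1 - t\<^sub>2)\<^sup>2" using y1 abs_le_square_iff by blast
  also have "(t\<^sub>1 - t\<^sub>2)\<^sup>2 \<le> T\<^sup>2" using t by (intro abs_le_square_iff[THEN iffD1]) auto
  finally have "y\<^sup>2 \<le> (T\<^sup>2 + 4) / (1 + \<rho>\<^sup>2)" using y2 by (rule square_le_quotient)
  then have "y\<^sup>2 \<le> 2 * (T\<^sup>2 + 4) * \<bar>t\<^sub>1 - t\<^sub>2\<bar> powr (2 * a) * ((1 + (\<rho>\<^sup>2) powr a) / (1 + \<rho>\<^sup>2))"
    using y3 by (intro square_interpolation a) auto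
  then show ?thesis using True by (simp add: y_def)
qed

lemma nn_integral_retarded_wave_sq_ge:
  assumes t: "t > 0" and \<rho>: "\<rho> \<ge> 2 / t"
  shows "ennreal (t / (4 * \<rho>\<^sup>2)) \<le> (\<integral>\<^sup>+s. ennreal ((retarded_wave t \<rho> s)\<^sup>2) \<partial>lborel)"
proof -
  have \<rho>0: "\<rho> > 0" using \<rho> t by (smt (verit) divide_pos_pos)
  \<comment> \<open>the quarter period that turns the sine into a cosine\<close>
  define \<alpha> where "\<alpha> = t - pi / (2 * \<rho>)"
  have eq: "ennreal ((retarded_wave t \<rho> s)\<^sup>2)
      = ennreal (1 / \<rho>\<^sup>2) * (ennreal ((cos (\<rho> * (\<alpha> - s)))\<^sup>2) * indicator {0..t} s)" for s
  proof (cases "s \<in> {0..t}")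
    case True
    have "\<rho> * (\<alpha> - s) = - (pi / 2 - (t - s) * \<rho>)" using \<rho>0 by (simp add: \<alpha>_def field_simps)
    then have "cos (\<rho> * (\<alpha> - s)) = sin ((t - s) * \<rho>)" by (simp add: cos_diff)
    then show ?thesis using True \<rho>0
      by (simp add: retarded_wave_def wave_def power_divide ennreal_mult[symmetric])
  qed (simp add: retarded_wave_def)
  have "ennreal (t / (4 * \<rho>\<^sup>2)) = ennreal (1 / \<rho>\<^sup>2) * ennreal (t / 4)"
    using t by (simp add: ennreal_mult[symmetric])
  also have "\<dots> \<le> ennreal (1 / \<rho>\<^sup>2) * (\<integral>\<^sup>+s. ennreal ((cos (\<rho> * (\<alpha> - s)))\<^sup>2) * indicator {0..t} s \<partial>lborel)"
    using nn_integral_cos_sq_ge[OF t \<rho>] by (rule mult_left_mono) simp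
  also have "\<dots> = (\<integral>\<^sup>+s. ennreal ((retarded_wave t \<rho> s)\<^sup>2) \<partial>lborel)"
    unfolding eq by (rule nn_integral_cmult[symmetric]) measurable
  finally show ?thesis .
qed

text \<open>
  Only the times \<open>s \<le> 1\<close> are kept, where the difference of the two sines factors as
  \<open>2 sin (h \<rho> / 2)\<close> times a cosine; the square of the first factor is \<open>2 (1 - cos (h \<rho>))\<close>.
\<close>

lemma nn_integral_retarded_wave_diff_sq_ge:
  assumes h: "h \<ge> 0" and \<rho>: "\<rho> \<ge> 2"
  shows "ennreal ((1 - cos (h * \<rho>)) / (2 * \<rho>\<^sup>2))
    \<le> (\<integral>\<^sup>+s. ennreal ((retarded_wave (1 + h) \<rho> s - retarded_wave 1 \<rho> s)\<^sup>2) \<partial>lborel)"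
proof -
  define A where "A = 2 * (1 - cos (h * \<rho>)) / \<rho>\<^sup>2"
  have A: "A \<ge> 0" by (simp add: A_def)
  have le: "ennreal A * (ennreal ((cos (\<rho> * ((1 + h / 2) - s)))\<^sup>2) * indicator {0..1} s)
      \<le> ennreal ((retarded_wave (1 + h) \<rho> s - retarded_wave 1 \<rho> s)\<^sup>2)" for s
  proof (cases "s \<in> {0..1}")
    case True
    have "retarded_wave (1 + h) \<rho> s - retarded_wave 1 \<rho> s
        = (sin ((1 + h - s) * \<rho>) - sin ((1 - s) * \<rho>)) / \<rho>"
      using True h \<rho> by (simp add: retarded_wave_def wave_def diff_divide_distrib)
    also have "\<dots> = 2 * sin (h * \<rho> / 2) * cos (\<rho> * ((1 + h / 2) - s)) / \<rho>"
    proof -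
      have "((1 + h - s) * \<rho> - (1 - s) * \<rho>) / 2 = h * \<rho> / 2" by (simp add: field_simps)
      moreover have "((1 + h - s) * \<rho> + (1 - s) * \<rho>) / 2 = \<rho> * ((1 + h / 2) - s)" by (simp add: field_simps)
      ultimately show ?thesis by (simp only: sin_diff_sin)
    qed
    finally have "(retarded_wave (1 + h) \<rho> s - retarded_wave 1 \<rho> s)\<^sup>2
        = 4 * (sin (h * \<rho> / 2))\<^sup>2 * (cos (\<rho> * ((1 + h / 2) - s)))\<^sup>2 / \<rho>\<^sup>2"
      by (simp add: power_mult_distrib power_divide)
    also have "4 * (sin (h * \<rho> / 2))\<^sup>2 = 2 * (1 - cos (h * \<rho>))"
      using cos_double_sin[of "h * \<rho> / 2"] by simp
    finally have "(retarded_wave (1 + h) \<rho> s - retarded_wave 1 \<rho> s)\<^sup>2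
        = A * (cos (\<rho> * ((1 + h / 2) - s)))\<^sup>2" by (simp add: A_def)
    then show ?thesis using True A by (simp add: ennreal_mult)
  qed simp
  have "ennreal ((1 - cos (h * \<rho>)) / (2 * \<rho>\<^sup>2)) = ennreal A * ennreal (1 / 4)"
  proof -
    have "(1 - cos (h * \<rho>)) / (2 * \<rho>\<^sup>2) = A * (1 / 4)" using \<rho> by (simp add: A_def field_simps)
    then show ?thesis using A by (simp only: ennreal_mult)
  qed
  also have "\<dots> \<le> ennreal A * (\<integral>\<^sup>+s. ennreal ((cos (\<rho> * ((1 + h / 2) - s)))\<^sup>2) * indicator {0..1} s \<partial>lborel)"
    using nn_integral_cos_sq_ge[of 1 \<rho> "1 + h / 2"] \<rho> by (intro mult_left_mono) auto
  also have "\<dots> = (\<integral>\<^sup>+s. ennreal A * (ennreal ((cos (\<rho> * ((1 + h / 2) - s)))\<^sup>2) * indicator {0..1} s) \<partial>lborel)"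
    by (rule nn_integral_cmult[symmetric]) measurable
  also have "\<dots> \<le> (\<integral>\<^sup>+s. ennreal ((retarded_wave (1 + h) \<rho> s - retarded_wave 1 \<rho> s)\<^sup>2) \<partial>lborel)"
    by (intro nn_integral_mono le)
  finally show ?thesis .
qed

lemma dyadic_powr: "(1 / 2 ^ n) powr (2 / real m) = (2 powr (- 2 * (1 / real m))) ^ n"
proof -
  have "(1::real) / 2 ^ n = 2 powr (- real n)" by (simp add: powr_minus powr_realpow divide_inverse)
  then have "(1 / 2 ^ n) powr (2 / real m) = 2 powr ((- real n) * (2 / real m))"
    using powr_powr[of 2 "- real n" "2 / real m"] by simp
  also have "(- real n) * (2 / real m) = (- 2 * (1 / real m)) * real n" by simp
  also have "2 powr \<dots> = (2 powr (- 2 * (1 / real m))) ^ n"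
    by (subst powr_powr[symmetric]) (simp add: powr_realpow)
  finally show ?thesis .
qed

text \<open>
  The exponent and the spectral measure determine the law of the convolution, so the analysis of its
  increments is carried out in terms of these two.
\<close>

locale wave_convolution =
  fixes M :: "'w measure" and \<psi> :: "'a::euclidean_space \<Rightarrow> complex" and \<mu> :: "'a measure"
    and F :: "(real \<times> 'a \<Rightarrow> real) \<Rightarrow> 'w \<Rightarrow> real" and W :: "real \<Rightarrow> 'a \<Rightarrow> 'w \<Rightarrow> real"
  assumes prob: "prob_space M" and conv: "stochastic_convolution M \<psi> \<mu> F W"
    and Im_psi: "Im (\<psi> \<xi>) = 0" and Re_psi: "Re (\<psi> \<xi>) \<ge> 0"
    and Re_psi_meas [measurable]: "(\<lambda>\<xi>. Re (\<psi> \<xi>)) \<in> borel_measurable borel"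
    and tempered: "tempered_measure \<mu>" and dalang: "dalang_condition \<psi> \<mu>"
begin

definition incr_var :: "real \<Rightarrow> 'a \<Rightarrow> real \<Rightarrow> 'a \<Rightarrow> real" where
  "incr_var t x s y = (LINT \<omega>|M. (W t x \<omega> - W s y \<omega>)\<^sup>2)"

definition inv_norm_const :: real where "inv_norm_const = 1 / (2 * pi) ^ DIM('a)"

lemma inv_norm_const_pos: "inv_norm_const > 0" by (simp add: inv_norm_const_def)

lemma incr_var_nonneg: "incr_var t x s y \<ge> 0" by (simp add: incr_var_def)

lemma sets_mu [measurable_cong]: "sets \<mu> = sets borel"
  using tempered by (simp add: tempered_measure_def)

abbreviation \<rho> :: "'a \<Rightarrow> real" where "\<rho> \<xi> \<equiv> sqrt (Re (\<psi> \<xi>))"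

lemma rho_sq: "(\<rho> \<xi>)\<^sup>2 = Re (\<psi> \<xi>)" using Re_psi[of \<xi>] by simp

lemma cmod_psi: "cmod (\<psi> \<xi>) = Re (\<psi> \<xi>)"
  using Im_psi[of \<xi>] Re_psi[of \<xi>] by (simp add: cmod_def)

lemma temporal_incr_spectral:
  assumes "t\<^sub>1 \<ge> 0" and "t\<^sub>2 \<ge> 0"
  shows "ennreal (incr_var t\<^sub>1 x t\<^sub>2 x) = ennreal inv_norm_const * (\<integral>\<^sup>+\<xi>. \<integral>\<^sup>+s.
      ennreal ((retarded_wave t\<^sub>1 (\<rho> \<xi>) s - retarded_wave t\<^sub>2 (\<rho> \<xi>) s)\<^sup>2) \<partial>lborel \<partial>\<mu>)"
  unfolding incr_var_def inv_norm_const_def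
  by (subst convolution_increment_spectral[OF prob conv Im_psi Re_psi Re_psi_meas tempered dalang assms])
    (simp add: power2_diff mult.assoc)

lemma spatial_incr_spectral:
  assumes "t \<ge> 0"
  shows "ennreal (incr_var t x t y) = ennreal inv_norm_const * (\<integral>\<^sup>+\<xi>. \<integral>\<^sup>+s.
      ennreal ((retarded_wave t (\<rho> \<xi>) s)\<^sup>2 * (2 * (1 - cos ((x - y) \<bullet> \<xi>)))) \<partial>lborel \<partial>\<mu>)"
  unfolding incr_var_def inv_norm_const_def
  by (subst convolution_increment_spectral[OF prob conv Im_psi Re_psi Re_psi_meas tempered dalang assms assms])
    (simp add: power2_eq_square algebra_simps)

lemma incr_le_of_spectral:
  assumes eq: "ennreal (incr_var t x s y) = ennreal inv_norm_const * J" and J: "J \<le> ennreal B * I" and I: "I < \<infinity>" and B: "B \<ge> 0"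
  shows "incr_var t x s y \<le> inv_norm_const * enn2real I * B"
proof -
  have "ennreal (incr_var t x s y) \<le> ennreal inv_norm_const * (ennreal B * I)"
    unfolding eq using J by (rule mult_left_mono) simp
  also have "I = ennreal (enn2real I)" using I by simp
  also have "ennreal inv_norm_const * (ennreal B * ennreal (enn2real I)) = ennreal (inv_norm_const * enn2real I * B)"
    using inv_norm_const_pos B by (simp add: ennreal_mult[symmetric] mult_ac)
  finally show ?thesis using inv_norm_const_pos B by (subst (asm) ennreal_le_iff) auto
qed

lemma temporal_incr_le:
  assumes a: "0 < a" "a < 1" and T: "T \<ge> 0"
    and I: "(\<integral>\<^sup>+\<xi>. ennreal ((1 + Re (\<psi> \<xi>) powr a) / (1 + Re (\<psi> \<xi>))) \<partial>\<mu>) < \<infinity>"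
  shows "\<exists>C\<ge>0. \<forall>t\<^sub>1\<in>{0..T}. \<forall>t\<^sub>2\<in>{0..T}. \<forall>x. incr_var t\<^sub>1 x t\<^sub>2 x \<le> C * \<bar>t\<^sub>1 - t\<^sub>2\<bar> powr (2 * a)"
proof -
  define I where "I = (\<integral>\<^sup>+\<xi>. ennreal ((1 + Re (\<psi> \<xi>) powr a) / (1 + Re (\<psi> \<xi>))) \<partial>\<mu>)"
  define C where "C = inv_norm_const * enn2real I * (T * (2 * (T\<^sup>2 + 4)))"
  have "incr_var t\<^sub>1 x t\<^sub>2 x \<le> C * \<bar>t\<^sub>1 - t\<^sub>2\<bar> powr (2 * a)" if t: "t\<^sub>1 \<in> {0..T}" "t\<^sub>2 \<in> {0..T}" for t\<^sub>1 t\<^sub>2 x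
  proof -
    have "incr_var t\<^sub>1 x t\<^sub>2 x \<le> inv_norm_const * enn2real I * (T * (2 * (T\<^sup>2 + 4) * \<bar>t\<^sub>1 - t\<^sub>2\<bar> powr (2 * a)))"
    proof (rule incr_le_of_spectral)
      show "ennreal (incr_var t\<^sub>1 x t\<^sub>2 x) = ennreal inv_norm_const * (\<integral>\<^sup>+\<xi>. \<integral>\<^sup>+s.
          ennreal ((retarded_wave t\<^sub>1 (\<rho> \<xi>) s - retarded_wave t\<^sub>2 (\<rho> \<xi>) s)\<^sup>2) \<partial>lborel \<partial>\<mu>)"
        using t by (intro temporal_incr_spectral) auto
      show "(\<integral>\<^sup>+\<xi>. \<integral>\<^sup>+s. ennreal ((retarded_wave t\<^sub>1 (\<rho> \<xi>) s - retarded_wave t\<^sub>2 (\<rho> \<xi>) s)\<^sup>2) \<partial>lborel \<partial>\<mu>)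
          \<le> ennreal (T * (2 * (T\<^sup>2 + 4) * \<bar>t\<^sub>1 - t\<^sub>2\<bar> powr (2 * a))) * I"
        unfolding I_def
      proof (rule nn_integral_strip_le)
        show "(retarded_wave t\<^sub>1 (\<rho> \<xi>) s - retarded_wave t\<^sub>2 (\<rho> \<xi>) s)\<^sup>2 \<le> indicator {0..T} s *
            (2 * (T\<^sup>2 + 4) * \<bar>t\<^sub>1 - t\<^sub>2\<bar> powr (2 * a) * ((1 + Re (\<psi> \<xi>) powr a) / (1 + Re (\<psi> \<xi>))))" for s \<xi>
          using retarded_wave_diff_sq_le[of t\<^sub>1 T t\<^sub>2 a "\<rho> \<xi>" s] t a unfolding rho_sq by simp
      qed (use T Re_psi in \<open>auto intro!: divide_nonneg_nonneg add_nonneg_nonneg\<close>)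
    qed (use T I in \<open>auto simp: I_def\<close>)
    then show ?thesis by (simp add: C_def mult_ac)
  qed
  moreover have "C \<ge> 0" using T inv_norm_const_pos by (simp add: C_def)
  ultimately show ?thesis by blast
qed

lemma spatial_incr_le:
  assumes b: "0 < b" "b < 1" and T: "T \<ge> 0"
    and I: "(\<integral>\<^sup>+\<xi>. ennreal (norm \<xi> powr (2 * b) / (1 + Re (\<psi> \<xi>))) \<partial>\<mu>) < \<infinity>"
  shows "\<exists>C\<ge>0. \<forall>t\<in>{0..T}. \<forall>x y. incr_var t x t y \<le> C * norm (x - y) powr (2 * b)"
proof -
  define I where "I = (\<integral>\<^sup>+\<xi>. ennreal (norm \<xi> powr (2 * b) / (1 + Re (\<psi> \<xi>))) \<partial>\<mu>)"
  define C where "C = inv_norm_const * enn2real I * (T * (4 * (T\<^sup>2 + 1)))"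
  have "incr_var t x t y \<le> C * norm (x - y) powr (2 * b)" if t: "t \<in> {0..T}" for t x y
  proof -
    have "incr_var t x t y \<le> inv_norm_const * enn2real I * (T * (4 * (T\<^sup>2 + 1) * norm (x - y) powr (2 * b)))"
    proof (rule incr_le_of_spectral)
      show "ennreal (incr_var t x t y) = ennreal inv_norm_const * (\<integral>\<^sup>+\<xi>. \<integral>\<^sup>+s.
          ennreal ((retarded_wave t (\<rho> \<xi>) s)\<^sup>2 * (2 * (1 - cos ((x - y) \<bullet> \<xi>)))) \<partial>lborel \<partial>\<mu>)"
        using t by (intro spatial_incr_spectral) auto
      show "(\<integral>\<^sup>+\<xi>. \<integral>\<^sup>+s. ennreal ((retarded_wave t (\<rho> \<xi>) s)\<^sup>2 * (2 * (1 - cos ((x - y) \<bullet> \<xi>)))) \<partial>lborel \<partial>\<mu>)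
          \<le> ennreal (T * (4 * (T\<^sup>2 + 1) * norm (x - y) powr (2 * b))) * I"
        unfolding I_def
      proof (rule nn_integral_strip_le)
        fix s \<xi>
        have p: "1 + Re (\<psi> \<xi>) > 0" using Re_psi[of \<xi>] by simp
        have strip: "a * (k / q) * (4 * (u * v)) = a * (4 * k * u * (v / q))" for a k q u v :: real by simp
        have "(retarded_wave t (\<rho> \<xi>) s)\<^sup>2 \<le> indicator {0..t} s * ((t\<^sup>2 + 1) / (1 + Re (\<psi> \<xi>)))"
          using retarded_wave_sq_le[of t "\<rho> \<xi>" s] unfolding rho_sq .
        also have "\<dots> \<le> indicator {0..T} s * ((T\<^sup>2 + 1) / (1 + Re (\<psi> \<xi>)))"
          using t p by (intro mult_mono divide_right_mono add_mono power_mono) (auto simp: indicator_def)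
        finally have 1: "(retarded_wave t (\<rho> \<xi>) s)\<^sup>2 \<le> indicator {0..T} s * ((T\<^sup>2 + 1) / (1 + Re (\<psi> \<xi>)))" .
        have "1 - cos ((x - y) \<bullet> \<xi>) \<le> 2 * \<bar>(x - y) \<bullet> \<xi>\<bar> powr (2 * b)"
          by (rule one_minus_cos_le_powr[OF b])
        also have "\<dots> \<le> 2 * (norm (x - y) * norm \<xi>) powr (2 * b)"
          using b Cauchy_Schwarz_ineq2[of "x - y" \<xi>] by (intro mult_left_mono powr_mono2) auto
        finally have 2: "2 * (1 - cos ((x - y) \<bullet> \<xi>)) \<le> 4 * (norm (x - y) powr (2 * b) * norm \<xi> powr (2 * b))"
          by (simp add: powr_mult)
        have "(retarded_wave t (\<rho> \<xi>) s)\<^sup>2 * (2 * (1 - cos ((x - y) \<bullet> \<xi>)))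
            \<le> (indicator {0..T} s * ((T\<^sup>2 + 1) / (1 + Re (\<psi> \<xi>)))) * (4 * (norm (x - y) powr (2 * b) * norm \<xi> powr (2 * b)))"
          using p by (intro mult_mono 1 2) (auto intro!: mult_nonneg_nonneg divide_nonneg_nonneg)
        then show "(retarded_wave t (\<rho> \<xi>) s)\<^sup>2 * (2 * (1 - cos ((x - y) \<bullet> \<xi>))) \<le> indicator {0..T} s *
            (4 * (T\<^sup>2 + 1) * norm (x - y) powr (2 * b) * (norm \<xi> powr (2 * b) / (1 + Re (\<psi> \<xi>))))"
          unfolding strip .
      qed (use T Re_psi in \<open>auto intro!: divide_nonneg_nonneg add_nonneg_nonneg\<close>)
    qed (use T I in \<open>auto simp: I_def\<close>)
    then show ?thesis by (simp add: C_def mult_ac)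
  qed
  moreover have "C \<ge> 0" using T inv_norm_const_pos by (simp add: C_def)
  ultimately show ?thesis by blast
qed

lemma spectral_le_incr:
  assumes eq: "ennreal (incr_var t x s y) = ennreal inv_norm_const * J" and le: "L \<le> ennreal K * J" and K: "K \<ge> 0"
  shows "L \<le> ennreal (K / inv_norm_const * incr_var t x s y)"
proof -
  have "J = ennreal (1 / inv_norm_const) * (ennreal inv_norm_const * J)"
    using inv_norm_const_pos by (simp add: mult.assoc[symmetric] ennreal_mult[symmetric])
  also have "\<dots> = ennreal (1 / inv_norm_const * incr_var t x s y)"
    using inv_norm_const_pos incr_var_nonneg by (subst eq[symmetric]) (simp add: ennreal_mult[symmetric])
  finally have "ennreal K * J = ennreal (K / inv_norm_const * incr_var t x s y)"
    using K inv_norm_const_pos incr_var_nonneg by (simp add: ennreal_mult[symmetric])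
  then show ?thesis using le by simp
qed

text \<open>
  The variances are bounded below at high frequencies, where the squared kernels average out over the
  time interval.
\<close>

definition high_weight :: "real \<Rightarrow> 'a \<Rightarrow> ennreal" where
  "high_weight r \<xi> = (if \<rho> \<xi> \<ge> r then ennreal (1 / (1 + Re (\<psi> \<xi>))) else 0)"

lemma high_weight_measurable [measurable]: "high_weight r \<in> borel_measurable borel"
  unfolding high_weight_def by measurable

lemma high_weight_finite: "(\<integral>\<^sup>+\<xi>. high_weight r \<xi> \<partial>\<mu>) < \<infinity>"
proof -
  have "(\<integral>\<^sup>+\<xi>. high_weight r \<xi> \<partial>\<mu>) \<le> (\<integral>\<^sup>+\<xi>. ennreal (1 / (1 + Re (\<psi> \<xi>))) \<partial>\<mu>)"
    by (intro nn_integral_mono) (simp add: high_weight_def)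
  also have "\<dots> < \<infinity>" using dalang by (simp add: dalang_condition_def)
  finally show ?thesis .
qed

text \<open>
  The kernels produce lower bounds with the weight \<open>1 / \<rho>\<^sup>2\<close>, which dominates \<open>1 / (1 + \<psi>)\<close>.
\<close>

lemma ennreal_mult_high_weight_le:
  assumes "g \<ge> 0" and K: "K > 0" and "r > 0" and J: "\<rho> \<xi> \<ge> r \<Longrightarrow> ennreal (g / (K * (\<rho> \<xi>)\<^sup>2)) \<le> J"
  shows "ennreal g * high_weight r \<xi> \<le> ennreal K * J"
proof (cases "\<rho> \<xi> \<ge> r")
  case True
  have p: "Re (\<psi> \<xi>) > 0" using True \<open>r > 0\<close> Re_psi[of \<xi>]
    by (metis less_eq_real_def less_le_trans not_less real_sqrt_zero)
  have "ennreal g * high_weight r \<xi> = ennreal (g / (1 + Re (\<psi> \<xi>)))"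
    using True assms(1) p by (simp add: high_weight_def ennreal_mult[symmetric])
  also have "\<dots> \<le> ennreal (K * (g / (K * (\<rho> \<xi>)\<^sup>2)))"
  proof (rule ennreal_leI)
    have "g / (1 + Re (\<psi> \<xi>)) \<le> g / Re (\<psi> \<xi>)" using p assms(1) by (intro divide_left_mono) auto
    then show "g / (1 + Re (\<psi> \<xi>)) \<le> K * (g / (K * (\<rho> \<xi>)\<^sup>2))" using K by (simp add: rho_sq)
  qed
  also have "\<dots> = ennreal K * ennreal (g / (K * (\<rho> \<xi>)\<^sup>2))" using K assms(1) by (intro ennreal_mult) auto
  also have "\<dots> \<le> ennreal K * J" using J[OF True] by (rule mult_left_mono) simp
  finally show ?thesis .
qed (simp add: high_weight_def)

lemma temporal_incr_ge:
  assumes h: "h \<ge> 0"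
  shows "(\<integral>\<^sup>+\<xi>. ennreal (1 - cos (h * \<rho> \<xi>)) * high_weight 2 \<xi> \<partial>\<mu>) \<le> ennreal (2 / inv_norm_const * incr_var (1 + h) x 1 x)"
proof (rule spectral_le_incr)
  show "ennreal (incr_var (1 + h) x 1 x) = ennreal inv_norm_const * (\<integral>\<^sup>+\<xi>. \<integral>\<^sup>+s.
      ennreal ((retarded_wave (1 + h) (\<rho> \<xi>) s - retarded_wave 1 (\<rho> \<xi>) s)\<^sup>2) \<partial>lborel \<partial>\<mu>)"
    using h by (intro temporal_incr_spectral) auto
  have "(\<integral>\<^sup>+\<xi>. ennreal (1 - cos (h * \<rho> \<xi>)) * high_weight 2 \<xi> \<partial>\<mu>)
      \<le> (\<integral>\<^sup>+\<xi>. ennreal 2 * (\<integral>\<^sup>+s. ennreal ((retarded_wave (1 + h) (\<rho> \<xi>) s - retarded_wave 1 (\<rho> \<xi>) s)\<^sup>2) \<partial>lborel) \<partial>\<mu>)"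
    by (intro nn_integral_mono ennreal_mult_high_weight_le nn_integral_retarded_wave_diff_sq_ge h) auto
  also have "\<dots> = ennreal 2 * (\<integral>\<^sup>+\<xi>. \<integral>\<^sup>+s. ennreal ((retarded_wave (1 + h) (\<rho> \<xi>) s - retarded_wave 1 (\<rho> \<xi>) s)\<^sup>2) \<partial>lborel \<partial>\<mu>)"
    by (intro nn_integral_cmult) measurable
  finally show "(\<integral>\<^sup>+\<xi>. ennreal (1 - cos (h * \<rho> \<xi>)) * high_weight 2 \<xi> \<partial>\<mu>) \<le> \<dots>" .
qed simp

lemma spatial_incr_ge:
  assumes t: "t > 0"
  shows "(\<integral>\<^sup>+\<xi>. ennreal (1 - cos ((x - y) \<bullet> \<xi>)) * high_weight (2 / t) \<xi> \<partial>\<mu>) \<le> ennreal (2 / t / inv_norm_const * incr_var t x t y)"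
proof (rule spectral_le_incr)
  show "ennreal (incr_var t x t y) = ennreal inv_norm_const * (\<integral>\<^sup>+\<xi>. \<integral>\<^sup>+s.
      ennreal ((retarded_wave t (\<rho> \<xi>) s)\<^sup>2 * (2 * (1 - cos ((x - y) \<bullet> \<xi>)))) \<partial>lborel \<partial>\<mu>)"
    using t by (intro spatial_incr_spectral) auto
  have "(\<integral>\<^sup>+\<xi>. ennreal (1 - cos ((x - y) \<bullet> \<xi>)) * high_weight (2 / t) \<xi> \<partial>\<mu>)
      \<le> (\<integral>\<^sup>+\<xi>. ennreal (2 / t) * (\<integral>\<^sup>+s. ennreal ((retarded_wave t (\<rho> \<xi>) s)\<^sup>2 * (2 * (1 - cos ((x - y) \<bullet> \<xi>)))) \<partial>lborel) \<partial>\<mu>)"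
  proof (intro nn_integral_mono ennreal_mult_high_weight_le)
    fix \<xi> assume r: "\<rho> \<xi> \<ge> 2 / t"
    define g where "g = 1 - cos ((x - y) \<bullet> \<xi>)"
    have g: "g \<ge> 0" by (simp add: g_def)
    have "ennreal (g / (2 / t * (\<rho> \<xi>)\<^sup>2)) = ennreal (t / (4 * (\<rho> \<xi>)\<^sup>2)) * ennreal (2 * g)"
      using g t by (subst ennreal_mult[symmetric]) (auto simp: mult_ac)
    also have "\<dots> \<le> (\<integral>\<^sup>+s. ennreal ((retarded_wave t (\<rho> \<xi>) s)\<^sup>2) \<partial>lborel) * ennreal (2 * g)"
      by (intro mult_right_mono nn_integral_retarded_wave_sq_ge t r) auto
    also have "\<dots> = (\<integral>\<^sup>+s. ennreal ((retarded_wave t (\<rho> \<xi>) s)\<^sup>2) * ennreal (2 * g) \<partial>lborel)"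
      by (rule nn_integral_multc[symmetric]) measurable
    also have "\<dots> = (\<integral>\<^sup>+s. ennreal ((retarded_wave t (\<rho> \<xi>) s)\<^sup>2 * (2 * g)) \<partial>lborel)"
      using g by (intro nn_integral_cong) (simp add: ennreal_mult)
    finally show "ennreal ((1 - cos ((x - y) \<bullet> \<xi>)) / (2 / t * (\<rho> \<xi>)\<^sup>2))
        \<le> (\<integral>\<^sup>+s. ennreal ((retarded_wave t (\<rho> \<xi>) s)\<^sup>2 * (2 * (1 - cos ((x - y) \<bullet> \<xi>)))) \<partial>lborel)"
      by (simp add: g_def)
  qed (use t in auto)
  also have "\<dots> = ennreal (2 / t) * (\<integral>\<^sup>+\<xi>. \<integral>\<^sup>+s. ennreal ((retarded_wave t (\<rho> \<xi>) s)\<^sup>2 * (2 * (1 - cos ((x - y) \<bullet> \<xi>)))) \<partial>lborel \<partial>\<mu>)"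
    by (intro nn_integral_cmult) measurable
  finally show "(\<integral>\<^sup>+\<xi>. ennreal (1 - cos ((x - y) \<bullet> \<xi>)) * high_weight (2 / t) \<xi> \<partial>\<mu>) \<le> \<dots>" .
qed (use t in simp)

text \<open>
  The frequencies with \<open>\<rho> \<xi> < 2\<close>, which the lower bound on the variance leaves out, contribute at most
  \<open>4 powr b\<close> times the integral in \<open>dalang_condition\<close>.
\<close>

lemma temporal_condition_of_incr_bound:
  assumes m: "0 < m"
    and bound: "\<And>n::nat. incr_var (1 + 1 / 2 ^ n) x 1 x \<le> B * (1 / 2 ^ n) powr (2 / real m)"
  shows "temporal_condition \<psi> \<mu>"
proof -
  \<comment> \<open>any exponent strictly below the Hoelder exponent \<open>1 / m\<close> works\<close>
  define b where "b = 1 / (2 * real m)"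
  have b: "0 < b" "b < 1" "b < 1 / real m" using m by (auto simp: b_def field_simps)
  have "(\<integral>\<^sup>+\<xi>. ennreal (\<bar>\<rho> \<xi>\<bar> powr (2 * b)) * high_weight 2 \<xi> \<partial>\<mu>) < \<infinity>"
  proof (rule nn_integral_powr_of_dyadic_cos[where \<gamma> = "1 / real m" and C = "2 / inv_norm_const * B"])
    fix n :: nat
    have "(\<integral>\<^sup>+\<xi>. ennreal (1 - cos (\<rho> \<xi> / 2 ^ n)) * high_weight 2 \<xi> \<partial>\<mu>) \<le> ennreal (2 / inv_norm_const * incr_var (1 + 1 / 2 ^ n) x 1 x)"
      using temporal_incr_ge[of "1 / 2 ^ n" x] by simp
    also have "\<dots> \<le> ennreal (2 / inv_norm_const * (B * (1 / 2 ^ n) powr (2 / real m)))"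
      using bound[of n] inv_norm_const_pos by (intro ennreal_leI mult_left_mono) auto
    finally show "(\<integral>\<^sup>+\<xi>. ennreal (1 - cos (\<rho> \<xi> / 2 ^ n)) * high_weight 2 \<xi> \<partial>\<mu>)
        \<le> ennreal (2 / inv_norm_const * B * (2 powr (- 2 * (1 / real m))) ^ n)"
      by (simp only: dyadic_powr mult.assoc)
  qed (use b high_weight_finite in auto)
  moreover have "(\<integral>\<^sup>+\<xi>. ennreal (cmod (\<psi> \<xi>) powr b / (1 + Re (\<psi> \<xi>))) \<partial>\<mu>)
      \<le> (\<integral>\<^sup>+\<xi>. ennreal (\<bar>\<rho> \<xi>\<bar> powr (2 * b)) * high_weight 2 \<xi> + ennreal (4 powr b) * ennreal (1 / (1 + Re (\<psi> \<xi>))) \<partial>\<mu>)"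
  proof (intro nn_integral_mono)
    fix \<xi>
    have p: "Re (\<psi> \<xi>) \<ge> 0" by (rule Re_psi)
    have rb: "\<bar>\<rho> \<xi>\<bar> powr (2 * b) = Re (\<psi> \<xi>) powr b"
      using p by (cases "Re (\<psi> \<xi>) = 0") (simp_all add: powr_half_sqrt[symmetric] powr_powr)
    show "ennreal (cmod (\<psi> \<xi>) powr b / (1 + Re (\<psi> \<xi>)))
        \<le> ennreal (\<bar>\<rho> \<xi>\<bar> powr (2 * b)) * high_weight 2 \<xi> + ennreal (4 powr b) * ennreal (1 / (1 + Re (\<psi> \<xi>)))"
    proof (cases "\<rho> \<xi> \<ge> 2")
      case True
      then have "ennreal (\<bar>\<rho> \<xi>\<bar> powr (2 * b)) * high_weight 2 \<xi> = ennreal (cmod (\<psi> \<xi>) powr b / (1 + Re (\<psi> \<xi>)))"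
        using p unfolding high_weight_def rb cmod_psi by (simp add: ennreal_mult[symmetric])
      then show ?thesis by simp
    next
      case False
      then have "(\<rho> \<xi>)\<^sup>2 \<le> 2\<^sup>2" using p by (intro power_mono) auto
      then have "cmod (\<psi> \<xi>) powr b \<le> 4 powr b" using b p unfolding rho_sq cmod_psi by (intro powr_mono2) auto
      then have "ennreal (cmod (\<psi> \<xi>) powr b / (1 + Re (\<psi> \<xi>))) \<le> ennreal (4 powr b * (1 / (1 + Re (\<psi> \<xi>))))"
        using p by (intro ennreal_leI) (simp add: divide_right_mono)
      also have "\<dots> = ennreal (4 powr b) * ennreal (1 / (1 + Re (\<psi> \<xi>)))" using p by (intro ennreal_mult) auto
      finally show ?thesis by (rule order_trans) simp
    qed
  qed
  moreover have "\<dots> = (\<integral>\<^sup>+\<xi>. ennreal (\<bar>\<rho> \<xi>\<bar> powr (2 * b)) * high_weight 2 \<xi> \<partial>\<mu>)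
      + ennreal (4 powr b) * (\<integral>\<^sup>+\<xi>. ennreal (1 / (1 + Re (\<psi> \<xi>))) \<partial>\<mu>)"
    by (subst nn_integral_add) (auto simp: nn_integral_cmult)
  ultimately have "(\<integral>\<^sup>+\<xi>. ennreal (cmod (\<psi> \<xi>) powr b / (1 + Re (\<psi> \<xi>))) \<partial>\<mu>) < \<infinity>"
    using dalang by (auto simp: dalang_condition_def ennreal_mult_less_top intro: le_less_trans)
  then show ?thesis using b unfolding temporal_condition_def by blast
qed

text \<open>
  Increments along the coordinate axes control each \<open>|\<xi> \<bullet> i|\<close> and thereby the norm. The divergence of \<open>\<psi>\<close>
  at infinity confines the frequencies with \<open>\<rho> \<xi> < 2 / t\<close> to a bounded set, on which \<open>norm \<xi> powr (2 b)\<close> is bounded.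
\<close>

lemma spatial_condition_of_incr_bound:
  assumes m: "0 < m" and t: "t > 0" and lim: "filterlim \<psi> at_infinity at_infinity"
    and bound: "\<And>i n. i \<in> Basis \<Longrightarrow> incr_var t ((1 / 2 ^ n) *\<^sub>R i) t 0 \<le> B * (1 / 2 ^ n) powr (2 / real m)"
  shows "spatial_condition \<psi> \<mu>"
proof -
  \<comment> \<open>any exponent strictly below the Hoelder exponent \<open>1 / m\<close> works\<close>
  define b where "b = 1 / (2 * real m)"
  have b: "0 < b" "b < 1" "b < 1 / real m" using m by (auto simp: b_def field_simps)
  define w where "w = high_weight (2 / t)"
  have w_meas [measurable]: "w \<in> borel_measurable borel" unfolding w_def by measurable
  obtain R where R: "\<And>\<xi>. norm \<xi> \<ge> R \<Longrightarrow> cmod (\<psi> \<xi>) \<ge> (2 / t)\<^sup>2"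
    using lim[unfolded filterlim_at_infinity[OF order_refl], rule_format, of "(2 / t)\<^sup>2"] t
    by (auto simp: eventually_at_infinity)
  have coord: "(\<integral>\<^sup>+\<xi>. ennreal (\<bar>\<xi> \<bullet> i\<bar> powr (2 * b)) * w \<xi> \<partial>\<mu>) < \<infinity>" if i: "i \<in> Basis" for i
  proof (rule nn_integral_powr_of_dyadic_cos[where \<gamma> = "1 / real m" and C = "2 / t / inv_norm_const * B"])
    fix n :: nat
    have "(\<integral>\<^sup>+\<xi>. ennreal (1 - cos ((\<xi> \<bullet> i) / 2 ^ n)) * w \<xi> \<partial>\<mu>) \<le> ennreal (2 / t / inv_norm_const * incr_var t ((1 / 2 ^ n) *\<^sub>R i) t 0)"
      using spatial_incr_ge[OF t, of "(1 / 2 ^ n) *\<^sub>R i" 0] by (simp add: w_def inner_commute)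
    also have "\<dots> \<le> ennreal (2 / t / inv_norm_const * (B * (1 / 2 ^ n) powr (2 / real m)))"
      using bound[OF i, of n] inv_norm_const_pos t by (intro ennreal_leI mult_left_mono) auto
    finally show "(\<integral>\<^sup>+\<xi>. ennreal (1 - cos ((\<xi> \<bullet> i) / 2 ^ n)) * w \<xi> \<partial>\<mu>)
        \<le> ennreal (2 / t / inv_norm_const * B * (2 powr (- 2 * (1 / real m))) ^ n)"
      by (simp only: dyadic_powr mult.assoc)
  qed (use b high_weight_finite[of "2 / t"] in \<open>auto simp: w_def\<close>)
  define D where "D = real DIM('a) powr (2 * b)"
  have D: "D \<ge> 0" by (simp add: D_def)
  have "(\<integral>\<^sup>+\<xi>. ennreal (norm \<xi> powr (2 * b) / (1 + Re (\<psi> \<xi>))) \<partial>\<mu>)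
      \<le> (\<integral>\<^sup>+\<xi>. ennreal D * (\<Sum>i\<in>Basis. ennreal (\<bar>\<xi> \<bullet> i\<bar> powr (2 * b)) * w \<xi>)
          + ennreal (\<bar>R\<bar> powr (2 * b)) * ennreal (1 / (1 + Re (\<psi> \<xi>))) \<partial>\<mu>)"
  proof (intro nn_integral_mono)
    fix \<xi> :: 'a
    have p: "Re (\<psi> \<xi>) \<ge> 0" by (rule Re_psi)
    show "ennreal (norm \<xi> powr (2 * b) / (1 + Re (\<psi> \<xi>)))
        \<le> ennreal D * (\<Sum>i\<in>Basis. ennreal (\<bar>\<xi> \<bullet> i\<bar> powr (2 * b)) * w \<xi>)
          + ennreal (\<bar>R\<bar> powr (2 * b)) * ennreal (1 / (1 + Re (\<psi> \<xi>)))"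
    proof (cases "\<rho> \<xi> \<ge> 2 / t")
      case True
      have "ennreal (norm \<xi> powr (2 * b) / (1 + Re (\<psi> \<xi>))) = ennreal (norm \<xi> powr (2 * b)) * w \<xi>"
        using True p by (simp add: w_def high_weight_def ennreal_mult[symmetric])
      also have "\<dots> \<le> ennreal (D * (\<Sum>i\<in>Basis. \<bar>\<xi> \<bullet> i\<bar> powr (2 * b))) * w \<xi>"
        unfolding D_def using b by (intro mult_right_mono ennreal_leI norm_powr_le_sum_Basis) auto
      also have "\<dots> = ennreal D * (\<Sum>i\<in>Basis. ennreal (\<bar>\<xi> \<bullet> i\<bar> powr (2 * b)) * w \<xi>)"
      proof -
        have "ennreal (D * (\<Sum>i\<in>Basis. \<bar>\<xi> \<bullet> i\<bar> powr (2 * b))) = ennreal D * ennreal (\<Sum>i\<in>Basis. \<bar>\<xi> \<bullet> i\<bar> powr (2 * b))"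
          using D by (intro ennreal_mult sum_nonneg) auto
        also have "ennreal (\<Sum>i\<in>Basis. \<bar>\<xi> \<bullet> i\<bar> powr (2 * b)) = (\<Sum>i\<in>Basis. ennreal (\<bar>\<xi> \<bullet> i\<bar> powr (2 * b)))"
          by (intro sum_ennreal[symmetric]) auto
        finally show ?thesis by (simp only: sum_distrib_right mult.assoc)
      qed
      finally show ?thesis by (rule order_trans) simp
    next
      case False
      have "norm \<xi> \<le> \<bar>R\<bar>"
      proof (rule ccontr)
        assume "\<not> norm \<xi> \<le> \<bar>R\<bar>"
        then have "(2 / t)\<^sup>2 \<le> (\<rho> \<xi>)\<^sup>2" using R[of \<xi>] unfolding cmod_psi rho_sq by auto
        then have "2 / t \<le> \<rho> \<xi>" by (rule power2_le_imp_le) (simp add: p)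
        then show False using False by simp
      qed
      then have "norm \<xi> powr (2 * b) \<le> \<bar>R\<bar> powr (2 * b)" using b by (intro powr_mono2) auto
      then have "ennreal (norm \<xi> powr (2 * b) / (1 + Re (\<psi> \<xi>))) \<le> ennreal (\<bar>R\<bar> powr (2 * b) * (1 / (1 + Re (\<psi> \<xi>))))"
        using p by (intro ennreal_leI) (simp add: divide_right_mono)
      also have "\<dots> = ennreal (\<bar>R\<bar> powr (2 * b)) * ennreal (1 / (1 + Re (\<psi> \<xi>)))" using p by (intro ennreal_mult) auto
      finally show ?thesis by (rule order_trans) simp
    qed
  qed
  also have "\<dots> = ennreal D * (\<Sum>i\<in>Basis. \<integral>\<^sup>+\<xi>. ennreal (\<bar>\<xi> \<bullet> i\<bar> powr (2 * b)) * w \<xi> \<partial>\<mu>)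
      + ennreal (\<bar>R\<bar> powr (2 * b)) * (\<integral>\<^sup>+\<xi>. ennreal (1 / (1 + Re (\<psi> \<xi>))) \<partial>\<mu>)"
    by (subst nn_integral_add) (auto simp: nn_integral_cmult nn_integral_sum)
  also have "\<dots> < \<infinity>"
    using dalang coord by (auto simp: dalang_condition_def ennreal_mult_less_top)
  finally show ?thesis using b unfolding spatial_condition_def by blast
qed

end

section \<open>Regularity of the solution\<close>

lemma half_square_diff_le:
  fixes c p q R :: real
  assumes "\<bar>p\<bar> \<le> R" and "\<bar>q\<bar> \<le> R"
  shows "\<bar>c / 2 * p\<^sup>2 - c / 2 * q\<^sup>2\<bar> \<le> \<bar>c\<bar> * R * \<bar>p - q\<bar>"
proof -
  have "c / 2 * p\<^sup>2 - c / 2 * q\<^sup>2 = c / 2 * ((p + q) * (p - q))"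
    by (simp add: power2_eq_square algebra_simps)
  then have "\<bar>c / 2 * p\<^sup>2 - c / 2 * q\<^sup>2\<bar> = \<bar>c\<bar> / 2 * (\<bar>p + q\<bar> * \<bar>p - q\<bar>)"
    by (simp only: abs_mult abs_divide abs_numeral)
  also have "\<dots> \<le> \<bar>c\<bar> / 2 * ((2 * R) * \<bar>p - q\<bar>)"
    using assms by (intro mult_left_mono mult_right_mono) auto
  finally show ?thesis by simp
qed

context wave_convolution begin

lemma temporal_hoelder:
  assumes cond: "temporal_condition \<psi> \<mu>"
    and u: "\<And>t \<omega>. t \<ge> 0 \<Longrightarrow> \<omega> \<in> space M \<Longrightarrow> u t \<omega> = c / 2 * t\<^sup>2 + W t x \<omega>"
  shows "as_locally_hoelder M {0..} u"
proof -
  obtain a where a: "0 < a" "a < 1"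
    and Ia: "(\<integral>\<^sup>+\<xi>. ennreal (cmod (\<psi> \<xi>) powr a / (1 + Re (\<psi> \<xi>))) \<partial>\<mu>) < \<infinity>"
    using cond by (auto simp: temporal_condition_def)
  have I: "(\<integral>\<^sup>+\<xi>. ennreal ((1 + Re (\<psi> \<xi>) powr a) / (1 + Re (\<psi> \<xi>))) \<partial>\<mu>) < \<infinity>"
  proof -
    have "(\<integral>\<^sup>+\<xi>. ennreal ((1 + Re (\<psi> \<xi>) powr a) / (1 + Re (\<psi> \<xi>))) \<partial>\<mu>)
        = (\<integral>\<^sup>+\<xi>. ennreal (1 / (1 + Re (\<psi> \<xi>))) + ennreal (cmod (\<psi> \<xi>) powr a / (1 + Re (\<psi> \<xi>))) \<partial>\<mu>)"
    proof (intro nn_integral_cong)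
      fix \<xi>
      show "ennreal ((1 + Re (\<psi> \<xi>) powr a) / (1 + Re (\<psi> \<xi>)))
          = ennreal (1 / (1 + Re (\<psi> \<xi>))) + ennreal (cmod (\<psi> \<xi>) powr a / (1 + Re (\<psi> \<xi>)))"
        using Re_psi[of \<xi>] unfolding cmod_psi add_divide_distrib by (intro ennreal_plus) auto
    qed
    also have "\<dots> = (\<integral>\<^sup>+\<xi>. ennreal (1 / (1 + Re (\<psi> \<xi>))) \<partial>\<mu>) + (\<integral>\<^sup>+\<xi>. ennreal (cmod (\<psi> \<xi>) powr a / (1 + Re (\<psi> \<xi>))) \<partial>\<mu>)"
      unfolding cmod_psi by (intro nn_integral_add) measurable
    also have "\<dots> < \<infinity>" using Ia dalang by (simp add: dalang_condition_def)
    finally show ?thesis .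
  qed
  show ?thesis
  proof (rule as_locally_hoelder_gaussian[where Z = "\<lambda>t. W t x" and \<kappa> = a and r = "\<lambda>t. max 0 t" and g = "\<lambda>t. c / 2 * t\<^sup>2"])
    fix R :: nat
    obtain C where C: "C \<ge> 0" "\<forall>t\<^sub>1\<in>{0..real R}. \<forall>t\<^sub>2\<in>{0..real R}. \<forall>x. incr_var t\<^sub>1 x t\<^sub>2 x \<le> C * \<bar>t\<^sub>1 - t\<^sub>2\<bar> powr (2 * a)"
      using temporal_incr_le[OF a _ I, of "real R"] by auto
    then show "\<exists>C\<ge>0. \<forall>p\<in>{0..} \<inter> cball 0 (real R). \<forall>q\<in>{0..} \<inter> cball 0 (real R).
        (LINT \<omega>|M. (W p x \<omega> - W q x \<omega>)\<^sup>2) \<le> C * dist p q powr (2 * a)"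
      by (intro exI[of _ C]) (auto simp: incr_var_def dist_real_def)
    have "\<bar>c / 2 * p\<^sup>2 - c / 2 * q\<^sup>2\<bar> \<le> (\<bar>c\<bar> * real R) * dist p q"
      if "p \<in> {0..} \<inter> cball 0 (real R)" "q \<in> {0..} \<inter> cball 0 (real R)" for p q
    proof -
      have "\<bar>p\<bar> \<le> real R" "\<bar>q\<bar> \<le> real R" using that by auto
      then show ?thesis using half_square_diff_le[of p "real R" q c] by (simp only: dist_real_def)
    qed
    then show "\<exists>L. \<forall>p\<in>{0..} \<inter> cball 0 (real R). \<forall>q\<in>{0..} \<inter> cball 0 (real R). \<bar>c / 2 * p\<^sup>2 - c / 2 * q\<^sup>2\<bar> \<le> L * dist p q"
      by blast
    show "W t x \<in> borel_measurable M" if "t \<in> {0..}" for t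
      using centered_gaussian_field_convolution[OF conv, of t x] that by (simp add: centered_gaussian_def)
    show "centered_gaussian M (\<lambda>\<omega>. W p x \<omega> - W q x \<omega>)" if "p \<in> {0..}" "q \<in> {0..}" for p q
      using that by (intro centered_gaussian_convolution_diff[OF prob conv]) auto
  qed (use prob a u in \<open>auto simp: dist_real_def\<close>)
qed

text \<open>
  The base point is \<open>t = 1\<close>: the lower bound on the temporal increments uses the noise before the
  smaller of the two times, so it would degenerate at time 0.
\<close>

lemma not_temporal_hoelder:
  assumes cond: "\<not> temporal_condition \<psi> \<mu>"
    and u: "\<And>t \<omega>. t \<ge> 0 \<Longrightarrow> \<omega> \<in> space M \<Longrightarrow> u t \<omega> = c / 2 * t\<^sup>2 + W t x \<omega>"
  shows "as_not_locally_hoelder M {0..} u"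
proof (rule as_not_locally_hoelder_gaussian[OF prob,
    where K = "{0..2}" and P = "range (\<lambda>n::nat. 1 + 1 / 2 ^ n)" and ?p0.0 = 1 and Z = "\<lambda>t. W t x"
      and g = "\<lambda>t. c / 2 * t\<^sup>2" and L = "2 * \<bar>c\<bar>"])
  have le1: "1 / 2 ^ n \<le> (1::real)" for n :: nat by simp
  show "range (\<lambda>n::nat. 1 + 1 / 2 ^ n) \<subseteq> {0..2::real}" using le1 by (auto intro: add_nonneg_nonneg)
  show "centered_gaussian M (\<lambda>\<omega>. W p x \<omega> - W 1 x \<omega>)" if "p \<in> range (\<lambda>n::nat. 1 + 1 / 2 ^ n)" for p
    using that by (intro centered_gaussian_convolution_diff[OF prob conv]) (auto intro: add_nonneg_nonneg)
  show "\<bar>c / 2 * p\<^sup>2 - c / 2 * 1\<^sup>2\<bar> \<le> 2 * \<bar>c\<bar> * dist p 1" if "p \<in> range (\<lambda>n::nat. 1 + 1 / 2 ^ n)" for p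
  proof -
    have "\<bar>p\<bar> \<le> 2" using that le1 by auto
    then show ?thesis using half_square_diff_le[of p 2 1 c] by (simp add: dist_real_def mult.commute)
  qed
  show "\<exists>p\<in>range (\<lambda>n::nat. 1 + 1 / 2 ^ n). dist p 1 > 0 \<and>
      (LINT \<omega>|M. (W p x \<omega> - W 1 x \<omega>)\<^sup>2) > B * dist p 1 powr (2 / real m)" if m: "0 < m" for m B
  proof (rule ccontr)
    assume *: "\<not> ?thesis"
    have "incr_var (1 + 1 / 2 ^ n) x 1 x \<le> B * (1 / 2 ^ n) powr (2 / real m)" for n
      using * by (force simp: incr_var_def dist_real_def not_less)
    then have "temporal_condition \<psi> \<mu>" using temporal_condition_of_incr_bound[OF m] by blast
    then show False using cond by simp
  qed
qed (use u in \<open>auto simp: dist_real_def\<close>)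

text \<open>
  By the quadratic growth of \<open>\<psi>\<close>, the exponent \<open>b\<close> of the spatial condition also serves in the temporal one.
  A joint increment is split at \<open>(s, x)\<close> into a temporal and a spatial one.
\<close>

lemma joint_hoelder:
  assumes cond: "spatial_condition \<psi> \<mu>"
    and growth: "\<And>\<xi>. Re (\<psi> \<xi>) \<le> G * (1 + (norm \<xi>)\<^sup>2)" and G: "G \<ge> 0"
    and u: "\<And>t x \<omega>. t \<ge> 0 \<Longrightarrow> \<omega> \<in> space M \<Longrightarrow> u t x \<omega> = c / 2 * t\<^sup>2 + W t x \<omega>"
  shows "as_locally_hoelder M ({0..} \<times> UNIV) (\<lambda>(t, x). u t x)"
proof -
  obtain b where b: "0 < b" "b < 1"
    and Ib: "(\<integral>\<^sup>+\<xi>. ennreal (norm \<xi> powr (2 * b) / (1 + Re (\<psi> \<xi>))) \<partial>\<mu>) < \<infinity>"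
    using cond by (auto simp: spatial_condition_def)
  define A where "A = 1 + 2 * G powr b"
  have A: "A \<ge> 0" by (simp add: A_def)
  have I: "(\<integral>\<^sup>+\<xi>. ennreal ((1 + Re (\<psi> \<xi>) powr b) / (1 + Re (\<psi> \<xi>))) \<partial>\<mu>) < \<infinity>"
  proof -
    have "(\<integral>\<^sup>+\<xi>. ennreal ((1 + Re (\<psi> \<xi>) powr b) / (1 + Re (\<psi> \<xi>))) \<partial>\<mu>)
        \<le> (\<integral>\<^sup>+\<xi>. ennreal A * (ennreal (1 / (1 + Re (\<psi> \<xi>))) + ennreal (norm \<xi> powr (2 * b) / (1 + Re (\<psi> \<xi>)))) \<partial>\<mu>)"
    proof (intro nn_integral_mono)
      fix \<xi> :: 'a
      have p: "Re (\<psi> \<xi>) \<ge> 0" by (rule Re_psi)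
      have "Re (\<psi> \<xi>) powr b \<le> (G * (1 + (norm \<xi>)\<^sup>2)) powr b"
        using p b growth by (intro powr_mono2) auto
      also have "\<dots> = G powr b * (1 + (norm \<xi>)\<^sup>2) powr b" by (rule powr_mult)
      also have "\<dots> \<le> G powr b * (2 * (1 + ((norm \<xi>)\<^sup>2) powr b))"
        using b by (intro mult_left_mono one_plus_powr_le) auto
      also have "((norm \<xi>)\<^sup>2) powr b = norm \<xi> powr (2 * b)"
        by (cases "\<xi> = 0") (simp_all add: powr_powr[symmetric])
      finally have "1 + Re (\<psi> \<xi>) powr b \<le> 1 + G powr b * (2 * (1 + norm \<xi> powr (2 * b)))" by simp
      also have "\<dots> \<le> A * (1 + norm \<xi> powr (2 * b))" by (simp add: A_def algebra_simps)
      finally have "(1 + Re (\<psi> \<xi>) powr b) / (1 + Re (\<psi> \<xi>)) \<le> A * (1 + norm \<xi> powr (2 * b)) / (1 + Re (\<psi> \<xi>))"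
        using p by (intro divide_right_mono) auto
      also have "\<dots> = A * (1 / (1 + Re (\<psi> \<xi>)) + norm \<xi> powr (2 * b) / (1 + Re (\<psi> \<xi>)))"
        by (simp add: add_divide_distrib[symmetric])
      finally have "ennreal ((1 + Re (\<psi> \<xi>) powr b) / (1 + Re (\<psi> \<xi>)))
          \<le> ennreal (A * (1 / (1 + Re (\<psi> \<xi>)) + norm \<xi> powr (2 * b) / (1 + Re (\<psi> \<xi>))))"
        by (rule ennreal_leI)
      also have "\<dots> = ennreal A * (ennreal (1 / (1 + Re (\<psi> \<xi>))) + ennreal (norm \<xi> powr (2 * b) / (1 + Re (\<psi> \<xi>))))"
        using A p by (simp only: ennreal_mult ennreal_plus divide_nonneg_nonneg add_nonneg_nonneg zero_le_one powr_ge_zero)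
      finally show "ennreal ((1 + Re (\<psi> \<xi>) powr b) / (1 + Re (\<psi> \<xi>)))
          \<le> ennreal A * (ennreal (1 / (1 + Re (\<psi> \<xi>))) + ennreal (norm \<xi> powr (2 * b) / (1 + Re (\<psi> \<xi>))))" .
    qed
    also have "\<dots> = ennreal A * ((\<integral>\<^sup>+\<xi>. ennreal (1 / (1 + Re (\<psi> \<xi>))) \<partial>\<mu>) + (\<integral>\<^sup>+\<xi>. ennreal (norm \<xi> powr (2 * b) / (1 + Re (\<psi> \<xi>))) \<partial>\<mu>))"
      by (subst nn_integral_cmult) (auto simp: nn_integral_add)
    also have "\<dots> < \<infinity>" using Ib dalang by (simp add: dalang_condition_def ennreal_mult_less_top)
    finally show ?thesis .
  qed
  show ?thesis
  proof (rule as_locally_hoelder_gaussian[where Z = "\<lambda>(t, x). W t x" and \<kappa> = b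
      and r = "\<lambda>(t, x). (max 0 t, x)" and g = "\<lambda>(t, x). c / 2 * t\<^sup>2"])
    fix R :: nat
    obtain C1 where C1: "C1 \<ge> 0" "\<And>t\<^sub>1 t\<^sub>2 x. t\<^sub>1 \<in> {0..real R} \<Longrightarrow> t\<^sub>2 \<in> {0..real R} \<Longrightarrow> incr_var t\<^sub>1 x t\<^sub>2 x \<le> C1 * \<bar>t\<^sub>1 - t\<^sub>2\<bar> powr (2 * b)"
      using temporal_incr_le[OF b _ I, of "real R"] by (auto simp del: atLeastAtMost_iff)
    obtain C2 where C2: "C2 \<ge> 0" "\<And>t x y. t \<in> {0..real R} \<Longrightarrow> incr_var t x t y \<le> C2 * norm (x - y) powr (2 * b)"
      using spatial_incr_le[OF b _ Ib, of "real R"] by (auto simp del: atLeastAtMost_iff)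
    have bound: "incr_var t x s y \<le> (2 * C1 + 2 * C2) * dist (t, x) (s, y) powr (2 * b)"
      if ts: "t \<in> {0..real R}" "s \<in> {0..real R}" for t s x y
    proof -
      have "incr_var t x s y \<le> (LINT \<omega>|M. 2 * (W t x \<omega> - W s x \<omega>)\<^sup>2 + 2 * (W s x \<omega> - W s y \<omega>)\<^sup>2)"
        unfolding incr_var_def
      proof (rule integral_mono)
        have sq: "integrable M (\<lambda>\<omega>. (W t x \<omega> - W s y \<omega>)\<^sup>2)" if "t \<ge> 0" "s \<ge> 0" for t s x y
          using that by (intro centered_gaussian_square_integrable[OF prob] centered_gaussian_convolution_diff[OF prob conv])
        show "integrable M (\<lambda>\<omega>. (W t x \<omega> - W s y \<omega>)\<^sup>2)"
          "integrable M (\<lambda>\<omega>. 2 * (W t x \<omega> - W s x \<omega>)\<^sup>2 + 2 * (W s x \<omega> - W s y \<omega>)\<^sup>2)"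
          using ts by (auto intro!: sq)
        fix \<omega>
        have "(p - q)\<^sup>2 \<le> 2 * (p - r)\<^sup>2 + 2 * (r - q)\<^sup>2" for p q r :: real
        proof -
          have "2 * (p - r)\<^sup>2 + 2 * (r - q)\<^sup>2 - (p - q)\<^sup>2 = (p - r - (r - q))\<^sup>2"
            by (simp add: power2_eq_square algebra_simps)
          then show ?thesis by (smt (verit) zero_le_power2)
        qed
        then show "(W t x \<omega> - W s y \<omega>)\<^sup>2 \<le> 2 * (W t x \<omega> - W s x \<omega>)\<^sup>2 + 2 * (W s x \<omega> - W s y \<omega>)\<^sup>2" .
      qed
      also have "\<dots> = 2 * incr_var t x s x + 2 * incr_var s x s y"
        unfolding incr_var_def using ts
        by (subst Bochner_Integration.integral_add)
          (auto intro!: centered_gaussian_square_integrable[OF prob] centered_gaussian_convolution_diff[OF prob conv])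
      also have "\<dots> \<le> 2 * (C1 * dist (t, x) (s, y) powr (2 * b)) + 2 * (C2 * dist (t, x) (s, y) powr (2 * b))"
      proof (intro add_mono mult_left_mono)
        have d1: "\<bar>t - s\<bar> \<le> dist (t, x) (s, y)" using dist_fst_le[of "(t, x)" "(s, y)"] by (simp add: dist_real_def)
        have d2: "norm (x - y) \<le> dist (t, x) (s, y)" using dist_snd_le[of "(t, x)" "(s, y)"] by (simp add: dist_norm)
        show "incr_var t x s x \<le> C1 * dist (t, x) (s, y) powr (2 * b)"
          by (rule order_trans[OF C1(2)[OF ts]]) (use C1(1) b d1 in \<open>auto intro!: mult_left_mono powr_mono2\<close>)
        show "incr_var s x s y \<le> C2 * dist (t, x) (s, y) powr (2 * b)"
          by (rule order_trans[OF C2(2)[OF ts(2)]]) (use C2(1) b d2 in \<open>auto intro!: mult_left_mono powr_mono2\<close>)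
      qed auto
      finally show ?thesis by (simp add: algebra_simps)
    qed
    have slab: "t \<in> {0..real R}" if "(t, x) \<in> ({0..} \<times> UNIV) \<inter> cball (0 :: real \<times> 'a) (real R)" for t x
      using that norm_fst_le[of t x] by auto
    show "\<exists>C\<ge>0. \<forall>p\<in>({0..} \<times> UNIV) \<inter> cball 0 (real R). \<forall>q\<in>({0..} \<times> UNIV) \<inter> cball 0 (real R).
        (LINT \<omega>|M. ((case p of (t, x) \<Rightarrow> W t x) \<omega> - (case q of (t, x) \<Rightarrow> W t x) \<omega>)\<^sup>2) \<le> C * dist p q powr (2 * b)"
    proof (intro exI[of _ "2 * C1 + 2 * C2"] conjI ballI)
      fix p q :: "real \<times> 'a" assume pq: "p \<in> ({0..} \<times> UNIV) \<inter> cball 0 (real R)" "q \<in> ({0..} \<times> UNIV) \<inter> cball 0 (real R)"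
      obtain t x s y where eq: "p = (t, x)" "q = (s, y)" by fastforce
      show "(LINT \<omega>|M. ((case p of (t, x) \<Rightarrow> W t x) \<omega> - (case q of (t, x) \<Rightarrow> W t x) \<omega>)\<^sup>2)
          \<le> (2 * C1 + 2 * C2) * dist p q powr (2 * b)"
        using bound[OF slab[OF pq(1)[unfolded eq]] slab[OF pq(2)[unfolded eq]], of x y] by (simp add: eq incr_var_def)
    qed (use C1 C2 in auto)
    have "\<bar>c / 2 * t\<^sup>2 - c / 2 * s\<^sup>2\<bar> \<le> (\<bar>c\<bar> * real R) * dist (t, x) (s, y)"
      if "t \<in> {0..real R}" "s \<in> {0..real R}" for t s and x y :: 'a
    proof -
      have "\<bar>c / 2 * t\<^sup>2 - c / 2 * s\<^sup>2\<bar> \<le> (\<bar>c\<bar> * real R) * \<bar>t - s\<bar>"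
        using that by (intro half_square_diff_le) auto
      also have "\<dots> \<le> (\<bar>c\<bar> * real R) * dist (t, x) (s, y)"
        using dist_fst_le[of "(t, x)" "(s, y)"] by (intro mult_left_mono) (auto simp: dist_real_def)
      finally show ?thesis .
    qed
    then show "\<exists>L. \<forall>p\<in>({0..} \<times> UNIV) \<inter> cball 0 (real R). \<forall>q\<in>({0..} \<times> UNIV) \<inter> cball 0 (real R).
        \<bar>(case p of (t, x :: 'a) \<Rightarrow> c / 2 * t\<^sup>2) - (case q of (t, x) \<Rightarrow> c / 2 * t\<^sup>2)\<bar> \<le> L * dist p q"
      using slab by (intro exI[of _ "\<bar>c\<bar> * real R"] ballI) (auto simp: case_prod_beta simp del: atLeastAtMost_iff)
    show "(case p of (t, x) \<Rightarrow> W t x) \<in> borel_measurable M" if "p \<in> {0..} \<times> UNIV" for p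
      using that centered_gaussian_field_convolution[OF conv] by (auto simp: centered_gaussian_def)
    show "centered_gaussian M (\<lambda>\<omega>. (case p of (t, x) \<Rightarrow> W t x) \<omega> - (case q of (t, x) \<Rightarrow> W t x) \<omega>)"
      if "p \<in> {0..} \<times> UNIV" "q \<in> {0..} \<times> UNIV" for p q
      using that by (auto intro!: centered_gaussian_convolution_diff[OF prob conv])
    show "dist (case p of (t, x) \<Rightarrow> (max 0 t, x)) (case q of (t, x) \<Rightarrow> (max 0 t, x)) \<le> dist p q" for p q :: "real \<times> 'a"
    proof -
      have "dist (max 0 (fst p)) (max 0 (fst q)) \<le> dist (fst p) (fst q)" by (simp add: dist_real_def)
      then show ?thesis by (auto simp: case_prod_beta dist_prod_def intro!: add_mono power_mono)
    qed
  qed (use prob b u in \<open>auto simp: zero_prod_def\<close>)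
qed

lemma not_spatial_hoelder:
  assumes cond: "\<not> spatial_condition \<psi> \<mu>" and t: "t > 0"
    and lim: "filterlim \<psi> at_infinity at_infinity"
    and u: "\<And>x \<omega>. \<omega> \<in> space M \<Longrightarrow> u x \<omega> = c / 2 * t\<^sup>2 + W t x \<omega>"
  shows "as_not_locally_hoelder M UNIV u"
proof (rule as_not_locally_hoelder_gaussian[OF prob,
    where K = "cball 0 1" and P = "(\<lambda>(n, i). (1 / 2 ^ n) *\<^sub>R i) ` ((UNIV :: nat set) \<times> Basis)" and ?p0.0 = 0 and Z = "\<lambda>x. W t x"
      and g = "\<lambda>x. c / 2 * t\<^sup>2" and L = 0])
  show "\<exists>p\<in>(\<lambda>(n, i). (1 / 2 ^ n) *\<^sub>R i) ` ((UNIV :: nat set) \<times> Basis). dist p 0 > 0 \<and>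
      (LINT \<omega>|M. (W t p \<omega> - W t 0 \<omega>)\<^sup>2) > B * dist p 0 powr (2 / real m)" if m: "0 < m" for m B
  proof (rule ccontr)
    assume *: "\<not> ?thesis"
    have "incr_var t ((1 / 2 ^ n) *\<^sub>R i) t 0 \<le> B * (1 / 2 ^ n) powr (2 / real m)" if "i \<in> Basis" for n i
      using * that by (force simp: incr_var_def not_less)
    then have "spatial_condition \<psi> \<mu>" using spatial_condition_of_incr_bound[OF m t lim] by blast
    then show False using cond by simp
  qed
  show "countable ((\<lambda>(n, i). (1 / 2 ^ n) *\<^sub>R i) ` ((UNIV :: nat set) \<times> (Basis :: 'a set)))"
    by (intro countable_image countable_SIGMA) (auto intro: countable_finite)
qed (use u t in \<open>auto intro!: centered_gaussian_convolution_diff[OF prob conv]\<close>)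

end

lemma drift_integral:
  assumes "t \<ge> 0" and "\<psi> 0 = 0"
  shows "(LINT s:{0..t}|lborel. phi_hat \<psi> s 0) = complex_of_real (t\<^sup>2 / 2)"
proof -
  have "(LINT s:{0..t}|lborel. phi_hat \<psi> s 0) = (LINT s|lborel. complex_of_real (indicator {0..t} s * s))"
    unfolding set_lebesgue_integral_def using assms(2)
    by (intro Bochner_Integration.integral_cong) (auto simp: phi_hat_def csinc_def indicator_def)
  also have "\<dots> = complex_of_real (LINT s|lborel. indicator {0..t} s * s)"
    by (rule integral_complex_of_real)
  also have "(LINT s|lborel. indicator {0..t} s * s) = t\<^sup>2 / 2 - 0\<^sup>2 / 2"
  proof -
    have "((\<lambda>s. s\<^sup>2 / 2) has_real_derivative x) (at x)" for x :: real
      by (auto intro!: derivative_eq_intros)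
    then have "(LINT s|lborel. s * indicator {0..t} s) = t\<^sup>2 / 2 - 0\<^sup>2 / 2"
      using assms(1) by (intro integral_FTC_Icc_real) auto
    then show ?thesis by (simp only: mult.commute)
  qed
  finally show ?thesis by simp
qed

theorem theorem1p2:
  fixes N :: "'v measure" and X :: "real \<Rightarrow> 'v \<Rightarrow> 'a::euclidean_space"
    and \<psi> :: "'a \<Rightarrow> complex" and \<Gamma> \<mu> :: "'a measure"
    and M :: "'w measure" and F :: "(real \<times> 'a \<Rightarrow> real) \<Rightarrow> 'w \<Rightarrow> real"
    and c :: real and u :: "real \<Rightarrow> 'a \<Rightarrow> 'w \<Rightarrow> real"
  assumes "levy_process N X" and "symmetric_process N X"
    and "characteristic_exponent N X \<psi>"
    and "genuinely_full_dimensional \<psi>"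
    and "filterlim \<psi> at_infinity at_infinity"
    and "tempered_measure \<Gamma>" and "nonneg_definite_measure \<Gamma>"
    and "spectral_measure \<Gamma> \<mu>"
    and "dalang_condition \<psi> \<mu>"
    and "white_in_time_noise M \<Gamma> F"
    and "random_field_solution M \<psi> \<mu> F c u"
  shows "(temporal_condition \<psi> \<mu> \<longrightarrow>
            (\<forall>x. as_locally_hoelder M {0..} (\<lambda>t. u t x))) \<and>
         (\<not> temporal_condition \<psi> \<mu> \<longrightarrow>
            (\<forall>x. as_not_locally_hoelder M {0..} (\<lambda>t. u t x))) \<and>
         (spatial_condition \<psi> \<mu> \<longrightarrow>
            as_locally_hoelder M ({0..} \<times> UNIV) (\<lambda>(t, x). u t x)) \<and>
         (\<not> spatial_condition \<psi> \<mu> \<longrightarrow>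
            (\<forall>t>0. as_not_locally_hoelder M UNIV (\<lambda>x. u t x)))"
proof -
  note levy = assms(1-3)
  obtain W where conv: "stochastic_convolution M \<psi> \<mu> F W"
    and u: "\<And>t x \<omega>. t \<ge> 0 \<Longrightarrow> \<omega> \<in> space M \<Longrightarrow> complex_of_real (u t x \<omega>) =
      complex_of_real c * (LINT s:{0..t}|lborel. phi_hat \<psi> s 0) + complex_of_real (W t x \<omega>)"
    using assms(11) unfolding random_field_solution_def by blast
  interpret wave_convolution M \<psi> \<mu> F W
  proof (rule wave_convolution.intro)
    show "prob_space M" using assms(10) by (simp add: white_in_time_noise_def)
    show "stochastic_convolution M \<psi> \<mu> F W" by (rule conv)
    show "Im (\<psi> \<xi>) = 0" for \<xi> by (rule symmetric_exponent_Im[OF levy])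
    show "Re (\<psi> \<xi>) \<ge> 0" for \<xi> by (rule symmetric_exponent_nonneg[OF levy])
    show "(\<lambda>\<xi>. Re (\<psi> \<xi>)) \<in> borel_measurable borel"
      by (rule borel_measurable_continuous_onI[OF symmetric_exponent_continuous[OF levy]])
    show "tempered_measure \<mu>" using assms(8) by (simp add: spectral_measure_def)
  qed (rule assms(9))
  have psi0: "\<psi> 0 = 0"
  proof -
    interpret N: prob_space N using assms(1) by (simp add: levy_process_def)
    have "exp (- Re (\<psi> 0)) = 1"
      using symmetric_exponent_cos[OF levy, of 1 0] by (simp add: N.prob_space)
    then show ?thesis using Im_psi[of 0] by (simp add: complex_eq_iff)
  qed
  have u': "u t x \<omega> = c / 2 * t\<^sup>2 + W t x \<omega>" if "t \<ge> 0" "\<omega> \<in> space M" for t x \<omega>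
  proof -
    have "complex_of_real (u t x \<omega>) = complex_of_real (c / 2 * t\<^sup>2 + W t x \<omega>)"
      using u[OF that, of x] drift_integral[where \<psi> = \<psi>, OF that(1) psi0] by simp
    then show ?thesis by (simp only: of_real_eq_iff)
  qed
  obtain G where G: "G \<ge> 0" "\<And>\<xi>. Re (\<psi> \<xi>) \<le> G * (1 + (norm \<xi>)\<^sup>2)"
    using symmetric_exponent_quadratic_growth[OF levy] by blast
  show ?thesis
  proof (intro conjI impI allI)
    show "as_locally_hoelder M {0..} (\<lambda>t. u t x)" if "temporal_condition \<psi> \<mu>" for x
      by (rule temporal_hoelder[OF that]) (rule u')
    show "as_not_locally_hoelder M {0..} (\<lambda>t. u t x)" if "\<not> temporal_condition \<psi> \<mu>" for x
      by (rule not_temporal_hoelder[OF that]) (rule u')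
    show "as_locally_hoelder M ({0..} \<times> UNIV) (\<lambda>(t, x). u t x)" if "spatial_condition \<psi> \<mu>"
      by (rule joint_hoelder[OF that G(2) G(1)]) (rule u')
    show "as_not_locally_hoelder M UNIV (\<lambda>x. u t x)" if "\<not> spatial_condition \<psi> \<mu>" "0 < t" for t
      by (rule not_spatial_hoelder[where c = c, OF that assms(5)]) (rule u'[OF less_imp_le[OF that(2)]])
  qed
qed

end
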